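(* Let $\Phi^\star=(\phi_\nu^\star,\phi_b^\star,\lambda_g^\star)\in E$ be a solution (maximizer) of the dual problem $$\sup_{\Phi\in E}\;-\mathcal{F}^\star(-\Phi)-\mathcal{G}^\star(\Delta\Phi),$$ and let $\mathbb{P}^{h,\star}$ be the measure on $\Omega^h$ induced by $\Phi^\star$ through $$\frac{d\mathbb{P}^{h,\star}}{d\overline{\mathbb{P}}^h}=\exp\left(\frac{\Delta\Phi^\star}{h}\right).$$ If the constraint functions $M_k$ ($0\le k\le N_T$) and $C_i$ ($1\le i\le N_C$) are finite under $\mathbb{P}^{h,\star}$, i.e. finite at the marginals $\nu_k$ and at the prices $g_i$ of $\mathbb{P}^{h,\star}$, then $\mathbb{P}^{h,\star}$ is the optimal solution of the primal problem $$\min_{\mathbb{P}}\;\mathcal{F}(\Delta^\dagger\mathbb{P})+\mathcal{G}(\mathbb{P}).$$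
   Context: Let $N_T,N_C,K\ge1$ be integers, $h>0$ the time step, $\mathcal{X}_k$ ($0\le k\le N_T$) the space of values at time step $k$ (e.g. $\mathbb{R}$ or a subset), and $\Omega^h=\prod_{k=0}^{N_T}\mathcal{X}_k$ the space of discrete paths $(x_0,\dots,x_{N_T})$ with canonical process $(X_k)$. The reference measure $\overline{\mathbb{P}}^h$ is a probability measure on $\Omega^h$, namely the law of an Euler–Maruyama chain $Y_{k+1}=Y_k+\overline\mu(Y_k,kh)h+\overline\sigma(Y_k,kh)h^{1/2}Z_k$, with $Z_k$ i.i.d. standard normal and $Y_0\sim\rho_0$. Let $B$ be an $\mathbb{R}^K$-valued function of two consecutive states $(x_k,x_{k+1})$, and for $i=1,\dots,N_C$ let $G_i$ be a real payoff function of the state at a grid time step $\tau_i\in\{0,\dots,N_T\}$; they are such that the operator $\Delta$ below maps $E$ into $C_b(\Omega^h)$. For a finite nonnegative measure $\mathbb{P}$ on $\Omega^h$ put $\Delta^\dagger\mathbb{P}=(\nu_k,\nu_kb_k,g_i)$, where $\nu_k=X_k\#\mathbb{P}$ is the $k$-th marginal ($0\le k\le N_T$), $\nu_kb_k$ is the $\mathbb{R}^K$-valued measure on $\mathcal{X}_k$ with $(\nu_kb_k)(dx_k)=\frac1h\int B(x_k,x_{k+1})\,\mathbb{P}_{k,k+1}(dx_k,dx_{k+1})$ (integration in $x_{k+1}$, $\mathbb{P}_{k,k+1}$ the joint law of $(X_k,X_{k+1})$, $0\le k\le N_T-1$), and $g_i=\int G_i(x_{\tau_i})\,d\mathbb{P}$.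 Let $E=\prod_{k=0}^{N_T}C_b(\mathcal{X}_k)\times\prod_{k=0}^{N_T-1}C_b(\mathcal{X}_k;\mathbb{R}^K)\times\mathbb{R}^{N_C}$, with elements $\Phi=(\phi_{\nu_k},\phi_{b_k},\lambda_{g_i})$, paired with triples $(\nu,p,g)$ of finite signed measures $\nu_k\in\mathcal{M}(\mathcal{X}_k)$, $p_k\in\mathcal{M}(\mathcal{X}_k)^K$ and reals $g_i$ by $$\langle\Phi,(\nu,p,g)\rangle=h\sum_{k=0}^{N_T}\int\phi_{\nu_k}\,d\nu_k+h\sum_{k=0}^{N_T-1}\int\phi_{b_k}\cdot dp_k+\sum_{i=1}^{N_C}\lambda_{g_i}g_i.$$ The adjoint of $\Delta^\dagger$ is the operator $\Delta:E\to C_b(\Omega^h)$, $$\Delta\Phi(x_0,\dots,x_{N_T})=\sum_{k=0}^{N_T}h\,\phi_{\nu_k}(x_k)+\sum_{k=0}^{N_T-1}B(x_k,x_{k+1})\cdot\phi_{b_k}(x_k)+\sum_{i=1}^{N_C}\lambda_{g_i}G_i(x_{\tau_i}).$$ The functional $\mathcal{G}$ is $\mathcal{G}(\mathbb{P})=h\,\mathrm{KL}(\mathbb{P}|\overline{\mathbb{P}}^h)$, where $\mathrm{KL}(\mathbb{P}|\overline{\mathbb{P}}^h)=\int\big(\log\frac{d\mathbb{P}}{d\overline{\mathbb{P}}^h}-1\big)d\mathbb{P}$ if $\mathbb{P}\ll\overline{\mathbb{P}}^h$ and $+\infty$ otherwise; its Legendre transform is $\mathcal{G}^\star(f)=h\,\mathbb{E}_{\overline{\mathbb{P}}^h}[\exp(f/h)]$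 for $f\in C_b(\Omega^h)$. The primal minimization is over finite nonnegative measures $\mathbb{P}$ on $\Omega^h$. The functional $\mathcal{F}$ is $$\mathcal{F}(\nu,p,g)=\sum_{k=0}^{N_T-1}\mathcal{F}_{\mathrm{mom},k}(\nu_k,p_k)+\sum_{k=0}^{N_T}M_k(\nu_k)+\sum_{i=1}^{N_C}C_i(g_i),$$ with $\mathcal{F}_{\mathrm{mom},k},M_k,C_i$ convex and lower semicontinuous (for the weak topology given by the pairing) with values in $\mathbb{R}\cup\{+\infty\}$, and $\mathcal{F}$ proper. Its Legendre transform is $\mathcal{F}^\star(\Phi)=\sup_{(\nu,p,g)}\langle\Phi,(\nu,p,g)\rangle-\mathcal{F}(\nu,p,g)$. *)

theory Defs
  imports "HOL-Probability.Probability"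
begin

section \<open>Finite signed and vector-valued measures\<close>

text \<open>
  A finite signed measure on \<open>S\<close> is a countably additive set function with values in the reals;
  with values in \<open>real ^ 'k\<close> it is a vector of finite signed measures.  Set functions vanish
  outside the \<open>\<sigma>\<close>-algebra, so that equality of set functions is equality of measures.  Additivity
  over the constant sequence of empty sets yields the value 0 at the empty set.
\<close>

definition vector_measures :: "'a measure \<Rightarrow> ('a set \<Rightarrow> 'b::real_normed_vector) set" where
  "vector_measures S = {\<mu>.
     (\<forall>A :: nat \<Rightarrow> 'a set. range A \<subseteq> sets S \<longrightarrow> disjoint_family A \<longrightarrow>
        (\<lambda>n. \<mu> (A n)) sums \<mu> (\<Union>n. A n)) \<and>
     (\<forall>A. A \<notin> sets S \<longrightarrow> \<mu> A = 0)}"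

text \<open>
  The positive part of the Jordan decomposition.  The truncation of negative values by
  \<^const>\<open>ennreal\<close> is harmless because the empty set is among the \<open>B\<close>.
\<close>

definition positive_variation :: "'a measure \<Rightarrow> ('a set \<Rightarrow> real) \<Rightarrow> 'a measure" where
  "positive_variation S \<mu> =
     measure_of (space S) (sets S) (\<lambda>A. \<Squnion>B\<in>{B \<in> sets S. B \<subseteq> A}. ennreal (\<mu> B))"

definition signed_integral :: "'a measure \<Rightarrow> ('a set \<Rightarrow> real) \<Rightarrow> ('a \<Rightarrow> real) \<Rightarrow> real" where
  "signed_integral S \<mu> f =
     (\<integral>x. f x \<partial>positive_variation S \<mu>) - (\<integral>x. f x \<partial>positive_variation S (\<lambda>A. - \<mu> A))"

definition vector_integral ::
  "'a measure \<Rightarrow> ('a set \<Rightarrow> real ^ 'k) \<Rightarrow> ('a \<Rightarrow> real ^ 'k) \<Rightarrow> real" where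
  "vector_integral S p \<psi> = (\<Sum>j\<in>UNIV. signed_integral S (\<lambda>A. p A $ j) (\<lambda>x. \<psi> x $ j))"

section \<open>Extended-real-valued convex analysis\<close>

definition Cb :: "'a::topological_space set \<Rightarrow> ('a \<Rightarrow> 'b::real_normed_vector) set" where
  "Cb X = {f. continuous_on X f \<and> bounded (f ` X)}"

definition weak_topology :: "'u set \<Rightarrow> ('u \<Rightarrow> real) set \<Rightarrow> 'u topology" where
  "weak_topology V L =
     topology_generated_by (insert V {{u \<in> V. l u \<in> U} | l U. l \<in> L \<and> open U})"

definition lsc_on :: "'u topology \<Rightarrow> ('u \<Rightarrow> ereal) \<Rightarrow> bool" where
  "lsc_on T f \<longleftrightarrow> (\<forall>a. openin T {u \<in> topspace T. a < f u})"

text \<open>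
  There is no vector space structure on set functions in the library, so the convex combination
  \<open>(1 - t) u + t v\<close> is passed as the parameter \<open>comb t u v\<close>.
\<close>

definition convex_fun :: "(real \<Rightarrow> 'u \<Rightarrow> 'u \<Rightarrow> 'u) \<Rightarrow> 'u set \<Rightarrow> ('u \<Rightarrow> ereal) \<Rightarrow> bool" where
  "convex_fun comb V f \<longleftrightarrow> (\<forall>u\<in>V. \<forall>v\<in>V. \<forall>t\<in>{0..1}.
     f (comb t u v) \<le> ereal (1 - t) * f u + ereal t * f v)"

definition comb_real :: "real \<Rightarrow> real \<Rightarrow> real \<Rightarrow> real" where
  "comb_real t x y = (1 - t) * x + t * y"

definition comb_measure ::
  "real \<Rightarrow> ('a set \<Rightarrow> 'b::real_vector) \<Rightarrow> ('a set \<Rightarrow> 'b) \<Rightarrow> 'a set \<Rightarrow> 'b" where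
  "comb_measure t \<mu> \<mu>' = (\<lambda>A. (1 - t) *\<^sub>R \<mu> A + t *\<^sub>R \<mu>' A)"

definition comb_pair ::
  "real \<Rightarrow> ('a set \<Rightarrow> 'b::real_vector) \<times> ('a set \<Rightarrow> 'c::real_vector)
     \<Rightarrow> ('a set \<Rightarrow> 'b) \<times> ('a set \<Rightarrow> 'c) \<Rightarrow> ('a set \<Rightarrow> 'b) \<times> ('a set \<Rightarrow> 'c)" where
  "comb_pair t u v = (comb_measure t (fst u) (fst v), comb_measure t (snd u) (snd v))"

definition legendre :: "('y \<Rightarrow> 'u \<Rightarrow> real) \<Rightarrow> 'u set \<Rightarrow> ('u \<Rightarrow> ereal) \<Rightarrow> 'y \<Rightarrow> ereal" where
  "legendre pair V f y = (\<Squnion>u\<in>V. ereal (pair y u) - f u)"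

section \<open>Discrete paths and the reference chain\<close>

text \<open>
  The state spaces \<open>X k\<close> are arbitrary subsets, with subspace topology and trace Borel
  \<open>\<sigma>\<close>-algebra, of a Euclidean space \<open>'a\<close>, for instance the reals.
\<close>

abbreviation state_space :: "(nat \<Rightarrow> 'a::euclidean_space set) \<Rightarrow> nat \<Rightarrow> 'a measure" where
  "state_space X k \<equiv> restrict_space borel (X k)"

abbreviation paths :: "nat \<Rightarrow> (nat \<Rightarrow> 'a set) \<Rightarrow> (nat \<Rightarrow> 'a) set" where
  "paths N X \<equiv> PiE {..N} X"

abbreviation path_space ::
  "nat \<Rightarrow> (nat \<Rightarrow> 'a::euclidean_space set) \<Rightarrow> (nat \<Rightarrow> 'a) measure" where
  "path_space N X \<equiv> PiM {..N} (state_space X)"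

text \<open>
  The diffusion coefficient acts as a linear map on the noise; for \<open>'a = real\<close> this is
  multiplication by a scalar.  The independence clause makes the initial value and all the noise
  variables jointly independent.
\<close>

definition euler_maruyama_chain ::
  "'w measure \<Rightarrow> nat \<Rightarrow> (nat \<Rightarrow> 'a::euclidean_space set) \<Rightarrow> real
     \<Rightarrow> ('a \<Rightarrow> real \<Rightarrow> 'a) \<Rightarrow> ('a \<Rightarrow> real \<Rightarrow> 'a \<Rightarrow>\<^sub>L 'a) \<Rightarrow> 'a measure
     \<Rightarrow> (nat \<Rightarrow> 'w \<Rightarrow> 'a) \<Rightarrow> (nat \<Rightarrow> 'w \<Rightarrow> 'a) \<Rightarrow> bool" where
  "euler_maruyama_chain W N X h \<mu> \<sigma> \<rho> Z Y \<longleftrightarrow>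
     prob_space W \<and>
     (\<forall>k<N. distributed W lborel (Z k) (\<lambda>z. \<Prod>b\<in>Basis. ennreal (std_normal_density (z \<bullet> b)))) \<and>
     (\<forall>k\<le>N. Y k \<in> W \<rightarrow>\<^sub>M state_space X k) \<and>
     distr W borel (Y 0) = \<rho> \<and>
     prob_space.indep_vars W (\<lambda>_. borel) (\<lambda>k. case k of 0 \<Rightarrow> Y 0 | Suc j \<Rightarrow> Z j) {..N} \<and>
     (\<forall>k<N. \<forall>\<omega>\<in>space W.
        Y (Suc k) \<omega> = Y k \<omega> + h *\<^sub>R \<mu> (Y k \<omega>) (real k * h)
                     + sqrt h *\<^sub>R blinfun_apply (\<sigma> (Y k \<omega>) (real k * h)) (Z k \<omega>))"

definition path_law ::
  "'w measure \<Rightarrow> nat \<Rightarrow> (nat \<Rightarrow> 'a::euclidean_space set) \<Rightarrow> (nat \<Rightarrow> 'w \<Rightarrow> 'a)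
     \<Rightarrow> (nat \<Rightarrow> 'a) measure" where
  "path_law W N X Y = distr W (path_space N X) (\<lambda>\<omega>. \<lambda>k\<in>{..N}. Y k \<omega>)"

definition path_measures ::
  "nat \<Rightarrow> (nat \<Rightarrow> 'a::euclidean_space set) \<Rightarrow> (nat \<Rightarrow> 'a) measure set" where
  "path_measures N X = {P. sets P = sets (path_space N X) \<and> finite_measure P}"

section \<open>The operators and the pairing\<close>

text \<open>
  Potentials \<open>(\<phi>, \<psi>, l)\<close> and triples \<open>(\<nu>, p, g)\<close> are indexed by all natural numbers; only the
  indices \<open>k \<le> N\<close> of \<open>\<phi>\<close> and \<open>\<nu>\<close>, \<open>k < N\<close> of \<open>\<psi>\<close> and \<open>p\<close>, and \<open>1 \<le> i \<le> NC\<close> of \<open>l\<close> and \<open>g\<close> matter.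
\<close>

type_synonym ('a, 'k) potential =
  "(nat \<Rightarrow> 'a \<Rightarrow> real) \<times> (nat \<Rightarrow> 'a \<Rightarrow> real ^ 'k) \<times> (nat \<Rightarrow> real)"

type_synonym ('a, 'k) triple =
  "(nat \<Rightarrow> 'a set \<Rightarrow> real) \<times> (nat \<Rightarrow> 'a set \<Rightarrow> real ^ 'k) \<times> (nat \<Rightarrow> real)"

definition potentials ::
  "nat \<Rightarrow> (nat \<Rightarrow> 'a::euclidean_space set) \<Rightarrow> ('a, 'k::finite) potential set" where
  "potentials N X = {(\<phi>, \<psi>, l). (\<forall>k\<le>N. \<phi> k \<in> Cb (X k)) \<and> (\<forall>k<N. \<psi> k \<in> Cb (X k))}"

definition triples ::
  "nat \<Rightarrow> (nat \<Rightarrow> 'a::euclidean_space set) \<Rightarrow> ('a, 'k::finite) triple set" where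
  "triples N X = {(\<nu>, p, g).
     (\<forall>k\<le>N. \<nu> k \<in> vector_measures (state_space X k)) \<and>
     (\<forall>k<N. p k \<in> vector_measures (state_space X k))}"

definition pairing ::
  "nat \<Rightarrow> nat \<Rightarrow> (nat \<Rightarrow> 'a::euclidean_space set) \<Rightarrow> real
     \<Rightarrow> ('a, 'k::finite) potential \<Rightarrow> ('a, 'k) triple \<Rightarrow> real" where
  "pairing N NC X h = (\<lambda>(\<phi>, \<psi>, l) (\<nu>, p, g).
     h * (\<Sum>k\<le>N. signed_integral (state_space X k) (\<nu> k) (\<phi> k))
     + h * (\<Sum>k<N. vector_integral (state_space X k) (p k) (\<psi> k))
     + (\<Sum>i=1..NC. l i * g i))"

definition Delta ::
  "nat \<Rightarrow> nat \<Rightarrow> real \<Rightarrow> ('a \<Rightarrow> 'a \<Rightarrow> real ^ 'k) \<Rightarrow> (nat \<Rightarrow> 'a \<Rightarrow> real) \<Rightarrow> (nat \<Rightarrow> nat)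
     \<Rightarrow> ('a, 'k::finite) potential \<Rightarrow> (nat \<Rightarrow> 'a) \<Rightarrow> real" where
  "Delta N NC h B G \<tau> = (\<lambda>(\<phi>, \<psi>, l) x.
     (\<Sum>k\<le>N. h * \<phi> k (x k))
     + (\<Sum>k<N. B (x k) (x (Suc k)) \<bullet> \<psi> k (x k))
     + (\<Sum>i=1..NC. l i * G i (x (\<tau> i))))"

definition marginal ::
  "(nat \<Rightarrow> 'a::euclidean_space set) \<Rightarrow> (nat \<Rightarrow> 'a) measure \<Rightarrow> nat \<Rightarrow> 'a measure" where
  "marginal X P k = distr P (state_space X k) (\<lambda>x. x k)"

definition joint_marginal ::
  "(nat \<Rightarrow> 'a::euclidean_space set) \<Rightarrow> (nat \<Rightarrow> 'a) measure \<Rightarrow> nat \<Rightarrow> ('a \<times> 'a) measure" where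
  "joint_marginal X P k =
     distr P (state_space X k \<Otimes>\<^sub>M state_space X (Suc k)) (\<lambda>x. (x k, x (Suc k)))"

definition Delta_adj ::
  "(nat \<Rightarrow> 'a::euclidean_space set) \<Rightarrow> real \<Rightarrow> ('a \<Rightarrow> 'a \<Rightarrow> real ^ 'k)
     \<Rightarrow> (nat \<Rightarrow> 'a \<Rightarrow> real) \<Rightarrow> (nat \<Rightarrow> nat) \<Rightarrow> (nat \<Rightarrow> 'a) measure \<Rightarrow> ('a, 'k::finite) triple" where
  "Delta_adj X h B G \<tau> P =
     (\<lambda>k. measure (marginal X P k),
      \<lambda>k A. if A \<in> sets (state_space X k)
            then (1 / h) *\<^sub>R
              (\<integral>z. indicator A (fst z) *\<^sub>R B (fst z) (snd z) \<partial>joint_marginal X P k)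
            else 0,
      \<lambda>i. \<integral>x. G i (x (\<tau> i)) \<partial>P)"

section \<open>The functionals\<close>

text \<open>
  The library's \<^const>\<open>KL_divergence\<close> is real-valued, hence 0 where the divergence is
  infinite; here the integral is the extended-real Lebesgue integral, the difference of the
  integrals of the positive and the negative part.  For finite \<open>P\<close> and a probability \<open>R\<close> the
  latter is finite.
\<close>

definition KL :: "'s measure \<Rightarrow> 's measure \<Rightarrow> ereal" where
  "KL P R =
     (if absolutely_continuous R P
      then enn2ereal (\<integral>\<^sup>+x. ennreal (ln (enn2real (RN_deriv R P x)) - 1) \<partial>P)
         - enn2ereal (\<integral>\<^sup>+x. ennreal (1 - ln (enn2real (RN_deriv R P x))) \<partial>P)
      else \<infinity>)"

definition Gfun :: "real \<Rightarrow> (nat \<Rightarrow> 'a) measure \<Rightarrow> (nat \<Rightarrow> 'a) measure \<Rightarrow> ereal" where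
  "Gfun h R P = ereal h * KL P R"

definition Gfun_star ::
  "nat \<Rightarrow> (nat \<Rightarrow> 'a::euclidean_space set) \<Rightarrow> real \<Rightarrow> (nat \<Rightarrow> 'a) measure
     \<Rightarrow> ((nat \<Rightarrow> 'a) \<Rightarrow> real) \<Rightarrow> ereal" where
  "Gfun_star N X h R = legendre (\<lambda>f P. \<integral>x. f x \<partial>P) (path_measures N X) (Gfun h R)"

definition Ffun ::
  "nat \<Rightarrow> nat \<Rightarrow> (nat \<Rightarrow> ('a set \<Rightarrow> real) \<times> ('a set \<Rightarrow> real ^ 'k) \<Rightarrow> ereal)
     \<Rightarrow> (nat \<Rightarrow> ('a set \<Rightarrow> real) \<Rightarrow> ereal) \<Rightarrow> (nat \<Rightarrow> real \<Rightarrow> ereal)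
     \<Rightarrow> ('a, 'k::finite) triple \<Rightarrow> ereal" where
  "Ffun N NC Fmom M C = (\<lambda>(\<nu>, p, g).
     (\<Sum>k<N. Fmom k (\<nu> k, p k)) + (\<Sum>k\<le>N. M k (\<nu> k)) + (\<Sum>i=1..NC. C i (g i)))"

definition Ffun_star ::
  "nat \<Rightarrow> nat \<Rightarrow> (nat \<Rightarrow> 'a::euclidean_space set) \<Rightarrow> real
     \<Rightarrow> (nat \<Rightarrow> ('a set \<Rightarrow> real) \<times> ('a set \<Rightarrow> real ^ 'k) \<Rightarrow> ereal)
     \<Rightarrow> (nat \<Rightarrow> ('a set \<Rightarrow> real) \<Rightarrow> ereal) \<Rightarrow> (nat \<Rightarrow> real \<Rightarrow> ereal)
     \<Rightarrow> ('a, 'k::finite) potential \<Rightarrow> ereal" where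
  "Ffun_star N NC X h Fmom M C =
     legendre (pairing N NC X h) (triples N X) (Ffun N NC Fmom M C)"

text \<open>
  Convexity, lower semicontinuity and values in the reals extended by \<open>+\<infinity>\<close>, on the respective
  factor of the space of triples with the weak topology induced by the pairing.
\<close>

definition admissible_mom ::
  "'a::euclidean_space set \<Rightarrow> (('a set \<Rightarrow> real) \<times> ('a set \<Rightarrow> real ^ 'k::finite) \<Rightarrow> ereal) \<Rightarrow> bool" where
  "admissible_mom Xk F \<longleftrightarrow>
     (let S = restrict_space borel Xk; V = vector_measures S \<times> vector_measures S in
      convex_fun comb_pair V F \<and>
      lsc_on (weak_topology V
        {\<lambda>(\<nu>, p). signed_integral S \<nu> \<phi> + vector_integral S p \<psi> | \<phi> \<psi>. \<phi> \<in> Cb Xk \<and> \<psi> \<in> Cb Xk}) F \<and>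
      (\<forall>u\<in>V. F u \<noteq> -\<infinity>))"

definition admissible_marginal ::
  "'a::euclidean_space set \<Rightarrow> (('a set \<Rightarrow> real) \<Rightarrow> ereal) \<Rightarrow> bool" where
  "admissible_marginal Xk F \<longleftrightarrow>
     (let S = restrict_space borel Xk; V = vector_measures S in
      convex_fun comb_measure V F \<and>
      lsc_on (weak_topology V {\<lambda>\<nu>. signed_integral S \<nu> \<phi> | \<phi>. \<phi> \<in> Cb Xk}) F \<and>
      (\<forall>u\<in>V. F u \<noteq> -\<infinity>))"

definition admissible_price :: "(real \<Rightarrow> ereal) \<Rightarrow> bool" where
  "admissible_price F \<longleftrightarrow>
     convex_fun comb_real UNIV F \<and> lsc_on euclideanreal F \<and> (\<forall>c. F c \<noteq> -\<infinity>)"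

section \<open>The primal and the dual problem\<close>

definition primal_objective ::
  "nat \<Rightarrow> nat \<Rightarrow> (nat \<Rightarrow> 'a::euclidean_space set) \<Rightarrow> real
     \<Rightarrow> ('a \<Rightarrow> 'a \<Rightarrow> real ^ 'k) \<Rightarrow> (nat \<Rightarrow> 'a \<Rightarrow> real) \<Rightarrow> (nat \<Rightarrow> nat)
     \<Rightarrow> (nat \<Rightarrow> ('a set \<Rightarrow> real) \<times> ('a set \<Rightarrow> real ^ 'k) \<Rightarrow> ereal)
     \<Rightarrow> (nat \<Rightarrow> ('a set \<Rightarrow> real) \<Rightarrow> ereal) \<Rightarrow> (nat \<Rightarrow> real \<Rightarrow> ereal)
     \<Rightarrow> (nat \<Rightarrow> 'a) measure \<Rightarrow> (nat \<Rightarrow> 'a) measure \<Rightarrow> ereal" where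
  "primal_objective N NC X h B G \<tau> Fmom M C R P =
     Ffun N NC Fmom M C (Delta_adj X h B G \<tau> P) + Gfun h R P"

definition dual_objective ::
  "nat \<Rightarrow> nat \<Rightarrow> (nat \<Rightarrow> 'a::euclidean_space set) \<Rightarrow> real
     \<Rightarrow> ('a \<Rightarrow> 'a \<Rightarrow> real ^ 'k) \<Rightarrow> (nat \<Rightarrow> 'a \<Rightarrow> real) \<Rightarrow> (nat \<Rightarrow> nat)
     \<Rightarrow> (nat \<Rightarrow> ('a set \<Rightarrow> real) \<times> ('a set \<Rightarrow> real ^ 'k) \<Rightarrow> ereal)
     \<Rightarrow> (nat \<Rightarrow> ('a set \<Rightarrow> real) \<Rightarrow> ereal) \<Rightarrow> (nat \<Rightarrow> real \<Rightarrow> ereal)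
     \<Rightarrow> (nat \<Rightarrow> 'a) measure \<Rightarrow> ('a, 'k::finite) potential \<Rightarrow> ereal" where
  "dual_objective N NC X h B G \<tau> Fmom M C R \<Phi> =
     - Ffun_star N NC X h Fmom M C (- \<Phi>) - Gfun_star N X h R (Delta N NC h B G \<tau> \<Phi>)"

definition induced_measure ::
  "nat \<Rightarrow> nat \<Rightarrow> real \<Rightarrow> ('a \<Rightarrow> 'a \<Rightarrow> real ^ 'k) \<Rightarrow> (nat \<Rightarrow> 'a \<Rightarrow> real) \<Rightarrow> (nat \<Rightarrow> nat)
     \<Rightarrow> (nat \<Rightarrow> 'a) measure \<Rightarrow> ('a, 'k::finite) potential \<Rightarrow> (nat \<Rightarrow> 'a) measure" where
  "induced_measure N NC h B G \<tau> R \<Phi> =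
     density R (\<lambda>x. ennreal (exp (Delta N NC h B G \<tau> \<Phi> x / h)))"

end

theory Submission
  imports Defs
begin

text \<open>
  The proof is Fenchel duality, with both attainment and uniqueness read off from the dual
  maximizer \<open>\<Phi>\<close>.  Write \<open>F\<close> for the functional on triples, \<open>F\<^sup>*\<close> for its Legendre transform,
  \<open>f = \<Delta>\<Phi>\<close>, and \<open>P\<^sup>*\<close> for the measure with density \<open>exp (f / h)\<close> with respect to the
  reference law \<open>R\<close>.

  Two inequalities hold for every competitor \<open>P\<close>.  By definition of \<open>F\<^sup>*\<close>, the value of \<open>F\<close> at
  \<open>\<Delta>\<^sup>\<dagger>P\<close> is at least \<open>\<langle>-\<Phi>, \<Delta>\<^sup>\<dagger>P\<rangle> - F\<^sup>*(-\<Phi>)\<close>, and the pairing is \<open>- \<integral> f dP\<close> by the adjoint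
  identity (\<open>Delta_adjoint\<close>).  By the pointwise Young inequality for \<open>r log r - r\<close> and \<open>exp\<close>
  (\<open>entropy_duality\<close>), \<open>h KL(P|R)\<close> is at least \<open>\<integral> f dP - h \<integral> exp (f/h) dR\<close>, with equality only for
  \<open>P = P\<^sup>*\<close>.  The two integrals of \<open>f\<close> cancel, so the dual value at \<open>\<Phi>\<close> bounds the primal
  objective from below.  This is weak duality, and once equality is known at \<open>P\<^sup>*\<close> both claims
  follow: \<open>P\<^sup>*\<close> is a minimizer, and any other minimizer has equality in the entropy inequality and
  therefore is \<open>P\<^sup>*\<close>.

  Equality at \<open>P\<^sup>*\<close> means that \<open>\<Delta>\<^sup>\<dagger>P\<^sup>*\<close> is a subgradient of \<open>F\<^sup>*\<close> at \<open>-\<Phi>\<close>.  Moving from \<open>-\<Phi>\<close>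
  a fraction \<open>t\<close> of the way to any \<open>y\<close>, convexity bounds the change of \<open>F\<^sup>*\<close>, while the
  exponential functional changes by \<open>t\<close> times an integral against \<open>P\<^sup>*\<close> plus a term of order
  \<open>t\<^sup>2\<close> (\<open>exponential_functional_increment\<close>); maximality of \<open>\<Phi>\<close> and \<open>t \<rightarrow> 0\<close> give
  \<open>\<langle>y, \<Delta>\<^sup>\<dagger>P\<^sup>*\<rangle> - F\<^sup>*(y) \<le> \<langle>-\<Phi>, \<Delta>\<^sup>\<dagger>P\<^sup>*\<rangle> - F\<^sup>*(-\<Phi>)\<close> (\<open>first_order_condition\<close>).  The supremum of
  the left side over \<open>y\<close> is the biconjugate of \<open>F\<close> at \<open>\<Delta>\<^sup>\<dagger>P\<^sup>*\<close>, hence \<open>F(\<Delta>\<^sup>\<dagger>P\<^sup>*)\<close> itself.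

  The last step is the Fenchel--Moreau theorem for a weak topology (\<open>affine_minorant\<close>).  A
  weakly lower semicontinuous function is controlled near a point by finitely many functionals,
  so only separation in finitely many real coordinates is needed.  The pairing is between
  continuous functions and general signed measures, and its bilinearity rests on the Jordan
  decomposition.
\<close>

section \<open>Finite signed measures and their Jordan decomposition\<close>

lemma vector_measures_sums:
  fixes A :: "nat \<Rightarrow> 'a set"
  assumes "\<mu> \<in> vector_measures S" "range A \<subseteq> sets S" "disjoint_family A"
  shows "(\<lambda>n. \<mu> (A n)) sums \<mu> (\<Union>n. A n)"
  using assms by (auto simp: vector_measures_def)

lemma vector_measures_empty:
  assumes "\<mu> \<in> vector_measures S" shows "\<mu> {} = 0"
proof -
  have "(\<lambda>n::nat. \<mu> {}) sums \<mu> (\<Union>n::nat. {})"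
    using assms by (intro vector_measures_sums[of _ _ "\<lambda>_. {}"]) (auto simp: disjoint_family_on_def)
  then have "(\<lambda>n::nat. \<mu> {}) \<longlonglongrightarrow> 0"
    by (intro summable_LIMSEQ_zero sums_summable)
  then show ?thesis by (simp add: LIMSEQ_const_iff)
qed

text \<open>
  Padding a two-set partition with empty sets turns countable additivity into finite additivity.
\<close>

lemma vector_measures_Un:
  assumes \<mu>: "\<mu> \<in> vector_measures S" and A: "A \<in> sets S" "B \<in> sets S" "A \<inter> B = {}"
  shows "\<mu> (A \<union> B) = \<mu> A + \<mu> B"
proof -
  have 1: "(\<lambda>n. \<mu> (binaryset A B n)) sums \<mu> (\<Union>n. binaryset A B n)"
    using A by (intro vector_measures_sums[OF \<mu>]) (auto simp: disjoint_family_on_def binaryset_def)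
  have "(\<lambda>n. \<mu> (binaryset A B n)) sums (\<Sum>n\<in>{0,1}. \<mu> (binaryset A B n))"
    by (rule sums_finite) (auto simp: binaryset_def vector_measures_empty[OF \<mu>])
  then have "(\<lambda>n. \<mu> (binaryset A B n)) sums (\<mu> A + \<mu> B)"
    by (simp add: binaryset_def)
  with 1 show ?thesis
    using sums_unique2 by (fastforce simp: UN_binaryset_eq)
qed

lemma vector_measures_Diff:
  assumes \<mu>: "\<mu> \<in> vector_measures S" and A: "A \<in> sets S" "B \<in> sets S" "B \<subseteq> A"
  shows "\<mu> (A - B) = \<mu> A - \<mu> B"
  using vector_measures_Un[OF \<mu>, of B "A - B"] A by (simp add: Un_absorb1 sets.Diff)

text \<open>
  If \<open>\<mu>\<close> takes arbitrarily large values on subsets of \<open>E\<close>, then \<open>E\<close> splits into two pieces whose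
  measures both exceed 1 in absolute value and one of which inherits the unboundedness.  Iterating
  on that piece peels off infinitely many disjoint sets of measure at least 1 in absolute value,
  which contradicts convergence of the series of their measures.
\<close>

lemma signed_measure_bounded:
  assumes \<mu>: "(\<mu> :: 'a set \<Rightarrow> real) \<in> vector_measures S"
  shows "\<exists>K. \<forall>A\<in>sets S. \<bar>\<mu> A\<bar> \<le> K"
proof (rule ccontr)
  assume not_bounded: "\<not> ?thesis"
  define unbdd where "unbdd E \<longleftrightarrow> E \<in> sets S \<and> (\<forall>K. \<exists>B\<in>sets S. B \<subseteq> E \<and> \<bar>\<mu> B\<bar> > K)" for E
  have unbdd_space: "unbdd (space S)"
    using not_bounded unfolding unbdd_def by (metis not_le sets.sets_into_space sets.top)
  have step: "\<exists>E'. unbdd E' \<and> E' \<subseteq> E \<and> 1 < \<bar>\<mu> (E - E')\<bar>" if E: "unbdd E" for E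
  proof -
    have ES: "E \<in> sets S" using E by (simp add: unbdd_def)
    obtain B where B: "B \<in> sets S" "B \<subseteq> E" "\<bar>\<mu> B\<bar> > \<bar>\<mu> E\<bar> + 1"
      using E unfolding unbdd_def by blast
    have EB: "\<mu> (E - B) = \<mu> E - \<mu> B" by (intro vector_measures_Diff[OF \<mu>] ES B)
    show ?thesis
    proof (cases "unbdd B")
      case True
      then show ?thesis using B EB by (intro exI[of _ B]) auto
    next
      case False
      have "unbdd (E - B)"
      proof (rule ccontr)
        assume "\<not> unbdd (E - B)"
        then obtain K' where K': "\<And>D. D \<in> sets S \<Longrightarrow> D \<subseteq> E - B \<Longrightarrow> \<bar>\<mu> D\<bar> \<le> K'"
          using B ES unfolding unbdd_def by (metis not_le sets.Diff)
        obtain K where K: "\<And>D. D \<in> sets S \<Longrightarrow> D \<subseteq> B \<Longrightarrow> \<bar>\<mu> D\<bar> \<le> K"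
          using B False unfolding unbdd_def by (metis not_le)
        obtain D where D: "D \<in> sets S" "D \<subseteq> E" "\<bar>\<mu> D\<bar> > K + K'"
          using E unfolding unbdd_def by blast
        have "\<mu> D = \<mu> (D \<inter> B) + \<mu> (D - B)"
          using vector_measures_Un[OF \<mu>, of "D \<inter> B" "D - B"] D B
          by (simp add: Int_Diff_Un sets.Int sets.Diff Int_Diff_disjoint)
        moreover have "\<bar>\<mu> (D \<inter> B)\<bar> \<le> K" using D B by (intro K) auto
        moreover have "\<bar>\<mu> (D - B)\<bar> \<le> K'" using D B by (intro K') auto
        ultimately show False using D by linarith
      qed
      moreover have "E - (E - B) = B" using B by auto
      ultimately show ?thesis using B by (intro exI[of _ "E - B"]) auto
    qed
  qed
  obtain E where E: "\<And>n. unbdd (E n)" "\<And>n. E (Suc n) \<subseteq> E n \<and> 1 < \<bar>\<mu> (E n - E (Suc n))\<bar>"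
  proof -
    have "\<exists>E. \<forall>n. unbdd (E n) \<and> E (Suc n) \<subseteq> E n \<and> 1 < \<bar>\<mu> (E n - E (Suc n))\<bar>"
      by (rule dependent_nat_choice) (use unbdd_space step in blast)+
    then show thesis using that by blast
  qed
  have mono: "E n \<subseteq> E m" if "m \<le> n" for m n
    by (rule lift_Suc_antimono_le[OF _ that]) (use E(2) in blast)
  have "disjoint_family (\<lambda>n. E n - E (Suc n))"
    unfolding disjoint_family_on_def
  proof safe
    fix m n x assume "m \<noteq> n" "x \<in> E m" "x \<notin> E (Suc m)" "x \<in> E n" "x \<notin> E (Suc n)"
    then show "x \<in> {}" using mono[of "Suc m" n] mono[of "Suc n" m]
      by (metis Suc_leI nat_neq_iff subsetD)
  qed
  then have "(\<lambda>n. \<mu> (E n - E (Suc n))) sums \<mu> (\<Union>n. E n - E (Suc n))"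
    using E(1) by (intro vector_measures_sums[OF \<mu>]) (auto simp: unbdd_def)
  then have "(\<lambda>n. \<mu> (E n - E (Suc n))) \<longlonglongrightarrow> 0"
    by (intro summable_LIMSEQ_zero sums_summable)
  then obtain n where "norm (\<mu> (E n - E (Suc n)) - 0) < 1"
    by (meson LIMSEQ_iff le_refl zero_less_one)
  with E(2)[of n] show False by simp
qed

text \<open>
  Truncating the negative terms at 0 can only increase the sum, and a series of nonnegative
  extended reals needs no convergence.
\<close>

lemma ennreal_sums_le:
  assumes "x sums s" shows "ennreal s \<le> (\<Sum>n. ennreal (x n))"
proof (rule LIMSEQ_le_const2)
  show "(\<lambda>n. ennreal (\<Sum>i<n. x i)) \<longlonglongrightarrow> ennreal s"
    using assms by (intro tendsto_ennrealI) (simp add: sums_def)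
  have le: "ennreal (\<Sum>i<n. x i) \<le> (\<Sum>i<n. ennreal (x i))" for n
  proof (induction n)
    case (Suc n)
    have "ennreal ((\<Sum>i<n. x i) + x n) \<le> ennreal (\<Sum>i<n. x i) + ennreal (x n)"
      by (metis ennreal_plus ennreal_leI le_add_same_cancel1 le_add_same_cancel2 linorder_le_cases add.commute
          ennreal_eq_0_iff add_0 order_refl)
    with Suc show ?case by (auto intro: order_trans add_mono)
  qed simp
  show "\<exists>N. \<forall>n\<ge>N. ennreal (\<Sum>i<n. x i) \<le> (\<Sum>n. ennreal (x n))"
    using order_trans[OF le sum_le_suminf[OF summableI]] by (auto simp: )
qed

lemma
  shows space_positive_variation [simp]: "space (positive_variation S \<mu>) = space S"
    and sets_positive_variation [simp, measurable_cong]: "sets (positive_variation S \<mu>) = sets S"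
  by (simp_all add: positive_variation_def sets.space_closed sets.sigma_sets_eq)

text \<open>
  The supremum over measurable subsets is countably additive: it is superadditive on disjoint sets
  because subsets of the two parts can be united, and countably subadditive because a subset of a
  union is cut into its traces on the parts.
\<close>

lemma emeasure_positive_variation:
  assumes \<mu>: "\<mu> \<in> vector_measures S" and A: "A \<in> sets S"
  shows "emeasure (positive_variation S \<mu>) A = (\<Squnion>B\<in>{B \<in> sets S. B \<subseteq> A}. ennreal (\<mu> B))"
proof -
  define v where "v A = (\<Squnion>B\<in>{B \<in> sets S. B \<subseteq> A}. ennreal (\<mu> B))" for A
  have v_upper: "ennreal (\<mu> B) \<le> v A" if "B \<in> sets S" "B \<subseteq> A" for A B
    unfolding v_def using that by (intro SUP_upper) auto
  have v_empty: "v {} = 0"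
    by (auto simp: v_def vector_measures_empty[OF \<mu>] intro!: SUP_eq_const)
  have v_mono: "v A \<le> v A'" if "A \<subseteq> A'" for A A'
    unfolding v_def using that by (intro SUP_subset_mono) auto
  have v_super: "v A1 + v A2 \<le> v (A1 \<union> A2)" if disj: "A1 \<inter> A2 = {}" for A1 A2
  proof -
    have 1: "ennreal (\<mu> B1) + ennreal (\<mu> B2) \<le> v (A1 \<union> A2)"
      if B: "B1 \<in> sets S" "B1 \<subseteq> A1" "B2 \<in> sets S" "B2 \<subseteq> A2" for B1 B2
    proof (cases "\<mu> B1 \<le> 0 \<or> \<mu> B2 \<le> 0")
      case True
      moreover have "ennreal (\<mu> B1) \<le> v (A1 \<union> A2)" "ennreal (\<mu> B2) \<le> v (A1 \<union> A2)"
        using B by (auto intro!: v_upper)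
      ultimately show ?thesis by (auto simp: ennreal_neg)
    next
      case False
      have "\<mu> (B1 \<union> B2) = \<mu> B1 + \<mu> B2" using B disj by (intro vector_measures_Un[OF \<mu>]) auto
      then show ?thesis using False B v_upper[of "B1 \<union> B2" "A1 \<union> A2"]
        by (auto simp: ennreal_plus)
    qed
    have ne: "{B \<in> sets S. B \<subseteq> A} \<noteq> {}" for A by auto
    have 2: "ennreal (\<mu> B1) + v A2 \<le> v (A1 \<union> A2)" if "B1 \<in> sets S" "B1 \<subseteq> A1" for B1
      unfolding v_def[of A2] ennreal_SUP_add_right[OF ne]
      by (rule SUP_least) (use 1 that in auto)
    show ?thesis
      unfolding v_def[of A1] ennreal_SUP_add_left[OF ne, symmetric]
      by (rule SUP_least) (use 2 in auto)
  qed
  have "emeasure (measure_of (space S) (sets S) v) A = v A"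
  proof (rule emeasure_measure_of_sigma)
    show "sigma_algebra (space S) (sets S)" by (rule sets.sigma_algebra_axioms)
    show "positive (sets S) v" by (simp add: positive_def v_empty)
    show "countably_additive (sets S) v"
    proof (rule countably_additiveI)
      fix D :: "nat \<Rightarrow> 'a set"
      assume D: "range D \<subseteq> sets S" "disjoint_family D" "\<Union> (range D) \<in> sets S"
      have "(\<Sum>i<n. v (D i)) \<le> v (\<Union>i<n. D i)" for n
      proof (induction n)
        case (Suc n)
        have "D i \<inter> D n = {}" if "i < n" for i
          using disjoint_family_onD[OF D(2), of i n] that by simp
        then have disj: "(\<Union>i<n. D i) \<inter> D n = {}" by blast
        have "(\<Sum>i<Suc n. v (D i)) \<le> v (\<Union>i<n. D i) + v (D n)"
          using Suc by (simp add: add_right_mono)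
        also have "\<dots> \<le> v ((\<Union>i<n. D i) \<union> D n)" by (rule v_super[OF disj])
        also have "(\<Union>i<n. D i) \<union> D n = (\<Union>i<Suc n. D i)" by (auto simp: lessThan_Suc)
        finally show ?case .
      qed (simp add: v_empty)
      moreover have "v (\<Union>i<n. D i) \<le> v (\<Union>i. D i)" for n by (rule v_mono) auto
      ultimately have "(\<Sum>i. v (D i)) \<le> v (\<Union>i. D i)"
        by (intro suminf_le_const summableI) (metis order_trans)
      moreover have "v (\<Union>i. D i) \<le> (\<Sum>i. v (D i))"
        unfolding v_def[of "\<Union>i. D i"]
      proof (rule SUP_least, safe)
        fix B assume B: "B \<in> sets S" "B \<subseteq> (\<Union>i. D i)"
        have "(\<lambda>i. \<mu> (B \<inter> D i)) sums \<mu> (\<Union>i. B \<inter> D i)"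
        proof (rule vector_measures_sums[OF \<mu>])
          show "range (\<lambda>i. B \<inter> D i) \<subseteq> sets S" using B D by auto
          show "disjoint_family (\<lambda>i. B \<inter> D i)"
            using D(2) by (rule disjoint_family_on_bisimulation) auto
        qed
        moreover have "(\<Union>i. B \<inter> D i) = B" using B by auto
        ultimately have "ennreal (\<mu> B) \<le> (\<Sum>i. ennreal (\<mu> (B \<inter> D i)))"
          using ennreal_sums_le by force
        also have "\<dots> \<le> (\<Sum>i. v (D i))"
          using B D by (intro suminf_le summableI v_upper) auto
        finally show "ennreal (\<mu> B) \<le> (\<Sum>i. v (D i))" .
      qed
      ultimately show "(\<Sum>i. v (D i)) = v (\<Union> (range D))" by simp
    qed
  qed (fact A)
  then show ?thesis by (simp add: positive_variation_def v_def[abs_def])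
qed

lemma vector_measures_lincomb:
  assumes "\<mu> \<in> vector_measures S" "\<nu> \<in> vector_measures S"
  shows "(\<lambda>A. a *\<^sub>R \<mu> A + b *\<^sub>R \<nu> A) \<in> vector_measures S"
  using assms by (auto simp: vector_measures_def intro!: sums_add sums_scaleR_right)

lemma vector_measures_uminus:
  assumes "\<mu> \<in> vector_measures S" shows "(\<lambda>A. - \<mu> A) \<in> vector_measures S"
  using vector_measures_lincomb[OF assms assms, of "-1" 0] by simp

lemma vector_measures_nth:
  assumes "\<mu> \<in> vector_measures S" shows "(\<lambda>A. \<mu> A $ j) \<in> vector_measures S"
  using assms by (auto simp: vector_measures_def intro!: bounded_linear.sums[OF bounded_linear_vec_nth])

lemma finite_measure_positive_variation:
  assumes \<mu>: "\<mu> \<in> vector_measures S" shows "finite_measure (positive_variation S \<mu>)"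
proof
  obtain K where K: "\<And>A. A \<in> sets S \<Longrightarrow> \<bar>\<mu> A\<bar> \<le> K" using signed_measure_bounded[OF \<mu>] by auto
  have "emeasure (positive_variation S \<mu>) (space S) \<le> ennreal K"
    unfolding emeasure_positive_variation[OF \<mu> sets.top]
    by (intro SUP_least ennreal_leI) (use K in force)
  then show "emeasure (positive_variation S \<mu>) (space (positive_variation S \<mu>)) \<noteq> \<infinity>"
    by (auto simp: top_unique)
qed

text \<open>
  Since \<open>\<mu> B = \<mu> A - \<mu> (A - B)\<close>, the supremum of \<open>\<mu> B\<close> over \<open>B \<subseteq> A\<close> equals \<open>\<mu> A\<close> plus the supremum of
  \<open>- \<mu>\<close> over the same sets; boundedness makes the subtraction legitimate.
\<close>

lemma jordan_decomposition:
  assumes \<mu>: "\<mu> \<in> vector_measures S" and A: "A \<in> sets S"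
  shows "measure (positive_variation S \<mu>) A - measure (positive_variation S (\<lambda>A. - \<mu> A)) A = \<mu> A"
proof -
  have le: "measure (positive_variation S \<nu>) A \<le> \<nu> A + measure (positive_variation S (\<lambda>A. - \<nu> A)) A"
    if \<nu>: "\<nu> \<in> vector_measures S" for \<nu>
  proof -
    let ?n = "positive_variation S (\<lambda>A. - \<nu> A)"
    interpret n: finite_measure ?n
      by (intro finite_measure_positive_variation vector_measures_uminus \<nu>)
    interpret p: finite_measure "positive_variation S \<nu>"
      by (intro finite_measure_positive_variation \<nu>)
    have n: "- \<nu> B \<le> measure ?n A" if "B \<in> sets S" "B \<subseteq> A" for B
    proof -
      have "ennreal (- \<nu> B) \<le> emeasure ?n A"
        unfolding emeasure_positive_variation[OF vector_measures_uminus[OF \<nu>] A]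
        using that by (intro SUP_upper2[of B]) auto
      then show ?thesis
        by (metis enn2real_ennreal ennreal_le_iff2 linorder_le_cases measure_nonneg n.emeasure_eq_measure order_trans)
    qed
    have "ennreal (measure (positive_variation S \<nu>) A) \<le> ennreal (\<nu> A + measure ?n A)"
      unfolding p.emeasure_eq_measure[symmetric] emeasure_positive_variation[OF \<nu> A]
    proof (intro SUP_least ennreal_leI, safe)
      fix B assume B: "B \<in> sets S" "B \<subseteq> A"
      then show "\<nu> B \<le> \<nu> A + measure ?n A"
        using n[of "A - B"] vector_measures_Diff[OF \<nu> A B] A by auto
    qed
    then show ?thesis using n[OF A] by (subst (asm) ennreal_le_iff) auto
  qed
  show ?thesis using le[OF \<mu>] le[OF vector_measures_uminus[OF \<mu>]] by simp
qed

section \<open>Integration against a finite signed measure\<close>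

definition bounded_measurable :: "'a measure \<Rightarrow> ('a \<Rightarrow> real) set" where
  "bounded_measurable S = {f \<in> borel_measurable S. \<exists>K. \<forall>x\<in>space S. \<bar>f x\<bar> \<le> K}"

lemma bounded_measurableI:
  "f \<in> borel_measurable S \<Longrightarrow> (\<And>x. x \<in> space S \<Longrightarrow> \<bar>f x\<bar> \<le> K) \<Longrightarrow> f \<in> bounded_measurable S"
  unfolding bounded_measurable_def by blast

lemma integrable_bounded_measurable:
  assumes "f \<in> bounded_measurable S" "finite_measure m" "sets m = sets S"
  shows "integrable m f"
proof -
  interpret finite_measure m by fact
  have "space m = space S" using assms(3) by (rule sets_eq_imp_space_eq)
  with assms show ?thesis
    by (auto simp: bounded_measurable_def intro!: integrable_const_bound AE_I2 cong: measurable_cong_sets)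
qed

lemma bounded_measurable_lincomb:
  assumes "f \<in> bounded_measurable S" "g \<in> bounded_measurable S"
  shows "(\<lambda>x. a * f x + b * g x) \<in> bounded_measurable S"
proof -
  obtain K L where K: "\<And>x. x \<in> space S \<Longrightarrow> \<bar>f x\<bar> \<le> K" and L: "\<And>x. x \<in> space S \<Longrightarrow> \<bar>g x\<bar> \<le> L"
    using assms by (auto simp: bounded_measurable_def)
  show ?thesis
  proof (rule bounded_measurableI)
    show "(\<lambda>x. a * f x + b * g x) \<in> borel_measurable S"
      using assms by (auto simp: bounded_measurable_def)
    show "\<bar>a * f x + b * g x\<bar> \<le> \<bar>a\<bar> * K + \<bar>b\<bar> * L" if "x \<in> space S" for x
      using K[OF that] L[OF that]
      by (intro order_trans[OF abs_triangle_ineq] add_mono) (auto simp: abs_mult intro!: mult_left_mono)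
  qed
qed

lemma bounded_measurable_compose:
  assumes "f \<in> bounded_measurable S" "T \<in> measurable M S"
  shows "(\<lambda>x. f (T x)) \<in> bounded_measurable M"
proof -
  obtain K where "\<And>x. x \<in> space S \<Longrightarrow> \<bar>f x\<bar> \<le> K" using assms by (auto simp: bounded_measurable_def)
  with assms(2) have "\<bar>f (T x)\<bar> \<le> K" if "x \<in> space M" for x
    using that by (blast dest: measurable_space)
  moreover have "(\<lambda>x. f (T x)) \<in> borel_measurable M"
    using assms by (auto simp: bounded_measurable_def intro: measurable_compose)
  ultimately show ?thesis by (intro bounded_measurableI)
qed

lemma bounded_measurable_mult:
  assumes "f \<in> bounded_measurable S" "g \<in> bounded_measurable S"
  shows "(\<lambda>x. f x * g x) \<in> bounded_measurable S"
proof -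
  obtain K L where K: "\<And>x. x \<in> space S \<Longrightarrow> \<bar>f x\<bar> \<le> K" and L: "\<And>x. x \<in> space S \<Longrightarrow> \<bar>g x\<bar> \<le> L"
    using assms by (auto simp: bounded_measurable_def)
  show ?thesis
  proof (rule bounded_measurableI)
    show "(\<lambda>x. f x * g x) \<in> borel_measurable S"
      using assms by (auto simp: bounded_measurable_def)
    show "\<bar>f x * g x\<bar> \<le> K * L" if "x \<in> space S" for x
      using K[OF that] L[OF that] by (auto simp: abs_mult intro!: mult_mono')
  qed
qed

text \<open>
  Signed combinations of finite measures that agree on sets agree on bounded functions.  This is
  what makes the integral against a signed measure independent of the chosen decomposition into
  positive measures; the proof is the standard machine on nonnegative bounded functions.
\<close>

lemma integral_combination_eqI:
  fixes c :: "'i \<Rightarrow> real" and m :: "'i \<Rightarrow> 'a measure"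
  assumes p: "finite_measure p" "sets p = sets S" and n: "finite_measure n" "sets n = sets S"
    and m: "\<And>i. i \<in> I \<Longrightarrow> finite_measure (m i)" "\<And>i. i \<in> I \<Longrightarrow> sets (m i) = sets S"
    and eq: "\<And>A. A \<in> sets S \<Longrightarrow> measure p A - measure n A = (\<Sum>i\<in>I. c i * measure (m i) A)"
    and f: "f \<in> bounded_measurable S"
  shows "(\<integral>x. f x \<partial>p) - (\<integral>x. f x \<partial>n) = (\<Sum>i\<in>I. c i * (\<integral>x. f x \<partial>m i))"
proof -
  define J where "J f \<longleftrightarrow> (\<integral>x. f x \<partial>p) - (\<integral>x. f x \<partial>n) = (\<Sum>i\<in>I. c i * (\<integral>x. f x \<partial>m i))" for f
  have sp: "space p = space S" "space n = space S" "\<And>i. i \<in> I \<Longrightarrow> space (m i) = space S"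
    by (intro sets_eq_imp_space_eq p n m; assumption)+
  note int = integrable_bounded_measurable[OF _ p] integrable_bounded_measurable[OF _ n]
    integrable_bounded_measurable[OF _ m]
  have lin: "J (\<lambda>x. a * u x + b * v x)"
    if "J u" "J v" "u \<in> bounded_measurable S" "v \<in> bounded_measurable S" for a b u v
  proof -
    have "(\<Sum>i\<in>I. c i * (\<integral>x. a * u x + b * v x \<partial>m i)) =
        (\<Sum>i\<in>I. a * (c i * (\<integral>x. u x \<partial>m i)) + b * (c i * (\<integral>x. v x \<partial>m i)))"
      by (intro sum.cong refl) (simp add: int that algebra_simps)
    also have "\<dots> = a * (\<Sum>i\<in>I. c i * (\<integral>x. u x \<partial>m i)) + b * (\<Sum>i\<in>I. c i * (\<integral>x. v x \<partial>m i))"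
      by (simp add: sum.distrib sum_distrib_left)
    finally show ?thesis
      using that(1,2)[unfolded J_def, symmetric] by (simp add: J_def int that(3,4) algebra_simps)
  qed
  have ind: "J (indicator A)" if "A \<in> sets S" for A
  proof -
    have "A \<inter> space q = A" if "space q = space S" for q :: "'a measure"
      using sets.sets_into_space[OF \<open>A \<in> sets S\<close>] that by auto
    then show ?thesis using eq[OF that] by (simp add: J_def sp)
  qed
  have nonneg: "J u" if u: "u \<in> borel_measurable S" "\<And>x. 0 \<le> u x" and K: "\<And>x. x \<in> space S \<Longrightarrow> u x \<le> K" for u K
    using u K
  proof (induction arbitrary: K rule: borel_measurable_induct_real)
    case (set A)
    then show ?case using ind by simp
  next
    case (mult u c)
    show ?case
    proof (cases "c = 0")
      case False
      then have c: "0 < c" using mult by simp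
      then have bound: "u x \<le> K / c" if "x \<in> space S" for x
        using mult.prems[OF that] by (simp add: field_simps)
      moreover have "u \<in> bounded_measurable S"
        using bound mult by (intro bounded_measurableI[where K = "K / c"]) auto
      moreover have "J u" by (rule mult.IH) (fact bound)
      ultimately show ?thesis using lin[of u u c 0] by simp
    qed (simp add: J_def)
  next
    case (add u v)
    have b: "u x \<le> K" "v x \<le> K" if "x \<in> space S" for x
      using add.prems[OF that] add.hyps(2,4)[of x] by linarith+
    then have "u \<in> bounded_measurable S" "v \<in> bounded_measurable S"
      using add by (auto intro!: bounded_measurableI[where K = K])
    moreover have "J u" "J v" by (rule add.IH, use b in blast)+
    ultimately show ?case using lin[of v u 1 1] by simp
  next
    case (seq U)
    have le: "U i x \<le> K" if x: "x \<in> space S" for i x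
    proof -
      have "U i x \<le> u x" using seq.hyps(3,4) x by (intro incseq_le) (auto simp: incseq_def le_fun_def)
      then show ?thesis using seq.prems[OF x] by simp
    qed
    have JU: "J (U i)" for i by (rule seq.IH) (rule le)
    have lim: "(\<lambda>i. \<integral>x. U i x \<partial>q) \<longlonglongrightarrow> (\<integral>x. u x \<partial>q)" if q: "finite_measure q" "sets q = sets S" for q
    proof (rule integral_dominated_convergence[where w = "\<lambda>_. K"])
      interpret finite_measure q by fact
      have "space q = space S" using q(2) by (rule sets_eq_imp_space_eq)
      with seq.hyps(2,4) le show "AE x in q. (\<lambda>i. U i x) \<longlonglongrightarrow> u x" "\<And>i. AE x in q. norm (U i x) \<le> K"
        by (auto intro!: AE_I2)
      show "u \<in> borel_measurable q" "\<And>i. U i \<in> borel_measurable q"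
        using u seq.hyps(1) q(2) by (auto cong: measurable_cong_sets)
      show "integrable q (\<lambda>_. K)" using q(1) by (rule finite_measure.integrable_const)
    qed
    have "(\<lambda>i. (\<integral>x. U i x \<partial>p) - (\<integral>x. U i x \<partial>n)) \<longlonglongrightarrow> (\<integral>x. u x \<partial>p) - (\<integral>x. u x \<partial>n)"
      by (intro tendsto_diff lim p n)
    moreover have "(\<lambda>i. (\<integral>x. U i x \<partial>p) - (\<integral>x. U i x \<partial>n)) \<longlonglongrightarrow> (\<Sum>i\<in>I. c i * (\<integral>x. u x \<partial>m i))"
      unfolding JU[unfolded J_def] by (intro tendsto_sum tendsto_mult tendsto_const lim m)
    ultimately show ?case unfolding J_def by (rule LIMSEQ_unique)
  qed
  obtain K where K: "\<And>x. x \<in> space S \<Longrightarrow> \<bar>f x\<bar> \<le> K" using f by (auto simp: bounded_measurable_def)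
  have fm [measurable]: "f \<in> borel_measurable S" using f by (simp add: bounded_measurable_def)
  \<comment> \<open>The shift makes \<open>f\<close> nonnegative on the space; the truncation makes it so everywhere.\<close>
  let ?g = "\<lambda>x. max 0 (f x + K)"
  have gK: "?g x \<le> 2 * \<bar>K\<bar>" if "x \<in> space S" for x using K[OF that] by auto
  have "?g \<in> bounded_measurable S" using gK by (intro bounded_measurableI[where K = "2 * \<bar>K\<bar>"]) auto
  moreover have "J ?g" by (rule nonneg[OF _ _ gK]) auto
  moreover have "J (indicator (space S))" by (rule ind) simp
  moreover have "indicator (space S) \<in> bounded_measurable S"
    by (intro bounded_measurableI[where K = 1]) auto
  ultimately have "J (\<lambda>x. 1 * ?g x + (- K) * indicator (space S) x)" by (intro lin)
  moreover have "(\<integral>x. 1 * ?g x + (- K) * indicator (space S) x \<partial>q) = (\<integral>x. f x \<partial>q)"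
    if "space q = space S" for q
    by (rule Bochner_Integration.integral_cong[OF refl]) (use K in \<open>force simp: that\<close>)
  ultimately show ?thesis by (simp add: J_def sp)
qed

text \<open>
  Any representation by finite positive measures computes the integral, not only the Jordan
  decomposition.
\<close>

lemma signed_integral_eqI:
  assumes \<mu>: "\<mu> \<in> vector_measures S"
    and m: "\<And>i. i \<in> I \<Longrightarrow> finite_measure (m i)" "\<And>i. i \<in> I \<Longrightarrow> sets (m i) = sets S"
    and eq: "\<And>A. A \<in> sets S \<Longrightarrow> \<mu> A = (\<Sum>i\<in>I. c i * measure (m i) A)"
    and f: "f \<in> bounded_measurable S"
  shows "signed_integral S \<mu> f = (\<Sum>i\<in>I. c i * (\<integral>x. f x \<partial>m i))"
  unfolding signed_integral_def
proof (rule integral_combination_eqI[OF _ _ _ _ m _ f])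
  show "finite_measure (positive_variation S \<mu>)" "finite_measure (positive_variation S (\<lambda>A. - \<mu> A))"
    by (intro finite_measure_positive_variation vector_measures_uminus \<mu>)+
  show "measure (positive_variation S \<mu>) A - measure (positive_variation S (\<lambda>A. - \<mu> A)) A
      = (\<Sum>i\<in>I. c i * measure (m i) A)" if "A \<in> sets S" for A
    using jordan_decomposition[OF \<mu> that] eq[OF that] by (rule trans)
qed simp_all

lemma signed_integral_lincomb_measure:
  assumes \<mu>: "\<mu> \<in> vector_measures S" and \<nu>: "\<nu> \<in> vector_measures S" and f: "f \<in> bounded_measurable S"
  shows "signed_integral S (\<lambda>A. a * \<mu> A + b * \<nu> A) f = a * signed_integral S \<mu> f + b * signed_integral S \<nu> f"
proof -
  let ?m = "\<lambda>i. [positive_variation S \<mu>, positive_variation S (\<lambda>A. - \<mu> A),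
                 positive_variation S \<nu>, positive_variation S (\<lambda>A. - \<nu> A)] ! i"
  let ?c = "\<lambda>i. [a, - a, b, - b] ! i"
  have sum4: "(\<Sum>i<4. g i) = g 0 + g 1 + g 2 + g 3" for g :: "nat \<Rightarrow> real"
    by (simp add: numeral_eq_Suc)
  have "signed_integral S (\<lambda>A. a * \<mu> A + b * \<nu> A) f = (\<Sum>i<4. ?c i * (\<integral>x. f x \<partial>?m i))"
  proof (rule signed_integral_eqI[OF _ _ _ _ f])
    show "(\<lambda>A. a * \<mu> A + b * \<nu> A) \<in> vector_measures S"
      using vector_measures_lincomb[OF \<mu> \<nu>] by simp
    fix i :: nat assume "i \<in> {..<4}"
    then have "i \<in> {0, 1, 2, 3}" by auto
    then show "finite_measure (?m i)" "sets (?m i) = sets S"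
      by (auto simp: finite_measure_positive_variation vector_measures_uminus \<mu> \<nu>)
  next
    fix A assume "A \<in> sets S"
    note jd = jordan_decomposition[OF \<mu> this, symmetric] jordan_decomposition[OF \<nu> this, symmetric]
    show "a * \<mu> A + b * \<nu> A = (\<Sum>i<4. ?c i * measure (?m i) A)"
      unfolding sum4 jd by (simp add: algebra_simps)
  qed
  then show ?thesis
    unfolding sum4 by (simp add: signed_integral_def algebra_simps)
qed

lemma signed_integral_lincomb_fun:
  assumes \<mu>: "\<mu> \<in> vector_measures S" and f: "f \<in> bounded_measurable S" "g \<in> bounded_measurable S"
  shows "signed_integral S \<mu> (\<lambda>x. a * f x + b * g x) = a * signed_integral S \<mu> f + b * signed_integral S \<mu> g"
proof -
  note int = integrable_bounded_measurable[OF f(1) finite_measure_positive_variation]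
    integrable_bounded_measurable[OF f(2) finite_measure_positive_variation]
  show ?thesis
    by (simp add: signed_integral_def int \<mu> vector_measures_uminus algebra_simps)
qed

lemma signed_integral_finite_measure:
  assumes "finite_measure m" "sets m = sets S" "f \<in> bounded_measurable S"
  shows "measure m \<in> vector_measures S" "signed_integral S (measure m) f = (\<integral>x. f x \<partial>m)"
proof -
  interpret finite_measure m by fact
  show 1: "measure m \<in> vector_measures S"
    using assms(2) by (auto simp: vector_measures_def measure_notin_sets intro!: finite_measure_UNION)
  show "signed_integral S (measure m) f = (\<integral>x. f x \<partial>m)"
    using signed_integral_eqI[OF 1, of "{()}" "\<lambda>_. m" "\<lambda>_. 1" f] assms by simp
qed

text \<open>
  The momentum components of \<open>\<Delta>\<^sup>\<dagger>P\<close> have this form: the image under a coordinate of the measure with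
  vector density \<open>b\<close>.
\<close>

lemma pushforward_density_vector_measure:
  fixes b :: "'s \<Rightarrow> 'b::{banach, second_countable_topology}"
  assumes T [measurable]: "T \<in> P \<rightarrow>\<^sub>M S" and b: "integrable P b"
  shows "(\<lambda>A. if A \<in> sets S then \<integral>x. indicator A (T x) *\<^sub>R b x \<partial>P else 0) \<in> vector_measures S"
  unfolding vector_measures_def
proof (safe, goal_cases)
  case (1 A)
  then have A: "A n \<in> sets S" for n by auto
  have meas: "T -` A n \<inter> space P \<in> sets P" for n using A by measurable
  have U: "(\<Union>n. A n) \<in> sets S" using A by blast
  have eq: "(\<integral>x. indicator D (T x) *\<^sub>R b x \<partial>P) = set_lebesgue_integral P (T -` D \<inter> space P) b" for D
    unfolding set_lebesgue_integral_def by (rule Bochner_Integration.integral_cong) (auto split: split_indicator)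
  have "(\<lambda>n. set_lebesgue_integral P (T -` A n \<inter> space P) b) sums
      set_lebesgue_integral P (\<Union>n. T -` A n \<inter> space P) b"
  proof -
    let ?D = "\<lambda>n. T -` A n \<inter> space P"
    have int: "set_integrable P D b" if "D \<in> sets P" for D
      using b that by (simp add: set_integrable_def integrable_mult_indicator)
    have "(\<lambda>n. set_lebesgue_integral P (\<Union>i<n. ?D i) b) \<longlonglongrightarrow> set_lebesgue_integral P (\<Union>n. \<Union>i<n. ?D i) b"
    proof (rule set_integral_cont_up)
      show "(\<Union>i<n. ?D i) \<in> sets P" for n by (rule sets.finite_UN) (use meas in auto)
      show "incseq (\<lambda>n. \<Union>i<n. ?D i)" by (force simp: incseq_def)
      show "set_integrable P (\<Union>n. \<Union>i<n. ?D i) b" 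
      proof (rule int)
        have "(\<Union>n. \<Union>i<n. ?D i) = (\<Union>n. ?D n)" by auto
        also have "\<dots> \<in> sets P" using meas by blast
        finally show "(\<Union>n. \<Union>i<n. ?D i) \<in> sets P" .
      qed
    qed
    moreover have "(\<Union>n. \<Union>i<n. ?D i) = (\<Union>n. ?D n)" by auto
    moreover have "set_lebesgue_integral P (\<Union>i<n. ?D i) b = (\<Sum>i<n. set_lebesgue_integral P (?D i) b)" for n
      using 1(2) by (intro set_integral_finite_Union int meas) (auto simp: disjoint_family_on_def)
    ultimately show ?thesis by (simp add: sums_def)
  qed
  moreover have "(\<Union>n. T -` A n \<inter> space P) = T -` (\<Union>n. A n) \<inter> space P" by auto
  ultimately show ?case using A U by (simp add: eq)
qed simp

text \<open>
  Split the density into its positive and negative parts, which give two finite positive measures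
  representing the signed one.
\<close>

lemma signed_integral_pushforward_density:
  fixes b :: "'s \<Rightarrow> real"
  assumes T [measurable]: "T \<in> P \<rightarrow>\<^sub>M S" and b: "integrable P b" and f: "f \<in> bounded_measurable S"
  shows "signed_integral S (\<lambda>A. if A \<in> sets S then \<integral>x. indicator A (T x) * b x \<partial>P else 0) f
    = (\<integral>x. f (T x) * b x \<partial>P)"
proof -
  have bm [measurable]: "b \<in> borel_measurable P" using b by simp
  have fm [measurable]: "f \<in> borel_measurable S" using f by (simp add: bounded_measurable_def)
  \<comment> \<open>The values \<open>1\<close> and \<open>- 1\<close> of \<open>s\<close> select the positive and the negative part of \<open>b\<close>.\<close>
  define m where "m s = distr (density P (\<lambda>x. ennreal (max 0 (s * b x)))) S T" for s :: real
  have int: "integrable P (\<lambda>x. max 0 (s * b x))" for s using b by auto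
  have intf: "integrable P (\<lambda>x. c x * g (T x))" if c: "integrable P c" and g: "g \<in> bounded_measurable S" for c g
  proof -
    obtain K where K: "\<And>x. x \<in> space S \<Longrightarrow> \<bar>g x\<bar> \<le> K" using g by (auto simp: bounded_measurable_def)
    have [measurable]: "g \<in> borel_measurable S" using g by (simp add: bounded_measurable_def)
    show ?thesis
    proof (rule Bochner_Integration.integrable_bound[where f = "\<lambda>x. K * c x"])
      show "AE x in P. norm (c x * g (T x)) \<le> norm (K * c x)"
      proof (rule AE_I2)
        fix x assume "x \<in> space P"
        then have "\<bar>g (T x)\<bar> \<le> \<bar>K\<bar>" using K[of "T x"] measurable_space[OF T] by force
        then show "norm (c x * g (T x)) \<le> norm (K * c x)"
          using mult_left_mono[OF _ abs_ge_zero[of "c x"], of "\<bar>g (T x)\<bar>" "\<bar>K\<bar>"] by (simp add: abs_mult mult.commute)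
      qed
      show "integrable P (\<lambda>x. K * c x)" using c by simp
      have [measurable]: "c \<in> borel_measurable P" using c by simp
      show "(\<lambda>x. c x * g (T x)) \<in> borel_measurable P" by measurable
    qed
  qed
  have m_int: "(\<integral>x. g x \<partial>m s) = (\<integral>x. max 0 (s * b x) * g (T x) \<partial>P)" if "g \<in> borel_measurable S" for s and g :: "_ \<Rightarrow> real"
    unfolding m_def using that by (simp add: integral_distr integral_density del: ennreal_max_0 ennreal_max_0')
  have m_fin: "finite_measure (m s)" for s
  proof -
    have "finite_measure (density P (\<lambda>x. ennreal (max 0 (s * b x))))"
      using int[of s] by (intro finite_measureI) (auto simp: emeasure_density nn_integral_eq_integral cong: nn_integral_cong)
    then show ?thesis unfolding m_def by (rule finite_measure.finite_measure_distr) simp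
  qed
  have split: "(\<Sum>s\<in>{1, -1}. s * (\<integral>x. g x \<partial>m s)) = (\<integral>x. g (T x) * b x \<partial>P)"
    if g: "g \<in> bounded_measurable S" for g
  proof -
    have "(\<Sum>s\<in>{1, -1}. s * (\<integral>x. g x \<partial>m s))
        = (\<integral>x. max 0 (1 * b x) * g (T x) \<partial>P) - (\<integral>x. max 0 (- 1 * b x) * g (T x) \<partial>P)"
      using g by (simp add: m_int bounded_measurable_def)
    also have "\<dots> = (\<integral>x. max 0 (1 * b x) * g (T x) - max 0 (- 1 * b x) * g (T x) \<partial>P)"
      by (rule Bochner_Integration.integral_diff[symmetric]; rule intf[OF int g])
    also have "\<dots> = (\<integral>x. g (T x) * b x \<partial>P)"
      by (rule Bochner_Integration.integral_cong) (auto simp: max_def)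
    finally show ?thesis .
  qed
  have "signed_integral S (\<lambda>A. if A \<in> sets S then \<integral>x. indicator A (T x) * b x \<partial>P else 0) f
    = (\<Sum>s\<in>{1, -1}. s * (\<integral>x. f x \<partial>m s))"
  proof (rule signed_integral_eqI[OF _ _ _ _ f])
    show "(\<lambda>A. if A \<in> sets S then \<integral>x. indicator A (T x) * b x \<partial>P else 0) \<in> vector_measures S"
      using pushforward_density_vector_measure[OF T b] by (simp only: real_scaleR_def)
    fix A assume A: "A \<in> sets S"
    then have "indicator A \<in> bounded_measurable S" by (intro bounded_measurableI[where K = 1]) auto
    from split[OF this] A show "(if A \<in> sets S then \<integral>x. indicator A (T x) * b x \<partial>P else 0) = (\<Sum>s\<in>{1, -1}. s * measure (m s) A)"
      by (simp add: m_def)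
  qed (simp_all add: m_fin, simp add: m_def)
  with split[OF f] show ?thesis by simp
qed

section \<open>Finite-dimensional separation and affine minorants\<close>

text \<open>
  Divide by \<open>t\<close> and let \<open>t\<close> tend to 0.  This extracts first-order conditions below, in the
  projection theorem as well as at the dual maximizer.
\<close>

lemma nonneg_of_quadratic:
  fixes a b e :: real
  assumes e: "0 < e" and "\<And>t. 0 < t \<Longrightarrow> t \<le> e \<Longrightarrow> 0 \<le> t * a + t\<^sup>2 * b"
  shows "0 \<le> a"
proof (rule tendsto_lowerbound)
  show "((\<lambda>t. a + t * b) \<longlongrightarrow> a) (at_right 0)"
    by (auto intro!: tendsto_eq_intros)
  show "\<forall>\<^sub>F t in at_right 0. 0 \<le> a + t * b"
    unfolding eventually_at_right_field
  proof (intro exI[of _ e] conjI allI impI)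
    fix t :: real assume t: "0 < t" "t < e"
    have "t * a + t\<^sup>2 * b = t * (a + t * b)" by (simp add: power2_eq_square algebra_simps)
    with assms(2)[of t] t have "0 \<le> t * (a + t * b)" by simp
    then show "0 \<le> a + t * b" using t by (simp add: zero_le_mult_iff)
  qed (fact e)
qed simp

text \<open>
  The point of smallest norm in the closure of \<open>S\<close> is a separating normal vector.  It is the limit
  of a minimizing sequence, which is Cauchy by the parallelogram law, and its variational inequality
  is the separation.  Coordinates indexed by a finite set, in place of a Euclidean space type, let
  the dimension depend on the neighbourhood chosen later.
\<close>

lemma separate_from_origin:
  fixes S :: "('i \<Rightarrow> real) set"
  assumes I: "finite I" and ne: "S \<noteq> {}"
    and conv: "\<And>x y t. x \<in> S \<Longrightarrow> y \<in> S \<Longrightarrow> 0 \<le> t \<Longrightarrow> t \<le> 1 \<Longrightarrow>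
        \<exists>z\<in>S. \<forall>i\<in>I. z i = (1 - t) * x i + t * y i"
    and away: "0 < d" "\<And>x. x \<in> S \<Longrightarrow> d \<le> (\<Sum>i\<in>I. (x i)\<^sup>2)"
  shows "\<exists>w. \<exists>d'>0. \<forall>x\<in>S. d' \<le> (\<Sum>i\<in>I. w i * x i)"
proof -
  define q where "q x = (\<Sum>i\<in>I. (x i)\<^sup>2)" for x :: "'i \<Rightarrow> real"
  define D where "D = Inf (q ` S)"
  have bdd: "bdd_below (q ` S)" by (intro bdd_belowI[of _ 0]) (auto simp: q_def sum_nonneg)
  have D_le: "D \<le> q x" if "x \<in> S" for x unfolding D_def using bdd that by (intro cInf_lower) auto
  have "d \<le> D" unfolding D_def using ne away(2) by (intro cInf_greatest) (auto simp: q_def)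
  then have D: "0 < D" using away(1) by simp
  have "\<exists>x\<in>S. q x < D + 1 / (real n + 1)" for n
    using cInf_lessD[of "q ` S" "D + 1 / (real n + 1)"] ne by (auto simp: D_def)
  then obtain s where s: "\<And>n. s n \<in> S" "\<And>n. q (s n) < D + 1 / (real n + 1)" by metis
  \<comment> \<open>The parallelogram law, with the midpoint of two points of \<open>S\<close> not below the infimum.\<close>
  have midpoint: "(\<Sum>i\<in>I. (x i - y i)\<^sup>2) \<le> 2 * (q x - D) + 2 * (q y - D)" if xy: "x \<in> S" "y \<in> S" for x y
  proof -
    obtain z where z: "z \<in> S" "\<And>i. i \<in> I \<Longrightarrow> z i = (x i + y i) / 2"
      using conv[OF xy, of "1/2"] by (auto simp: add_divide_distrib)
    have "q z = (\<Sum>i\<in>I. ((x i + y i) / 2)\<^sup>2)" unfolding q_def by (rule sum.cong) (simp_all only: z(2))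
    then have "4 * D \<le> (\<Sum>i\<in>I. (x i + y i)\<^sup>2)"
      using D_le[OF z(1)] by (simp add: power_divide flip: sum_divide_distrib)
    moreover have "(\<Sum>i\<in>I. (x i - y i)\<^sup>2) + (\<Sum>i\<in>I. (x i + y i)\<^sup>2) = 2 * q x + 2 * q y"
      unfolding q_def sum_distrib_left sum.distrib[symmetric]
      by (intro sum.cong) (simp_all add: power2_eq_square algebra_simps)
    ultimately show ?thesis by simp
  qed
  have "\<exists>l. (\<lambda>n. s n i) \<longlonglongrightarrow> l" if i: "i \<in> I" for i
  proof -
    have "Cauchy (\<lambda>n. s n i)"
    proof (rule metric_CauchyI)
      fix e :: real assume e: "0 < e"
      obtain N where N: "4 / e\<^sup>2 < real N" using reals_Archimedean2 by blast
      have small: "2 * (q (s n) - D) < e\<^sup>2 / 2" if "N \<le> n" for n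
      proof -
        have "4 / e\<^sup>2 < real n + 1" using N that by simp
        then have "1 / (real n + 1) < e\<^sup>2 / 4" using e by (simp add: field_simps)
        then show ?thesis using s(2)[of n] by simp
      qed
      show "\<exists>M. \<forall>m\<ge>M. \<forall>n\<ge>M. dist (s m i) (s n i) < e"
      proof (intro exI[of _ N] allI impI)
        fix m n assume mn: "N \<le> m" "N \<le> n"
        have "(s m i - s n i)\<^sup>2 \<le> (\<Sum>i\<in>I. (s m i - s n i)\<^sup>2)"
          using I i by (intro member_le_sum) auto
        also have "\<dots> < e\<^sup>2" using midpoint[OF s(1) s(1), of m n] small[OF mn(1)] small[OF mn(2)] by linarith
        finally show "dist (s m i) (s n i) < e"
          using e power2_less_imp_less[of "\<bar>s m i - s n i\<bar>" e] by (simp add: dist_real_def)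
      qed
    qed
    then show ?thesis by (simp add: Cauchy_convergent_iff convergent_def)
  qed
  then obtain w where w: "\<And>i. i \<in> I \<Longrightarrow> (\<lambda>n. s n i) \<longlonglongrightarrow> w i" by metis
  have q_lim: "(\<lambda>n. q (s n)) \<longlonglongrightarrow> q w" unfolding q_def by (intro tendsto_sum tendsto_power w)
  have "D \<le> q w" by (rule LIMSEQ_le_const[OF q_lim]) (use D_le s in auto)
  have "(\<lambda>n. D + 1 / (real n + 1)) \<longlonglongrightarrow> D + 0"
    using LIMSEQ_inverse_real_of_nat
    by (intro tendsto_add tendsto_const) (simp add: inverse_eq_divide add.commute)
  then have "q w \<le> D"
    using q_lim s(2) by (intro LIMSEQ_le[OF q_lim]) (auto intro: less_imp_le)
  have "D \<le> (\<Sum>i\<in>I. w i * x i)" if x: "x \<in> S" for x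
  proof -
    have "0 \<le> t * (2 * (\<Sum>i\<in>I. w i * (x i - w i))) + t\<^sup>2 * (\<Sum>i\<in>I. (x i - w i)\<^sup>2)"
      if t: "0 < t" "t \<le> 1" for t
    proof -
      have "D \<le> (\<Sum>i\<in>I. ((1 - t) * s n i + t * x i)\<^sup>2)" for n
      proof -
        obtain z where "z \<in> S" "\<forall>i\<in>I. z i = (1 - t) * s n i + t * x i"
          using conv[OF s(1) x, of t] t by auto
        then show ?thesis using D_le[of z] by (simp add: q_def)
      qed
      moreover have "(\<lambda>n. \<Sum>i\<in>I. ((1 - t) * s n i + t * x i)\<^sup>2) \<longlonglongrightarrow> (\<Sum>i\<in>I. ((1 - t) * w i + t * x i)\<^sup>2)"
        by (intro tendsto_intros w)
      ultimately have "D \<le> (\<Sum>i\<in>I. ((1 - t) * w i + t * x i)\<^sup>2)"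
        by (intro LIMSEQ_le_const) auto
      also have "\<dots> = q w + (t * (2 * (\<Sum>i\<in>I. w i * (x i - w i))) + t\<^sup>2 * (\<Sum>i\<in>I. (x i - w i)\<^sup>2))"
        unfolding q_def sum_distrib_left sum.distrib[symmetric]
        by (intro sum.cong) (simp_all add: power2_eq_square algebra_simps)
      finally show ?thesis using \<open>q w \<le> D\<close> by simp
    qed
    from nonneg_of_quadratic[OF zero_less_one this] have "0 \<le> (\<Sum>i\<in>I. w i * (x i - w i))" by simp
    also have "\<dots> = (\<Sum>i\<in>I. w i * x i) - q w"
      by (simp add: q_def power2_eq_square right_diff_distrib sum_subtractf)
    finally show ?thesis using \<open>D \<le> q w\<close> by simp
  qed
  with D show ?thesis by blast
qed

text \<open>
  Convexity of the epigraph.  It avoids products and sums of infinite values and is therefore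
  easier to combine than the inequality between extended reals.
\<close>

definition convex_epi :: "(real \<Rightarrow> 'u \<Rightarrow> 'u \<Rightarrow> 'u) \<Rightarrow> 'u set \<Rightarrow> ('u \<Rightarrow> ereal) \<Rightarrow> bool" where
  "convex_epi comb V F \<longleftrightarrow> (\<forall>u\<in>V. \<forall>v\<in>V. \<forall>t\<in>{0..1}. \<forall>r s. F u \<le> ereal r \<longrightarrow> F v \<le> ereal s \<longrightarrow>
     F (comb t u v) \<le> ereal ((1 - t) * r + t * s))"

text \<open>
  Lower semicontinuity for the weak topology of \<open>L\<close>, expressed through basic neighbourhoods: a
  strict lower bound at a point persists as long as finitely many functionals move little.
\<close>

definition lsc_along :: "'u set \<Rightarrow> ('u \<Rightarrow> real) set \<Rightarrow> ('u \<Rightarrow> ereal) \<Rightarrow> bool" where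
  "lsc_along V L F \<longleftrightarrow> (\<forall>u0\<in>V. \<forall>a. ereal a < F u0 \<longrightarrow>
     (\<exists>Y e. finite Y \<and> Y \<subseteq> L \<and> 0 < e \<and>
       (\<forall>u\<in>V. (\<forall>l\<in>Y. \<bar>l u - l u0\<bar> < e) \<longrightarrow> ereal a < F u)))"

text \<open>
  The abstract setting for Fenchel--Moreau.  The points form a set with a convex combination
  operation, not a vector space; \<open>L\<close> is a nonempty family of affine functions on it that is closed
  under linear combinations.
\<close>

locale dual_functionals =
  fixes V :: "'u set" and comb :: "real \<Rightarrow> 'u \<Rightarrow> 'u \<Rightarrow> 'u" and L :: "('u \<Rightarrow> real) set"
  assumes comb_closed: "\<And>u v t. u \<in> V \<Longrightarrow> v \<in> V \<Longrightarrow> 0 \<le> t \<Longrightarrow> t \<le> 1 \<Longrightarrow> comb t u v \<in> V"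
    and L_comb: "\<And>l u v t. l \<in> L \<Longrightarrow> u \<in> V \<Longrightarrow> v \<in> V \<Longrightarrow> 0 \<le> t \<Longrightarrow> t \<le> 1 \<Longrightarrow>
        l (comb t u v) = (1 - t) * l u + t * l v"
    and L_nonempty: "L \<noteq> {}"
    and L_lincomb: "\<And>k l a b. k \<in> L \<Longrightarrow> l \<in> L \<Longrightarrow> \<exists>m\<in>L. \<forall>u\<in>V. m u = a * k u + b * l u"
begin

lemma L_sum:
  assumes "finite Y" "Y \<subseteq> L"
  shows "\<exists>m\<in>L. \<forall>u\<in>V. m u = (\<Sum>l\<in>Y. c l * l u)"
  using assms
proof (induction Y)
  case empty
  obtain l where "l \<in> L" using L_nonempty by auto
  from L_lincomb[OF this this, of 0 0] show ?case by simp
next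
  case (insert l Y)
  then obtain m where m: "m \<in> L" "\<And>u. u \<in> V \<Longrightarrow> m u = (\<Sum>l\<in>Y. c l * l u)" by auto
  from L_lincomb[OF _ m(1), of l "c l" 1] insert m show ?case by auto
qed

text \<open>
  On the neighbourhood given by lower semicontinuity the epigraph stays above level \<open>b > a\<close>, and
  off it one of finitely many functionals has moved by \<open>e\<close>.  Hence the image of the epigraph in those
  finitely many coordinates, recentred at \<open>(u0, a)\<close>, is bounded away from the origin.
\<close>

lemma separation:
  assumes conv: "convex_epi comb V F" and lsc: "lsc_along V L F" and v: "v \<in> V" "F v \<noteq> \<infinity>" "F v \<noteq> -\<infinity>"
    and u0: "u0 \<in> V" and a: "ereal a < F u0"
  obtains w0 d :: real and l where "0 \<le> w0" "0 < d" "l \<in> L"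
    "\<And>u t. u \<in> V \<Longrightarrow> F u \<le> ereal t \<Longrightarrow> d \<le> w0 * (t - a) + (l u - l u0)"
proof -
  obtain b where b: "a < b" "ereal b < F u0" using ereal_dense2[OF a] by auto
  obtain Y e where Y: "finite Y" "Y \<subseteq> L" and e: "0 < e"
    and nb: "\<And>u. u \<in> V \<Longrightarrow> (\<forall>l\<in>Y. \<bar>l u - l u0\<bar> < e) \<Longrightarrow> ereal b < F u"
    using lsc u0 b(2) unfolding lsc_along_def by metis
  define p where "p u t = (\<lambda>i. case i of None \<Rightarrow> t - a | Some l \<Rightarrow> l u - l u0)" for u and t :: real
  define S where "S = {p u t | u t. u \<in> V \<and> F u \<le> ereal t}"
  define I where "I = insert None (Some ` Y)"
  have sumI: "(\<Sum>i\<in>I. g i) = g None + (\<Sum>l\<in>Y. g (Some l))" for g :: "_ \<Rightarrow> real"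
    unfolding I_def using Y by (subst sum.insert) (auto simp: sum.reindex)
  have "\<exists>w. \<exists>d'>0. \<forall>x\<in>S. d' \<le> (\<Sum>i\<in>I. w i * x i)"
  proof (rule separate_from_origin)
    show "finite I" using Y by (simp add: I_def)
    show "S \<noteq> {}"
    proof -
      obtain r where "F v = ereal r" using v by (cases "F v") auto
      then have "p v r \<in> S" unfolding S_def using v by fastforce
      then show ?thesis by blast
    qed
    show "0 < min (e\<^sup>2) ((b - a)\<^sup>2)" using e b by simp
  next
    fix x y t assume "x \<in> S" "y \<in> S" and t: "0 \<le> t" "t \<le> (1::real)"
    then obtain u r u' r' where x: "x = p u r" "u \<in> V" "F u \<le> ereal r"
      and y: "y = p u' r'" "u' \<in> V" "F u' \<le> ereal r'" by (auto simp: S_def)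
    have "p (comb t u u') ((1 - t) * r + t * r') \<in> S"
    proof -
      have "F (comb t u u') \<le> ereal ((1 - t) * r + t * r')"
        using conv x y t by (simp add: convex_epi_def)
      then show ?thesis using comb_closed[OF x(2) y(2) t] unfolding S_def by blast
    qed
    moreover have "\<forall>i\<in>I. p (comb t u u') ((1 - t) * r + t * r') i = (1 - t) * x i + t * y i"
      using x y t Y by (auto simp: I_def p_def L_comb algebra_simps subset_eq)
    ultimately show "\<exists>z\<in>S. \<forall>i\<in>I. z i = (1 - t) * x i + t * y i" by blast
  next
    fix x assume "x \<in> S"
    then obtain u t where x: "x = p u t" and u: "u \<in> V" "F u \<le> ereal t" by (auto simp: S_def)
    have q: "(\<Sum>i\<in>I. (x i)\<^sup>2) = (t - a)\<^sup>2 + (\<Sum>l\<in>Y. (l u - l u0)\<^sup>2)" by (simp add: sumI x p_def)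
    show "min (e\<^sup>2) ((b - a)\<^sup>2) \<le> (\<Sum>i\<in>I. (x i)\<^sup>2)"
    proof (cases "\<forall>l\<in>Y. \<bar>l u - l u0\<bar> < e")
      case True
      have "ereal b < ereal t" using nb[OF u(1) True] u(2) by (rule less_le_trans)
      then have "(b - a)\<^sup>2 \<le> (t - a)\<^sup>2" using b by (intro power_mono) auto
      moreover have "0 \<le> (\<Sum>l\<in>Y. (l u - l u0)\<^sup>2)" by (simp add: sum_nonneg)
      ultimately show ?thesis unfolding q by linarith
    next
      case False
      then obtain l where l: "l \<in> Y" "e \<le> \<bar>l u - l u0\<bar>" by (auto simp: not_less)
      have "e\<^sup>2 \<le> (l u - l u0)\<^sup>2" using power_mono[OF l(2), of 2] e by simp
      also have "\<dots> \<le> (\<Sum>l\<in>Y. (l u - l u0)\<^sup>2)" using Y l by (intro member_le_sum) auto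
      finally show ?thesis unfolding q using zero_le_power2[of "t - a"] by linarith
    qed
  qed
  then obtain w d where d: "0 < d" "\<And>x. x \<in> S \<Longrightarrow> d \<le> (\<Sum>i\<in>I. w i * x i)" by blast
  obtain l where l: "l \<in> L" "\<And>u. u \<in> V \<Longrightarrow> l u = (\<Sum>l\<in>Y. w (Some l) * l u)"
    using L_sum[OF Y, of "\<lambda>l. w (Some l)"] by auto
  have main: "d \<le> w None * (t - a) + (l u - l u0)" if "u \<in> V" "F u \<le> ereal t" for u t
  proof -
    have "p u t \<in> S" using that by (auto simp: S_def)
    from d(2)[OF this] show ?thesis
      by (simp add: sumI p_def l that u0 right_diff_distrib sum_subtractf)
  qed
  have "0 \<le> w None"
  proof (rule ccontr)
    assume neg: "\<not> 0 \<le> w None"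
    obtain r where r: "F v = ereal r" using v by (cases "F v") auto
    \<comment> \<open>The epigraph contains the vertical ray above \<open>v\<close>, so a negative slope is refuted far up.\<close>
    define t where "t = max r (a + \<bar>l v - l u0\<bar> / (- w None))"
    have "F v \<le> ereal t" by (simp add: r t_def)
    from main[OF v(1) this] have 1: "d \<le> w None * (t - a) + (l v - l u0)" .
    have "\<bar>l v - l u0\<bar> / (- w None) \<le> t - a" by (simp add: t_def)
    then have "\<bar>l v - l u0\<bar> \<le> - (w None * (t - a))" using neg by (simp add: field_simps)
    with 1 d(1) show False by linarith
  qed
  then show ?thesis using that d(1) l(1) main by blast
qed

text \<open>
  The Fenchel--Moreau theorem: \<open>F\<close> is the supremum of its affine minorants.  A separating hyperplane
  that is not vertical is such a minorant after division by its slope.  At a point of the effective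
  domain the hyperplane cannot be vertical, which yields at least one minorant; at other points a
  vertical hyperplane is tilted by adding a large multiple of it to that minorant.
\<close>

theorem affine_minorant:
  assumes conv: "convex_epi comb V F" and lsc: "lsc_along V L F"
    and proper: "\<And>u. u \<in> V \<Longrightarrow> F u \<noteq> -\<infinity>" "v \<in> V" "F v \<noteq> \<infinity>"
    and u0: "u0 \<in> V" and a: "ereal a < F u0"
  obtains l c where "l \<in> L" "\<And>u. u \<in> V \<Longrightarrow> ereal (l u - c) \<le> F u" "a < l u0 - c"
proof -
  have nonvertical: Q if w0: "0 < w0" and "0 < d" "l \<in> L" "u1 \<in> V"
      and *: "\<And>u t. u \<in> V \<Longrightarrow> F u \<le> ereal t \<Longrightarrow> d \<le> w0 * (t - a1) + (l u - l u1)"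
      and c: "\<And>m c. m \<in> L \<Longrightarrow> (\<And>u. u \<in> V \<Longrightarrow> ereal (m u - c) \<le> F u) \<Longrightarrow> a1 < m u1 - c \<Longrightarrow> Q"
    for w0 d a1 l u1 Q
  proof -
    obtain m where m: "m \<in> L" "\<And>u. u \<in> V \<Longrightarrow> m u = - (1 / w0) * l u"
      using L_lincomb[OF \<open>l \<in> L\<close> \<open>l \<in> L\<close>, of "- (1 / w0)" 0] by auto
    show ?thesis
    proof (rule c[OF m(1), of "m u1 - a1 - d / w0"])
      fix u assume u: "u \<in> V"
      show "ereal (m u - (m u1 - a1 - d / w0)) \<le> F u"
      proof (cases "F u")
        case (real r)
        from *[OF u, of r] real have "d \<le> w0 * (r - a1) + (l u - l u1)" by simp
        then have "d / w0 \<le> r - a1 + (l u - l u1) / w0" using w0 by (simp add: field_simps)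
        then show ?thesis by (simp add: real m u \<open>u1 \<in> V\<close> diff_divide_distrib)
      qed (use proper(1)[OF u] in auto)
    next
      show "a1 < m u1 - (m u1 - a1 - d / w0)" using w0 \<open>0 < d\<close> by simp
    qed
  qed
  obtain r where r: "F v = ereal r" using proper by (cases "F v") auto
  obtain m c where m: "m \<in> L" "\<And>u. u \<in> V \<Longrightarrow> ereal (m u - c) \<le> F u"
  proof -
    have "ereal (r - 1) < F v" by (simp add: r)
    then obtain w0 d l where wd: "0 \<le> w0" "0 < d" "l \<in> L"
      and *: "\<And>u t. u \<in> V \<Longrightarrow> F u \<le> ereal t \<Longrightarrow> d \<le> w0 * (t - (r - 1)) + (l u - l v)"
      using separation[OF conv lsc proper(2,3) proper(1)[OF proper(2)] proper(2)] by blast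
    have "w0 \<noteq> 0" using *[OF proper(2), of r] wd by (auto simp: r)
    with wd(1) have "0 < w0" by simp
    from nonvertical[OF this wd(2,3) proper(2) *] that show ?thesis by blast
  qed
  obtain w0 d l where wd: "0 \<le> w0" "0 < d" "l \<in> L"
      and *: "\<And>u t. u \<in> V \<Longrightarrow> F u \<le> ereal t \<Longrightarrow> d \<le> w0 * (t - a) + (l u - l u0)"
    using separation[OF conv lsc proper(2,3) proper(1)[OF proper(2)] u0 a] by blast
  show ?thesis
  proof (cases "w0 = 0")
    case False
    with wd(1) have "0 < w0" by simp
    from nonvertical[OF this wd(2,3) u0 *] that show ?thesis by blast
  next
    case True
    \<comment> \<open>Large enough for the tilted minorant to pass the level \<open>a\<close> at \<open>u0\<close>.\<close>
    define K where "K = (\<bar>a - (m u0 - c)\<bar> + 1) / d"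
    have K: "0 \<le> K" "K * d = \<bar>a - (m u0 - c)\<bar> + 1" using wd by (auto simp: K_def)
    obtain n where n: "n \<in> L" "\<And>u. u \<in> V \<Longrightarrow> n u = 1 * m u + (- K) * l u"
      using L_lincomb[OF m(1) wd(3)] by blast
    show ?thesis
    proof (rule that[OF n(1), of "c - K * l u0 - K * d"])
      fix u assume u: "u \<in> V"
      show "ereal (n u - (c - K * l u0 - K * d)) \<le> F u"
      proof (cases "F u")
        case (real t)
        have "K * d \<le> K * (l u - l u0)" using *[OF u, of t] True real K(1) by (intro mult_left_mono) auto
        moreover have "m u - c \<le> t" using m(2)[OF u] real by simp
        ultimately show ?thesis by (simp add: real n u algebra_simps)
      qed (use proper(1)[OF u] in auto)
    next
      show "a < n u0 - (c - K * l u0 - K * d)" using K(2) by (simp add: n u0)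
    qed
  qed
qed

end

section \<open>Closed convex functions for a weak topology\<close>

text \<open>
  Induction over the generation of the topology by subbasic sets.
\<close>

lemma weak_topology_neighbourhood:
  assumes "openin (weak_topology V L) U" "u0 \<in> U"
  shows "\<exists>Y e. finite Y \<and> Y \<subseteq> L \<and> 0 < e \<and> (\<forall>u\<in>V. (\<forall>l\<in>Y. \<bar>l u - l u0\<bar> < e) \<longrightarrow> u \<in> U)"
proof -
  have "generate_topology_on (insert V {{u \<in> V. l u \<in> U} | l U. l \<in> L \<and> open U}) U"
    using assms(1) by (simp add: weak_topology_def openin_topology_generated_by_iff)
  then show ?thesis using assms(2)
  proof (induction rule: generate_topology_on.induct)
    case Empty
    then show ?case by simp
  next
    case (Int a b)
    from Int.prems have u0: "u0 \<in> a" "u0 \<in> b" by auto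
    from Int.IH(1)[OF u0(1)] obtain Y e where
      "finite Y" "Y \<subseteq> L" "0 < e" "\<forall>u\<in>V. (\<forall>l\<in>Y. \<bar>l u - l u0\<bar> < e) \<longrightarrow> u \<in> a" by blast
    moreover from Int.IH(2)[OF u0(2)] obtain Y' e' where
      "finite Y'" "Y' \<subseteq> L" "0 < e'" "\<forall>u\<in>V. (\<forall>l\<in>Y'. \<bar>l u - l u0\<bar> < e') \<longrightarrow> u \<in> b" by blast
    ultimately show ?case by (intro exI[of _ "Y \<union> Y'"] exI[of _ "min e e'"]) auto
  next
    case (UN K)
    then obtain k where k: "k \<in> K" "u0 \<in> k" by auto
    from UN.IH[OF this] obtain Y e where
      "finite Y" "Y \<subseteq> L" "0 < e" "\<forall>u\<in>V. (\<forall>l\<in>Y. \<bar>l u - l u0\<bar> < e) \<longrightarrow> u \<in> k" by blast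
    then show ?case using k by blast
  next
    case (Basis s)
    then consider "s = V" | l W where "l \<in> L" "open W" "s = {u \<in> V. l u \<in> W}" by auto
    then show ?case
    proof cases
      case 1
      then show ?thesis by (intro exI[of _ "{}"] exI[of _ 1]) auto
    next
      case (2 l W)
      then obtain e where "0 < e" "\<And>y. dist y (l u0) < e \<Longrightarrow> y \<in> W"
        using Basis by (auto simp: open_dist)
      then show ?thesis using 2
        by (intro exI[of _ "{l}"] exI[of _ e]) (auto simp: dist_real_def)
    qed
  qed
qed

lemma topspace_weak_topology: "topspace (weak_topology V L) = V"
  by (auto simp: weak_topology_def topology_generated_by_topspace)

lemma lsc_on_weak_topology:
  assumes "lsc_on (weak_topology V L) F" shows "lsc_along V L F"
  unfolding lsc_along_def
proof (intro ballI allI impI)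
  fix u0 a assume u0: "u0 \<in> V" "ereal a < F u0"
  have "openin (weak_topology V L) {u \<in> V. ereal a < F u}"
    using assms by (simp add: lsc_on_def topspace_weak_topology)
  from weak_topology_neighbourhood[OF this, of u0] u0
  show "\<exists>Y e. finite Y \<and> Y \<subseteq> L \<and> 0 < e \<and> (\<forall>u\<in>V. (\<forall>l\<in>Y. \<bar>l u - l u0\<bar> < e) \<longrightarrow> ereal a < F u)"
    by simp
qed

lemma lsc_on_real:
  assumes "lsc_on euclideanreal F" shows "lsc_along UNIV {\<lambda>x. x} F"
  unfolding lsc_along_def
proof (intro ballI allI impI)
  fix u0 a assume u0: "ereal a < F u0"
  have "open {u. ereal a < F u}" using assms by (simp add: lsc_on_def)
  then obtain e where "0 < e" "\<And>u. dist u u0 < e \<Longrightarrow> ereal a < F u"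
    using u0 by (auto simp: open_dist)
  then show "\<exists>Y e. finite Y \<and> Y \<subseteq> {\<lambda>x. x} \<and> 0 < e \<and> (\<forall>u\<in>UNIV. (\<forall>l\<in>Y. \<bar>l u - l u0\<bar> < e) \<longrightarrow> ereal a < F u)"
    by (intro exI[of _ "{\<lambda>x. x}"] exI[of _ e]) (auto simp: dist_real_def)
qed

text \<open>
  A strict lower bound on a sum is split into strict lower bounds on the summands, which is possible
  as neither of them is minus infinity.
\<close>

lemma lsc_along_add:
  assumes F: "lsc_along V L F" "\<And>u. u \<in> V \<Longrightarrow> F u \<noteq> -\<infinity>" and G: "lsc_along V L G" "\<And>u. u \<in> V \<Longrightarrow> G u \<noteq> -\<infinity>"
  shows "lsc_along V L (\<lambda>u. F u + G u)"
  unfolding lsc_along_def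
proof (intro ballI allI impI)
  fix u0 a assume u0: "u0 \<in> V" and a: "ereal a < F u0 + G u0"
  obtain b c where bc: "a = b + c" "ereal b < F u0" "ereal c < G u0"
  proof (cases "F u0")
    case (real r)
    show ?thesis
    proof (cases "G u0")
      case (real s)
      with \<open>F u0 = ereal r\<close> a show ?thesis
        by (intro that[of "r - (r + s - a) / 2" "s - (r + s - a) / 2"]) (auto simp: field_simps)
    next
      case PInf
      with \<open>F u0 = ereal r\<close> show ?thesis by (intro that[of "r - 1" "a - (r - 1)"]) auto
    qed (use G(2)[OF u0] in simp)
  next
    case PInf
    obtain c where "ereal c < G u0" using ereal_dense2[of "-\<infinity>" "G u0"] G(2)[OF u0] by auto
    then show ?thesis using PInf by (intro that[of "a - c" c]) auto
  qed (use F(2)[OF u0] in simp)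
  obtain Y e where Y: "finite Y" "Y \<subseteq> L" "0 < e"
      "\<And>u. u \<in> V \<Longrightarrow> (\<forall>l\<in>Y. \<bar>l u - l u0\<bar> < e) \<Longrightarrow> ereal b < F u"
    using F(1) u0 bc(2) unfolding lsc_along_def by metis
  obtain Y' e' where Y': "finite Y'" "Y' \<subseteq> L" "0 < e'"
      "\<And>u. u \<in> V \<Longrightarrow> (\<forall>l\<in>Y'. \<bar>l u - l u0\<bar> < e') \<Longrightarrow> ereal c < G u"
    using G(1) u0 bc(3) unfolding lsc_along_def by metis
  have "ereal a < F u + G u" if u: "u \<in> V" "\<forall>l\<in>Y \<union> Y'. \<bar>l u - l u0\<bar> < min e e'" for u
  proof -
    have "ereal b < F u" "ereal c < G u" using u by (auto intro!: Y Y')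
    then show ?thesis unfolding bc(1) plus_ereal.simps(1)[symmetric] by (rule ereal_add_strict_mono2)
  qed
  then show "\<exists>Y e. finite Y \<and> Y \<subseteq> L \<and> 0 < e \<and> (\<forall>u\<in>V. (\<forall>l\<in>Y. \<bar>l u - l u0\<bar> < e) \<longrightarrow> ereal a < F u + G u)"
    using Y Y' by (intro exI[of _ "Y \<union> Y'"] exI[of _ "min e e'"]) auto
qed

lemma lsc_along_compose:
  assumes F: "lsc_along V' L' F" and f: "\<And>u. u \<in> V \<Longrightarrow> f u \<in> V'"
    and L: "\<And>l. l \<in> L' \<Longrightarrow> \<exists>m\<in>L. \<forall>u\<in>V. m u = l (f u)"
  shows "lsc_along V L (\<lambda>u. F (f u))"
  unfolding lsc_along_def
proof (intro ballI allI impI)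
  fix u0 a assume u0: "u0 \<in> V" and a: "ereal a < F (f u0)"
  obtain Y e where Y: "finite Y" "Y \<subseteq> L'" "0 < e"
      "\<And>u. u \<in> V' \<Longrightarrow> (\<forall>l\<in>Y. \<bar>l u - l (f u0)\<bar> < e) \<Longrightarrow> ereal a < F u"
    using F f[OF u0] a unfolding lsc_along_def by metis
  obtain m where m: "\<And>l. l \<in> L' \<Longrightarrow> m l \<in> L" "\<And>l u. l \<in> L' \<Longrightarrow> u \<in> V \<Longrightarrow> m l u = l (f u)"
    using L by metis
  have "ereal a < F (f u)" if u: "u \<in> V" "\<forall>l\<in>m ` Y. \<bar>l u - l u0\<bar> < e" for u
    using Y(2) u u0 m(2) by (intro Y(4) f) (auto simp: subset_eq)
  then show "\<exists>Y e. finite Y \<and> Y \<subseteq> L \<and> 0 < e \<and> (\<forall>u\<in>V. (\<forall>l\<in>Y. \<bar>l u - l u0\<bar> < e) \<longrightarrow> ereal a < F (f u))"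
    using Y(1-3) m(1) by (intro exI[of _ "m ` Y"] exI[of _ e]) auto
qed

lemma convex_fun_imp_epi:
  assumes "convex_fun comb V F" "\<And>u. u \<in> V \<Longrightarrow> F u \<noteq> -\<infinity>" shows "convex_epi comb V F"
  unfolding convex_epi_def
proof (intro ballI allI impI)
  fix u v t r s assume V: "u \<in> V" "v \<in> V" and t: "t \<in> {0..1::real}"
    and rs: "F u \<le> ereal r" "F v \<le> ereal s"
  have "F (comb t u v) \<le> ereal (1 - t) * F u + ereal t * F v"
    using assms(1) V t by (auto simp: convex_fun_def)
  also have "\<dots> \<le> ereal (1 - t) * ereal r + ereal t * ereal s"
    using rs t by (intro add_mono ereal_mult_left_mono) auto
  finally show "F (comb t u v) \<le> ereal ((1 - t) * r + t * s)" by simp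
qed

lemma convex_epi_add:
  assumes F: "convex_epi comb V F" "\<And>u. u \<in> V \<Longrightarrow> F u \<noteq> -\<infinity>" and G: "convex_epi comb V G" "\<And>u. u \<in> V \<Longrightarrow> G u \<noteq> -\<infinity>"
  shows "convex_epi comb V (\<lambda>u. F u + G u)"
  unfolding convex_epi_def
proof (intro ballI allI impI)
  fix u v t r s assume V: "u \<in> V" "v \<in> V" and t: "t \<in> {0..1::real}"
    and rs: "F u + G u \<le> ereal r" "F v + G v \<le> ereal s"
  obtain a b where u: "F u = ereal a" "G u = ereal b"
    using rs(1) F(2)[OF V(1)] G(2)[OF V(1)] by (cases "F u"; cases "G u") auto
  obtain c d where v: "F v = ereal c" "G v = ereal d"
    using rs(2) F(2)[OF V(2)] G(2)[OF V(2)] by (cases "F v"; cases "G v") auto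
  have "F (comb t u v) + G (comb t u v) \<le> ereal ((1 - t) * a + t * c) + ereal ((1 - t) * b + t * d)"
    using F(1) G(1) V t u v unfolding convex_epi_def by (intro add_mono) auto
  also have "\<dots> = ereal ((1 - t) * (a + b) + t * (c + d))" by (simp add: algebra_simps)
  also have "\<dots> \<le> ereal ((1 - t) * r + t * s)"
    using rs t u v by (auto intro!: add_mono mult_left_mono)
  finally show "F (comb t u v) + G (comb t u v) \<le> ereal ((1 - t) * r + t * s)" .
qed

lemma convex_epi_compose:
  assumes "convex_epi comb' V' F" "\<And>u. u \<in> V \<Longrightarrow> f u \<in> V'"
    and "\<And>u v t. u \<in> V \<Longrightarrow> v \<in> V \<Longrightarrow> f (comb t u v) = comb' t (f u) (f v)"
  shows "convex_epi comb V (\<lambda>u. F (f u))"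
  using assms unfolding convex_epi_def by simp

definition closed_convex :: "(real \<Rightarrow> 'u \<Rightarrow> 'u \<Rightarrow> 'u) \<Rightarrow> 'u set \<Rightarrow> ('u \<Rightarrow> real) set \<Rightarrow> ('u \<Rightarrow> ereal) \<Rightarrow> bool" where
  "closed_convex comb V L F \<longleftrightarrow> convex_epi comb V F \<and> lsc_along V L F \<and> (\<forall>u\<in>V. F u \<noteq> -\<infinity>)"

lemma closed_convex_add:
  "closed_convex comb V L F \<Longrightarrow> closed_convex comb V L G \<Longrightarrow> closed_convex comb V L (\<lambda>u. F u + G u)"
  unfolding closed_convex_def by (auto intro!: convex_epi_add lsc_along_add)

lemma closed_convex_sum:
  assumes "finite I" "\<And>i. i \<in> I \<Longrightarrow> closed_convex comb V L (F i)"
  shows "closed_convex comb V L (\<lambda>u. \<Sum>i\<in>I. F i u)"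
  using assms
proof (induction I)
  case empty
  show ?case
    by (auto simp: closed_convex_def convex_epi_def lsc_along_def zero_ereal_def intro!: exI[of _ "{}"] exI[of _ 1])
qed (simp add: closed_convex_add)

text \<open>
  Transfers the hypotheses from a factor of the space of triples to the whole space along a
  projection: every functional of the factor must come from a functional of the whole space.
\<close>

lemma closed_convex_compose:
  assumes "closed_convex comb' V' L' F" "\<And>u. u \<in> V \<Longrightarrow> f u \<in> V'"
    and "\<And>u v t. u \<in> V \<Longrightarrow> v \<in> V \<Longrightarrow> f (comb t u v) = comb' t (f u) (f v)"
    and "\<And>l. l \<in> L' \<Longrightarrow> \<exists>m\<in>L. \<forall>u\<in>V. m u = l (f u)"
  shows "closed_convex comb V L (\<lambda>u. F (f u))"
  using assms convex_epi_compose[of comb' V' F V f comb] lsc_along_compose[of V' L' F V f L]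
  by (auto simp: closed_convex_def)

section \<open>The pairing of potentials with triples\<close>

lemma Cb_bounded_measurable:
  assumes "(f :: 'a::topological_space \<Rightarrow> real) \<in> Cb A" shows "f \<in> bounded_measurable (restrict_space borel A)"
  using assms unfolding Cb_def bounded_measurable_def
  by (auto simp: space_restrict_space bounded_iff borel_measurable_continuous_on_restrict)

lemma Cb_lincomb:
  fixes f g :: "'a::topological_space \<Rightarrow> 'b::real_normed_vector"
  assumes "f \<in> Cb A" "g \<in> Cb A" shows "(\<lambda>x. a *\<^sub>R f x + b *\<^sub>R g x) \<in> Cb A"
  using assms unfolding Cb_def
  by (auto intro!: continuous_intros bounded_plus_comp bounded_scaleR_comp)

lemma Cb_zero: "(\<lambda>x. 0) \<in> Cb A"
  by (auto simp: Cb_def image_constant_conv)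

lemma Cb_nth:
  fixes f :: "'a::topological_space \<Rightarrow> real ^ 'k::finite"
  assumes "f \<in> Cb A" shows "(\<lambda>x. f x $ j) \<in> Cb A"
proof -
  obtain K where K: "\<And>x. x \<in> A \<Longrightarrow> norm (f x) \<le> K" using assms by (auto simp: Cb_def bounded_iff)
  have "norm (f x $ j) \<le> K" if "x \<in> A" for x
    using K[OF that] component_le_norm_cart[of "f x" j] by simp
  moreover have "continuous_on A (\<lambda>x. f x $ j)" using assms by (auto simp: Cb_def intro!: continuous_intros)
  ultimately show ?thesis by (auto simp: Cb_def bounded_iff)
qed

lemma signed_integral_zero [simp]: "signed_integral S \<mu> (\<lambda>x. 0) = 0"
  by (simp add: signed_integral_def)

lemma vector_integral_zero [simp]: "vector_integral S p (\<lambda>x. 0) = 0"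
  by (simp add: vector_integral_def)

lemma vector_integral_lincomb_measure:
  assumes "p \<in> vector_measures (restrict_space borel A)" "q \<in> vector_measures (restrict_space borel A)" "\<psi> \<in> Cb A"
  shows "vector_integral (restrict_space borel A) (\<lambda>D. a *\<^sub>R p D + b *\<^sub>R q D) \<psi>
    = a * vector_integral (restrict_space borel A) p \<psi> + b * vector_integral (restrict_space borel A) q \<psi>"
  unfolding vector_integral_def vector_add_component vector_scaleR_component real_scaleR_def
    signed_integral_lincomb_measure[OF vector_measures_nth[OF assms(1)] vector_measures_nth[OF assms(2)]
      Cb_bounded_measurable[OF Cb_nth[OF assms(3)]]]
  by (simp add: sum.distrib sum_distrib_left)

lemma vector_integral_lincomb_fun:
  assumes "p \<in> vector_measures (restrict_space borel A)" "\<psi> \<in> Cb A" "\<psi>' \<in> Cb A"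
  shows "vector_integral (restrict_space borel A) p (\<lambda>x. a *\<^sub>R \<psi> x + b *\<^sub>R \<psi>' x)
    = a * vector_integral (restrict_space borel A) p \<psi> + b * vector_integral (restrict_space borel A) p \<psi>'"
  unfolding vector_integral_def vector_add_component vector_scaleR_component real_scaleR_def
    signed_integral_lincomb_fun[OF vector_measures_nth[OF assms(1)]
      Cb_bounded_measurable[OF Cb_nth[OF assms(2)]] Cb_bounded_measurable[OF Cb_nth[OF assms(3)]]]
  by (simp add: sum.distrib sum_distrib_left)

text \<open>
  Set functions carry no vector space structure, so convex combinations are taken componentwise.
\<close>

definition comb_triple :: "real \<Rightarrow> ('a, 'k::finite) triple \<Rightarrow> ('a, 'k) triple \<Rightarrow> ('a, 'k) triple" where
  "comb_triple t = (\<lambda>(\<nu>, p, g) (\<nu>', p', g').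
     (\<lambda>k. comb_measure t (\<nu> k) (\<nu>' k), \<lambda>k. comb_measure t (p k) (p' k), \<lambda>i. comb_real t (g i) (g' i)))"

definition lincomb_potential ::
  "real \<Rightarrow> ('a, 'k::finite) potential \<Rightarrow> real \<Rightarrow> ('a, 'k) potential \<Rightarrow> ('a, 'k) potential" where
  "lincomb_potential a \<Phi> b \<Psi> = (case \<Phi> of (\<phi>, \<psi>, l) \<Rightarrow> case \<Psi> of (\<phi>', \<psi>', l') \<Rightarrow>
     (\<lambda>k x. a *\<^sub>R \<phi> k x + b *\<^sub>R \<phi>' k x, \<lambda>k x. a *\<^sub>R \<psi> k x + b *\<^sub>R \<psi>' k x, \<lambda>i. a * l i + b * l' i))"

lemma potentials_lincomb:
  "\<Phi> \<in> potentials N X \<Longrightarrow> \<Psi> \<in> potentials N X \<Longrightarrow> lincomb_potential a \<Phi> b \<Psi> \<in> potentials N X"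
  unfolding potentials_def lincomb_potential_def by (auto intro!: Cb_lincomb simp del: real_scaleR_def)

lemma pairing_lincomb:
  assumes "\<Phi> \<in> potentials N X" "\<Psi> \<in> potentials N X" "u \<in> triples N X"
  shows "pairing N NC X h (lincomb_potential a \<Phi> b \<Psi>) u
    = a * pairing N NC X h \<Phi> u + b * pairing N NC X h \<Psi> u"
proof -
  obtain \<phi> \<psi> l \<phi>' \<psi>' l' \<nu> p g where e: "\<Phi> = (\<phi>, \<psi>, l)" "\<Psi> = (\<phi>', \<psi>', l')" "u = (\<nu>, p, g)"
    by (metis prod_cases3)
  have 1: "(\<Sum>k\<le>N. signed_integral (state_space X k) (\<nu> k) (\<lambda>x. a *\<^sub>R \<phi> k x + b *\<^sub>R \<phi>' k x))
      = (\<Sum>k\<le>N. a * signed_integral (state_space X k) (\<nu> k) (\<phi> k) + b * signed_integral (state_space X k) (\<nu> k) (\<phi>' k))"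
    unfolding real_scaleR_def
    by (intro sum.cong refl signed_integral_lincomb_fun Cb_bounded_measurable)
       (use assms in \<open>auto simp: e potentials_def triples_def\<close>)
  have 2: "(\<Sum>k<N. vector_integral (state_space X k) (p k) (\<lambda>x. a *\<^sub>R \<psi> k x + b *\<^sub>R \<psi>' k x))
      = (\<Sum>k<N. a * vector_integral (state_space X k) (p k) (\<psi> k) + b * vector_integral (state_space X k) (p k) (\<psi>' k))"
    by (intro sum.cong refl vector_integral_lincomb_fun)
       (use assms in \<open>auto simp: e potentials_def triples_def\<close>)
  show ?thesis
    unfolding e pairing_def lincomb_potential_def prod.case 1 2
    by (simp add: sum.distrib sum_distrib_left algebra_simps)
qed

lemma pairing_comb_triple:
  assumes "\<Phi> \<in> potentials N X" "u \<in> triples N X" "v \<in> triples N X"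
  shows "pairing N NC X h \<Phi> (comb_triple t u v)
    = (1 - t) * pairing N NC X h \<Phi> u + t * pairing N NC X h \<Phi> v"
proof -
  obtain \<phi> \<psi> l \<nu>' p' g' \<nu> p g where e: "\<Phi> = (\<phi>, \<psi>, l)" "v = (\<nu>', p', g')" "u = (\<nu>, p, g)"
    by (metis prod_cases3)
  have 1: "(\<Sum>k\<le>N. signed_integral (state_space X k) (comb_measure t (\<nu> k) (\<nu>' k)) (\<phi> k))
      = (\<Sum>k\<le>N. (1 - t) * signed_integral (state_space X k) (\<nu> k) (\<phi> k) + t * signed_integral (state_space X k) (\<nu>' k) (\<phi> k))"
    unfolding comb_measure_def real_scaleR_def
    by (intro sum.cong refl signed_integral_lincomb_measure Cb_bounded_measurable)
       (use assms in \<open>auto simp: e potentials_def triples_def\<close>)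
  have 2: "(\<Sum>k<N. vector_integral (state_space X k) (comb_measure t (p k) (p' k)) (\<psi> k))
      = (\<Sum>k<N. (1 - t) * vector_integral (state_space X k) (p k) (\<psi> k) + t * vector_integral (state_space X k) (p' k) (\<psi> k))"
    unfolding comb_measure_def
    by (intro sum.cong refl vector_integral_lincomb_measure)
       (use assms in \<open>auto simp: e potentials_def triples_def\<close>)
  show ?thesis
    unfolding e pairing_def comb_triple_def prod.case 1 2
    by (simp add: sum.distrib sum_distrib_left comb_real_def algebra_simps)
       (simp add: sum_subtractf sum.distrib)
qed

lemma triples_comb: "u \<in> triples N X \<Longrightarrow> v \<in> triples N X \<Longrightarrow> comb_triple t u v \<in> triples N X"
  unfolding triples_def comb_triple_def comb_measure_def
  by (auto intro!: vector_measures_lincomb simp del: real_scaleR_def)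

definition pairing_functionals ::
  "nat \<Rightarrow> nat \<Rightarrow> (nat \<Rightarrow> 'a::euclidean_space set) \<Rightarrow> real \<Rightarrow> (('a, 'k::finite) triple \<Rightarrow> real) set" where
  "pairing_functionals N NC X h = pairing N NC X h ` potentials N X"

lemma zero_potential: "(\<lambda>k x. 0, \<lambda>k x. 0, \<lambda>i. 0) \<in> potentials N X"
  by (auto simp: potentials_def Cb_zero)

text \<open>
  The bilinearity of the pairing is what makes Fenchel--Moreau applicable to triples.
\<close>

lemma dual_functionals_pairing:
  "dual_functionals (triples N X) comb_triple (pairing_functionals N NC X h :: (('a::euclidean_space, 'k::finite) triple \<Rightarrow> real) set)"
proof
  show "pairing_functionals N NC X h \<noteq> ({} :: (('a, 'k) triple \<Rightarrow> real) set)"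
    using zero_potential by (auto simp: pairing_functionals_def)
next
  fix k l :: "('a, 'k) triple \<Rightarrow> real" and a b
  assume "k \<in> pairing_functionals N NC X h" "l \<in> pairing_functionals N NC X h"
  then show "\<exists>m\<in>pairing_functionals N NC X h. \<forall>u\<in>triples N X. m u = a * k u + b * l u"
    using potentials_lincomb pairing_lincomb unfolding pairing_functionals_def by blast
qed (auto simp: triples_comb pairing_functionals_def pairing_comb_triple)


lemma pairing_functionalsI:
  "\<Phi> \<in> potentials N X \<Longrightarrow> (\<And>u. u \<in> triples N X \<Longrightarrow> pairing N NC X h \<Phi> u = l u) \<Longrightarrow>
    \<exists>m\<in>pairing_functionals N NC X h. \<forall>u\<in>triples N X. m u = l u"
  unfolding pairing_functionals_def by blast

text \<open>
  Each summand depends on one component of the triple, and its functionals are pairings with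
  potentials supported at one index.  The measure parts of the pairing carry a factor \<open>h\<close>, so these
  potentials are divided by \<open>h\<close>.
\<close>

lemma closed_convex_Ffun:
  fixes X :: "nat \<Rightarrow> 'a::euclidean_space set"
    and Fmom :: "nat \<Rightarrow> ('a set \<Rightarrow> real) \<times> ('a set \<Rightarrow> real ^ 'k::finite) \<Rightarrow> ereal"
  assumes h: "0 < h"
    and mom: "\<And>k. k < N \<Longrightarrow> admissible_mom (X k) (Fmom k)"
    and marg: "\<And>k. k \<le> N \<Longrightarrow> admissible_marginal (X k) (M k)"
    and price: "\<And>i. i \<in> {1..NC} \<Longrightarrow> admissible_price (C i)"
  shows "closed_convex comb_triple (triples N X) (pairing_functionals N NC X h) (Ffun N NC Fmom M C)"
proof -
  let ?cc = "closed_convex comb_triple (triples N X) (pairing_functionals N NC X h)"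
  have mom': "?cc (\<lambda>u. Fmom k (fst u k, fst (snd u) k))" if k: "k < N" for k
  proof (rule closed_convex_compose[where F = "Fmom k"])
    let ?S = "restrict_space borel (X k)"
    show "closed_convex comb_pair (vector_measures ?S \<times> vector_measures ?S)
        {\<lambda>(\<nu>, p). signed_integral ?S \<nu> \<phi> + vector_integral ?S p \<psi> | \<phi> \<psi>. \<phi> \<in> Cb (X k) \<and> \<psi> \<in> Cb (X k)} (Fmom k)"
      using mom[OF k] unfolding admissible_mom_def Let_def closed_convex_def
      by (auto intro: lsc_on_weak_topology convex_fun_imp_epi)
    fix l :: "('a set \<Rightarrow> real) \<times> ('a set \<Rightarrow> real ^ 'k) \<Rightarrow> real"
    assume "l \<in> {\<lambda>(\<nu>, p). signed_integral ?S \<nu> \<phi> + vector_integral ?S p \<psi> | \<phi> \<psi>. \<phi> \<in> Cb (X k) \<and> \<psi> \<in> Cb (X k)}"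
    then obtain \<phi> \<psi> where l: "l = (\<lambda>(\<nu>, p). signed_integral ?S \<nu> \<phi> + vector_integral ?S p \<psi>)"
      and C: "\<phi> \<in> Cb (X k)" "\<psi> \<in> Cb (X k)" by blast
    let ?\<Phi> = "(\<lambda>j. if j = k then (\<lambda>x. (1 / h) *\<^sub>R \<phi> x) else (\<lambda>x. 0),
               \<lambda>j. if j = k then (\<lambda>x. (1 / h) *\<^sub>R \<psi> x) else (\<lambda>x. 0), \<lambda>i. 0)"
    show "\<exists>m\<in>pairing_functionals N NC X h. \<forall>u\<in>triples N X. m u = l (fst u k, fst (snd u) k)"
    proof (rule pairing_functionalsI[of ?\<Phi>])
      show "?\<Phi> \<in> potentials N X"
        using Cb_lincomb[OF C(1) C(1), of "1 / h" 0] Cb_lincomb[OF C(2) C(2), of "1 / h" 0] by (auto simp: potentials_def Cb_zero simp del: real_scaleR_def)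
      fix u :: "('a, 'k) triple" assume u: "u \<in> triples N X"
      obtain \<nu> p g where e: "u = (\<nu>, p, g)" by (metis prod_cases3)
      have S: "\<nu> k \<in> vector_measures ?S" "p k \<in> vector_measures ?S" using u k by (auto simp: triples_def e)
      have "(\<Sum>j\<le>N. signed_integral (state_space X j) (\<nu> j) (fst ?\<Phi> j)) = signed_integral ?S (\<nu> k) \<phi> / h"
        using k signed_integral_lincomb_fun[OF S(1) Cb_bounded_measurable[OF C(1)] Cb_bounded_measurable[OF C(1)], of "1 / h" 0]
        by (subst sum.remove[of _ k]) (auto intro!: sum.neutral)
      moreover have "(\<Sum>j<N. vector_integral (state_space X j) (p j) (fst (snd ?\<Phi>) j)) = vector_integral ?S (p k) \<psi> / h"
        using k vector_integral_lincomb_fun[OF S(2) C(2) C(2), of "1 / h" 0]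
        by (subst sum.remove[of _ k]) (auto intro!: sum.neutral)
      ultimately show "pairing N NC X h ?\<Phi> u = l (fst u k, fst (snd u) k)"
        using h unfolding e l pairing_def prod.case by simp
    qed
  qed (use k in \<open>auto simp: triples_def comb_triple_def comb_pair_def\<close>)
  have marg': "?cc (\<lambda>u :: ('a, 'k) triple. M k (fst u k))" if k: "k \<le> N" for k
  proof (rule closed_convex_compose[where F = "M k"])
    let ?S = "restrict_space borel (X k)"
    show "closed_convex comb_measure (vector_measures ?S)
        {\<lambda>\<nu>. signed_integral ?S \<nu> \<phi> | \<phi>. \<phi> \<in> Cb (X k)} (M k)"
      using marg[OF k] unfolding admissible_marginal_def Let_def closed_convex_def
      by (auto intro: lsc_on_weak_topology convex_fun_imp_epi)
    fix l assume "l \<in> {\<lambda>\<nu>. signed_integral ?S \<nu> \<phi> | \<phi>. \<phi> \<in> Cb (X k)}"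
    then obtain \<phi> where l: "l = (\<lambda>\<nu>. signed_integral ?S \<nu> \<phi>)" and C: "\<phi> \<in> Cb (X k)" by blast
    let ?\<Phi> = "(\<lambda>j. if j = k then (\<lambda>x. (1 / h) *\<^sub>R \<phi> x) else (\<lambda>x. 0), \<lambda>j x. 0, \<lambda>i. 0)
      :: ('a, 'k) potential"
    show "\<exists>m\<in>pairing_functionals N NC X h. \<forall>u\<in>triples N X. m u = l (fst (u :: ('a, 'k) triple) k)"
    proof (rule pairing_functionalsI[of ?\<Phi>])
      show "?\<Phi> \<in> potentials N X"
        using Cb_lincomb[OF C C, of "1 / h" 0] by (auto simp: potentials_def Cb_zero simp del: real_scaleR_def)
      fix u :: "('a, 'k) triple" assume u: "u \<in> triples N X"
      obtain \<nu> p g where e: "u = (\<nu>, p, g)" by (metis prod_cases3)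
      have S: "\<nu> k \<in> vector_measures ?S" using u k by (auto simp: triples_def e)
      have "(\<Sum>j\<le>N. signed_integral (state_space X j) (\<nu> j) (fst ?\<Phi> j)) = signed_integral ?S (\<nu> k) \<phi> / h"
        using k signed_integral_lincomb_fun[OF S Cb_bounded_measurable[OF C] Cb_bounded_measurable[OF C], of "1 / h" 0]
        by (subst sum.remove[of _ k]) (auto intro!: sum.neutral)
      then show "pairing N NC X h ?\<Phi> u = l (fst u k)"
        using h unfolding e l pairing_def prod.case by simp
    qed
  qed (use k in \<open>auto simp: triples_def comb_triple_def\<close>)
  have price': "?cc (\<lambda>u :: ('a, 'k) triple. C i (snd (snd u) i))" if i: "i \<in> {1..NC}" for i
  proof (rule closed_convex_compose[where F = "C i"])
    show "closed_convex comb_real UNIV {\<lambda>x. x} (C i)"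
      using price[OF i] unfolding admissible_price_def closed_convex_def
      by (auto intro: lsc_on_real convex_fun_imp_epi)
    fix l :: "real \<Rightarrow> real" assume "l \<in> {\<lambda>x. x}"
    then show "\<exists>m\<in>pairing_functionals N NC X h. \<forall>u\<in>triples N X. m u = l (snd (snd (u :: ('a, 'k) triple)) i)"
      using i by (intro pairing_functionalsI[of "(\<lambda>k x. 0, \<lambda>k x. 0, \<lambda>j. if j = i then 1 else 0)"])
         (auto simp: potentials_def Cb_zero pairing_def if_distrib[of "\<lambda>x. x * _"] cong: if_cong)
  qed (auto simp: triples_def comb_triple_def)
  have "?cc (\<lambda>u. (\<Sum>k<N. Fmom k (fst u k, fst (snd u) k)) + (\<Sum>k\<le>N. M k (fst u k)) + (\<Sum>i=1..NC. C i (snd (snd u) i)))"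
    by (intro closed_convex_add closed_convex_sum mom' marg' price') auto
  moreover have "(\<lambda>u. (\<Sum>k<N. Fmom k (fst u k, fst (snd u) k)) + (\<Sum>k\<le>N. M k (fst u k)) + (\<Sum>i=1..NC. C i (snd (snd u) i)))
      = Ffun N NC Fmom M C"
    by (auto simp: Ffun_def fun_eq_iff)
  ultimately show ?thesis by simp
qed

section \<open>Relative entropy and the exponential functional\<close>

definition rn_density :: "'s measure \<Rightarrow> 's measure \<Rightarrow> 's \<Rightarrow> real" where
  "rn_density R P x = enn2real (RN_deriv R P x)"

lemma rn_density_measurable [measurable]: "rn_density R P \<in> borel_measurable R"
  unfolding rn_density_def by measurable

lemma rn_density_nonneg: "0 \<le> rn_density R P x" by (simp add: rn_density_def)

lemma density_rn_density:
  assumes R: "finite_measure R" and P: "finite_measure P" "sets P = sets R" "absolutely_continuous R P"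
  shows "density R (\<lambda>x. ennreal (rn_density R P x)) = P"
proof -
  interpret R: finite_measure R by fact
  interpret P: finite_measure P by fact
  have "AE x in R. RN_deriv R P x \<noteq> \<infinity>"
    using R.RN_deriv_finite[OF P.sigma_finite_measure_axioms P(3,2)] .
  then have "density R (\<lambda>x. ennreal (rn_density R P x)) = density R (RN_deriv R P)"
    by (intro density_cong) (auto simp: rn_density_def less_top)
  with R.density_RN_deriv[OF P(3,2)] show ?thesis by simp
qed

text \<open>
  This bound makes the negative part of the integrand of the divergence integrable over a
  probability measure.
\<close>

lemma entropy_density_lower_bound: "(r :: real) * (1 - ln r) \<le> 1" if "0 \<le> r"
proof (cases "r = 0")
  case False
  with that have r: "0 < r" by simp
  have "ln (1 / r) \<le> 1 / r - 1" using r by (intro ln_le_minus_one) simp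
  then have "1 - ln r \<le> 1 / r" using r by (simp add: ln_div)
  then show ?thesis using r by (simp add: field_simps)
qed simp

text \<open>
  Since the negative part of the integrand is always integrable, a finite divergence has an
  integrable positive part, and the difference of extended integrals is an ordinary integral.
\<close>

lemma KL_finite:
  assumes R: "prob_space R" and P: "finite_measure P" "sets P = sets R" and fin: "KL P R \<noteq> \<infinity>"
  shows "absolutely_continuous R P"
    and "integrable P (\<lambda>x. ln (rn_density R P x) - 1)"
    and "KL P R = ereal (\<integral>x. ln (rn_density R P x) - 1 \<partial>P)"
proof -
  interpret R: prob_space R by fact
  show ac: "absolutely_continuous R P" using fin by (auto simp: KL_def split: if_splits)
  let ?r = "rn_density R P"
  let ?neg = "\<integral>\<^sup>+x. ennreal (1 - ln (?r x)) \<partial>P" and ?pos = "\<integral>\<^sup>+x. ennreal (ln (?r x) - 1) \<partial>P"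
  have rP [measurable]: "?r \<in> borel_measurable P" using P(2) by (simp cong: measurable_cong_sets)
  have Pd: "density R (\<lambda>x. ennreal (?r x)) = P"
    by (rule density_rn_density[OF R.finite_measure_axioms P ac])
  have "?neg = (\<integral>\<^sup>+x. ennreal (?r x) * ennreal (1 - ln (?r x)) \<partial>R)"
    by (subst Pd[symmetric], subst nn_integral_density) auto
  also have "\<dots> \<le> (\<integral>\<^sup>+x. 1 \<partial>R)"
  proof (rule nn_integral_mono)
    fix x
    show "ennreal (?r x) * ennreal (1 - ln (?r x)) \<le> 1"
      using entropy_density_lower_bound[OF rn_density_nonneg, of R P x]
      by (simp add: rn_density_nonneg flip: ennreal_mult')
  qed
  also have "\<dots> < \<infinity>" by (simp add: R.emeasure_space_1)
  finally have neg: "?neg < \<infinity>" .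
  have KL: "KL P R = enn2ereal ?pos - enn2ereal ?neg"
    using ac by (simp add: KL_def rn_density_def)
  have pos: "?pos < \<infinity>"
  proof (rule ccontr)
    assume "\<not> ?pos < \<infinity>"
    then have "?pos = top" by (metis infinity_ennreal_def less_top)
    then have "enn2ereal ?pos = \<infinity>" by simp
    moreover have "enn2ereal ?neg \<noteq> \<infinity>" using neg by (metis enn2ereal_eq_top_iff infinity_ennreal_def less_irrefl top_ereal_def)
    ultimately show False using KL fin by simp
  qed
  show int: "integrable P (\<lambda>x. ln (?r x) - 1)"
    unfolding real_integrable_def using pos neg by (auto simp: less_top)
  show "KL P R = ereal (\<integral>x. ln (?r x) - 1 \<partial>P)"
    unfolding KL real_lebesgue_integral_def[OF int] using pos neg
    by (cases ?pos rule: ennreal_cases; cases ?neg rule: ennreal_cases) (auto simp: minus_diff_eq)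
qed

text \<open>
  Young's inequality for the conjugate pair \<open>r log r - r\<close> and \<open>exp\<close>.  With \<open>r > 0\<close> the expression is
  \<open>r\<close> times the gap in \<open>1 + x \<le> exp x\<close> at \<open>x = s - ln r\<close>, which vanishes only at \<open>x = 0\<close>.  At
  \<open>r = 0\<close> it is \<open>exp s\<close>.
\<close>

lemma fenchel_young_exp:
  fixes r s :: real assumes "0 \<le> r"
  shows "0 \<le> exp s - r * s + r * (ln r - 1)"
    and "exp s - r * s + r * (ln r - 1) = 0 \<Longrightarrow> r = exp s"
proof -
  show "0 \<le> exp s - r * s + r * (ln r - 1)"
  proof (cases "r = 0")
    case False
    then have r: "0 < r" using assms by simp
    have "0 \<le> r * (exp (s - ln r) - (1 + (s - ln r)))"
      using r exp_ge_add_one_self[of "s - ln r"] by (intro mult_nonneg_nonneg) auto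
    also have "\<dots> = exp s - r * s + r * (ln r - 1)"
      using r by (simp add: exp_diff field_simps)
    finally show ?thesis .
  qed simp
  assume z: "exp s - r * s + r * (ln r - 1) = 0"
  then have r: "0 < r" using assms by (cases "r = 0") auto
  have "r * (exp (s - ln r) - (1 + (s - ln r))) = 0"
    using r z by (simp add: exp_diff field_simps)
  then have "exp (s - ln r) = 1 + (s - ln r)" using r by simp
  then have "ln (exp (s - ln r)) = exp (s - ln r) - 1" unfolding ln_exp by simp
  then have "exp (s - ln r) = 1" by (intro ln_eq_minus_one) simp_all
  then have "s = ln r" by simp
  then show "r = exp s" using r by simp
qed

lemma bounded_measurable_exp:
  assumes "f \<in> bounded_measurable S" shows "(\<lambda>x. exp (f x / h)) \<in> bounded_measurable S"
proof -
  obtain K where K: "\<And>x. x \<in> space S \<Longrightarrow> \<bar>f x\<bar> \<le> K" and [measurable]: "f \<in> borel_measurable S"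
    using assms by (auto simp: bounded_measurable_def)
  show ?thesis
  proof (rule bounded_measurableI)
    fix x assume "x \<in> space S"
    then have "\<bar>f x / h\<bar> \<le> K / \<bar>h\<bar>" using K by (simp add: divide_right_mono)
    then have "f x / h \<le> K / \<bar>h\<bar>" by linarith
    then show "\<bar>exp (f x / h)\<bar> \<le> exp (K / \<bar>h\<bar>)" by simp
  qed simp
qed

text \<open>
  This is not normalized: a primal competitor need not have mass 1.
\<close>

definition gibbs :: "real \<Rightarrow> 's measure \<Rightarrow> ('s \<Rightarrow> real) \<Rightarrow> 's measure" where
  "gibbs h R f = density R (\<lambda>x. ennreal (exp (f x / h)))"

context
  fixes h :: real and R :: "'s measure" and f :: "'s \<Rightarrow> real"
  assumes h: "0 < h" and R: "prob_space R" and f: "f \<in> bounded_measurable R"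
begin

interpretation R: prob_space R by (rule R)

lemma bounded_measurableD [measurable]: "f \<in> borel_measurable R" using f by (simp add: bounded_measurable_def)

lemma finite_measure_gibbs: "finite_measure (gibbs h R f)"
proof -
  have "integrable R (\<lambda>x. exp (f x / h))"
    by (rule integrable_bounded_measurable[OF bounded_measurable_exp[OF f] R.finite_measure_axioms refl])
  then show ?thesis
    unfolding gibbs_def
    by (intro finite_measureI) (auto simp: emeasure_density nn_integral_eq_integral cong: nn_integral_cong)
qed

lemma sets_gibbs [simp]: "sets (gibbs h R f) = sets R" by (simp add: gibbs_def)

lemma KL_gibbs: "KL (gibbs h R f) R = ereal (\<integral>x. f x / h - 1 \<partial>gibbs h R f)"
proof -
  let ?P = "gibbs h R f"
  have ac: "absolutely_continuous R ?P"
    unfolding gibbs_def by (intro absolutely_continuousI_density) simp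
  have "AE x in R. ennreal (exp (f x / h)) = RN_deriv R ?P x"
    by (rule R.RN_deriv_unique) (auto simp: gibbs_def)
  then have "AE x in ?P. ennreal (exp (f x / h)) = RN_deriv R ?P x"
    using ac by (intro absolutely_continuous_AE[OF _ ac]) simp_all
  then have ae: "AE x in ?P. ln (enn2real (RN_deriv R ?P x)) = f x / h"
    by eventually_elim (metis enn2real_ennreal exp_ge_zero ln_exp)
  have b: "(\<lambda>x. f x / h - 1) \<in> bounded_measurable R"
    using bounded_measurable_lincomb[OF f bounded_measurableI[of "\<lambda>_. 1" R 1], of "1 / h" "- 1"] by simp
  have int: "integrable ?P (\<lambda>x. f x / h - 1)"
    by (intro integrable_bounded_measurable[OF b] finite_measure_gibbs sets_gibbs)
  have "(\<integral>\<^sup>+x. ennreal (ln (enn2real (RN_deriv R ?P x)) - 1) \<partial>?P) = (\<integral>\<^sup>+x. ennreal (f x / h - 1) \<partial>?P)"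
    by (rule nn_integral_cong_AE) (use ae in eventually_elim, simp)
  moreover have "(\<integral>\<^sup>+x. ennreal (1 - ln (enn2real (RN_deriv R ?P x))) \<partial>?P) = (\<integral>\<^sup>+x. ennreal (1 - f x / h) \<partial>?P)"
    by (rule nn_integral_cong_AE) (use ae in eventually_elim, simp)
  moreover have "(\<integral>\<^sup>+x. ennreal (f x / h - 1) \<partial>?P) \<noteq> \<infinity>" "(\<integral>\<^sup>+x. ennreal (1 - f x / h) \<partial>?P) \<noteq> \<infinity>"
    using int unfolding real_integrable_def by auto
  ultimately show ?thesis
    unfolding KL_def real_lebesgue_integral_def[OF int] using ac
    by (cases "\<integral>\<^sup>+x. ennreal (f x / h - 1) \<partial>?P" rule: ennreal_cases;
        cases "\<integral>\<^sup>+x. ennreal (1 - f x / h) \<partial>?P" rule: ennreal_cases) auto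
qed

lemma entropy_duality_gibbs:
  "ereal (\<integral>x. f x \<partial>gibbs h R f) - ereal h * KL (gibbs h R f) R = ereal (h * (\<integral>x. exp (f x / h) \<partial>R))"
proof -
  let ?P = "gibbs h R f"
  note fin = finite_measure_gibbs sets_gibbs
  have int: "integrable ?P f" by (rule integrable_bounded_measurable[OF f fin])
  have int1: "integrable ?P (\<lambda>x. 1)" by (rule finite_measure.integrable_const[OF finite_measure_gibbs])
  have "(\<integral>x. f x / h - 1 \<partial>?P) = (\<integral>x. f x / h \<partial>?P) - (\<integral>x. 1 \<partial>?P)"
    using int by (intro Bochner_Integration.integral_diff int1) simp
  then have "h * (\<integral>x. f x / h - 1 \<partial>?P) = (\<integral>x. f x \<partial>?P) - h * (\<integral>x. 1 \<partial>?P)"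
    using h by (simp add: right_diff_distrib)
  moreover have "(\<integral>x. 1 \<partial>?P) = (\<integral>x. exp (f x / h) \<partial>R)"
    unfolding gibbs_def by (subst integral_density) auto
  ultimately show ?thesis unfolding KL_gibbs by simp
qed

text \<open>
  With \<open>r\<close> the density of \<open>P\<close>, the gap in the first inequality is \<open>h\<close> times the \<open>R\<close>-integral of the
  nonnegative expression in \<open>fenchel_young_exp\<close> at \<open>s = f / h\<close>.  Equality forces it to vanish almost
  everywhere, which identifies the density.
\<close>

lemma entropy_duality:
  assumes P: "finite_measure P" "sets P = sets R"
  shows "ereal (\<integral>x. f x \<partial>P) - ereal h * KL P R \<le> ereal (h * (\<integral>x. exp (f x / h) \<partial>R))"
    and "ereal (\<integral>x. f x \<partial>P) - ereal h * KL P R = ereal (h * (\<integral>x. exp (f x / h) \<partial>R)) \<Longrightarrow> P = gibbs h R f"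
proof -
  have *: "(\<integral>x. f x \<partial>P) - h * (\<integral>x. ln (rn_density R P x) - 1 \<partial>P) \<le> h * (\<integral>x. exp (f x / h) \<partial>R) \<and>
     ((\<integral>x. f x \<partial>P) - h * (\<integral>x. ln (rn_density R P x) - 1 \<partial>P) = h * (\<integral>x. exp (f x / h) \<partial>R) \<longrightarrow> P = gibbs h R f)"
    if fin: "KL P R \<noteq> \<infinity>"
  proof -
    note K = KL_finite[OF R P fin]
    let ?r = "rn_density R P"
    have Pd: "density R (\<lambda>x. ennreal (?r x)) = P"
      by (rule density_rn_density[OF R.finite_measure_axioms P K(1)])
    have trans: "integrable R (\<lambda>x. ?r x * g x)" "(\<integral>x. g x \<partial>P) = (\<integral>x. ?r x * g x \<partial>R)"
      if g: "integrable P g" for g :: "'s \<Rightarrow> real"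
    proof -
      have [measurable]: "g \<in> borel_measurable R"
        using borel_measurable_integrable[OF g] P(2) by (simp cong: measurable_cong_sets)
      show "integrable R (\<lambda>x. ?r x * g x)"
        using g by (subst (asm) Pd[symmetric], subst (asm) integrable_density) (auto simp: rn_density_nonneg)
      show "(\<integral>x. g x \<partial>P) = (\<integral>x. ?r x * g x \<partial>R)"
        by (subst Pd[symmetric], subst integral_density) (auto simp: rn_density_nonneg)
    qed
    have fP: "integrable P f" by (rule integrable_bounded_measurable[OF f P])
    have eR: "integrable R (\<lambda>x. exp (f x / h))"
      by (rule integrable_bounded_measurable[OF bounded_measurable_exp[OF f] R.finite_measure_axioms refl])
    define g where "g x = exp (f x / h) - ?r x * (f x / h) + ?r x * (ln (?r x) - 1)" for x
    have g: "0 \<le> g x" "g x = 0 \<Longrightarrow> ?r x = exp (f x / h)" for x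
      unfolding g_def by (rule fenchel_young_exp[OF rn_density_nonneg], rule fenchel_young_exp[OF rn_density_nonneg])
    have frR: "integrable R (\<lambda>x. ?r x * (f x / h))"
      using trans(1)[OF fP] by simp
    have gR: "integrable R g"
      unfolding g_def using eR frR trans(1)[OF K(2)]
      by (intro Bochner_Integration.integrable_add Bochner_Integration.integrable_diff)
    have "(\<integral>x. g x \<partial>R) = (\<integral>x. exp (f x / h) \<partial>R) - (\<integral>x. ?r x * (f x / h) \<partial>R) + (\<integral>x. ?r x * (ln (?r x) - 1) \<partial>R)"
      unfolding g_def using eR frR trans(1)[OF K(2)] by simp
    also have "(\<integral>x. ?r x * (f x / h) \<partial>R) = (\<integral>x. f x \<partial>P) / h"
      using trans(2)[OF fP] by simp
    also have "(\<integral>x. ?r x * (ln (?r x) - 1) \<partial>R) = (\<integral>x. ln (?r x) - 1 \<partial>P)"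
      using trans(2)[OF K(2)] by simp
    finally have "(\<integral>x. g x \<partial>R) = (\<integral>x. exp (f x / h) \<partial>R) - (\<integral>x. f x \<partial>P) / h + (\<integral>x. ln (?r x) - 1 \<partial>P)" .
    from arg_cong[OF this, of "\<lambda>x. h * x"] have eq: "h * (\<integral>x. g x \<partial>R) = h * (\<integral>x. exp (f x / h) \<partial>R) - (\<integral>x. f x \<partial>P) + h * (\<integral>x. ln (?r x) - 1 \<partial>P)"
      using h by (simp add: right_diff_distrib distrib_left)
    have "0 \<le> h * (\<integral>x. g x \<partial>R)" using h g(1) by (intro mult_nonneg_nonneg integral_nonneg) auto
    moreover have "P = gibbs h R f" if "h * (\<integral>x. g x \<partial>R) = 0"
    proof -
      have "(\<integral>x. g x \<partial>R) = 0" using that h by simp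
      then have "AE x in R. g x = 0" using integral_nonneg_eq_0_iff_AE[OF gR] g(1) by simp
      then have "AE x in R. ennreal (?r x) = ennreal (exp (f x / h))"
        by eventually_elim (simp add: g(2))
      then have "density R (\<lambda>x. ennreal (?r x)) = density R (\<lambda>x. ennreal (exp (f x / h)))"
        by (intro density_cong) auto
      then show ?thesis unfolding Pd gibbs_def .
    qed
    moreover have "h * (\<integral>x. g x \<partial>R) = 0"
      if "(\<integral>x. f x \<partial>P) - h * (\<integral>x. ln (?r x) - 1 \<partial>P) = h * (\<integral>x. exp (f x / h) \<partial>R)"
      using eq that by linarith
    ultimately show ?thesis using eq by (intro conjI impI) (linarith, blast)
  qed
  have "ereal (\<integral>x. f x \<partial>P) - ereal h * KL P R \<le> ereal (h * (\<integral>x. exp (f x / h) \<partial>R)) \<and>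
    (ereal (\<integral>x. f x \<partial>P) - ereal h * KL P R = ereal (h * (\<integral>x. exp (f x / h) \<partial>R)) \<longrightarrow> P = gibbs h R f)"
  proof (cases "KL P R = \<infinity>")
    case True
    then have "ereal (\<integral>x. f x \<partial>P) - ereal h * KL P R = -\<infinity>" using h by simp
    then show ?thesis by simp
  next
    case False
    from *[OF False] show ?thesis
      unfolding KL_finite(3)[OF R P False] times_ereal.simps ereal_minus(1) ereal_less_eq(3) ereal.inject .
  qed
  then show "ereal (\<integral>x. f x \<partial>P) - ereal h * KL P R \<le> ereal (h * (\<integral>x. exp (f x / h) \<partial>R))"
    and "ereal (\<integral>x. f x \<partial>P) - ereal h * KL P R = ereal (h * (\<integral>x. exp (f x / h) \<partial>R)) \<Longrightarrow> P = gibbs h R f"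
    by blast+
qed

text \<open>
  A one-sided second-order expansion of the exponential functional.  The linear term shows that the
  Gibbs measure is its derivative; an upper bound suffices because the dual objective is being
  maximized.
\<close>

lemma exponential_functional_increment:
  assumes g: "g \<in> bounded_measurable R" "\<And>x. x \<in> space R \<Longrightarrow> \<bar>g x\<bar> \<le> K" and t: "0 \<le> t" "t * K \<le> h / 2"
  shows "h * (\<integral>x. exp ((f x + t * g x) / h) \<partial>R)
    \<le> h * (\<integral>x. exp (f x / h) \<partial>R) + t * (\<integral>x. g x \<partial>gibbs h R f) + t\<^sup>2 * (2 / h * (\<integral>x. g x * g x \<partial>gibbs h R f))"
proof -
  let ?P = "gibbs h R f"
  \<comment> \<open>From \<open>exp s \<le> 1 / (1 - s)\<close>, which is \<open>1 - s \<le> exp (- s)\<close>.\<close>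
  have quad: "exp s \<le> 1 + s + 2 * s\<^sup>2" if "\<bar>s\<bar> \<le> 1/2" for s :: real
  proof -
    have s: "0 < 1 - s" using that by linarith
    have "exp s * (1 - s) \<le> exp s * exp (- s)"
      using exp_ge_add_one_self[of "- s"] by (intro mult_left_mono) auto
    then have 1: "exp s * (1 - s) \<le> 1" by (simp flip: exp_add)
    have "(1 + s + 2 * s\<^sup>2) * (1 - s) = 1 + s\<^sup>2 * (1 - 2 * s)"
      by (simp add: power2_eq_square algebra_simps)
    moreover have "0 \<le> s\<^sup>2 * (1 - 2 * s)" using that by (intro mult_nonneg_nonneg) auto
    ultimately have "exp s * (1 - s) \<le> (1 + s + 2 * s\<^sup>2) * (1 - s)" using 1 by simp
    then show ?thesis using s by simp
  qed
  have [measurable]: "g \<in> borel_measurable R" using g(1) by (simp add: bounded_measurable_def)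
  note fin = finite_measure_gibbs sets_gibbs
  have int: "integrable ?P g" "integrable ?P (\<lambda>x. g x * g x)" "integrable ?P (\<lambda>x. 1)"
    using integrable_bounded_measurable[OF g(1) fin] integrable_bounded_measurable[OF bounded_measurable_mult[OF g(1) g(1)] fin]
      finite_measure.integrable_const[OF fin(1)] by auto
  have to_R: "(\<integral>x. v x \<partial>?P) = (\<integral>x. exp (f x / h) * v x \<partial>R)" "integrable ?P v \<Longrightarrow> integrable R (\<lambda>x. exp (f x / h) * v x)"
    if [measurable]: "v \<in> borel_measurable R" for v :: "'s \<Rightarrow> real"
    unfolding gibbs_def by (simp_all add: integral_density integrable_density)
  let ?q = "\<lambda>x. 1 + t / h * g x + 2 * (t / h)\<^sup>2 * (g x * g x)"
  have intq: "integrable ?P ?q" using int by (intro Bochner_Integration.integrable_add integrable_mult_right)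
  have "(\<integral>x. exp ((f x + t * g x) / h) \<partial>R) \<le> (\<integral>x. exp (f x / h) * ?q x \<partial>R)"
  proof (rule integral_mono)
    have "(\<lambda>x. f x + t * g x) \<in> bounded_measurable R" using bounded_measurable_lincomb[OF f g(1), of 1 t] by simp
    then show "integrable R (\<lambda>x. exp ((f x + t * g x) / h))"
      by (intro integrable_bounded_measurable[OF bounded_measurable_exp _ refl] R.finite_measure_axioms)
    show "integrable R (\<lambda>x. exp (f x / h) * ?q x)" using intq by (intro to_R) simp_all
    fix x assume x: "x \<in> space R"
    have "\<bar>t / h * g x\<bar> = t * \<bar>g x\<bar> / h" using t(1) h by (simp add: abs_mult)
    also have "\<dots> \<le> t * K / h" using t(1) h g(2)[OF x] by (intro divide_right_mono mult_left_mono) auto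
    also have "\<dots> \<le> 1/2" using t(2) h by (simp add: field_simps)
    finally have "exp (t / h * g x) \<le> ?q x" using quad[of "t / h * g x"] by (simp add: power2_eq_square algebra_simps)
    moreover have "exp ((f x + t * g x) / h) = exp (f x / h) * exp (t / h * g x)"
      by (simp add: add_divide_distrib exp_add)
    ultimately show "exp ((f x + t * g x) / h) \<le> exp (f x / h) * ?q x" by simp
  qed
  also have "\<dots> = (\<integral>x. ?q x \<partial>?P)" by (rule to_R(1)[symmetric]) simp
  also have "\<dots> = (\<integral>x. 1 \<partial>?P) + t / h * (\<integral>x. g x \<partial>?P) + 2 * (t / h)\<^sup>2 * (\<integral>x. g x * g x \<partial>?P)"
  proof -
    have "(\<integral>x. ?q x \<partial>?P) = (\<integral>x. 1 + t / h * g x \<partial>?P) + (\<integral>x. 2 * (t / h)\<^sup>2 * (g x * g x) \<partial>?P)"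
      by (intro Bochner_Integration.integral_add Bochner_Integration.integrable_add integrable_mult_right int)
    also have "(\<integral>x. 1 + t / h * g x \<partial>?P) = (\<integral>x. 1 \<partial>?P) + (\<integral>x. t / h * g x \<partial>?P)"
      by (intro Bochner_Integration.integral_add integrable_mult_right int)
    finally show ?thesis by (simp only: integral_mult_right_zero)
  qed
  also have "(\<integral>x. 1 \<partial>?P) = (\<integral>x. exp (f x / h) \<partial>R)" by (subst to_R(1)) simp_all
  finally have "h * (\<integral>x. exp ((f x + t * g x) / h) \<partial>R)
    \<le> h * ((\<integral>x. exp (f x / h) \<partial>R) + t / h * (\<integral>x. g x \<partial>?P) + 2 * (t / h)\<^sup>2 * (\<integral>x. g x * g x \<partial>?P))"
    using h by (intro mult_left_mono) auto
  moreover have "h * (x + t / h * y + 2 * (t / h)\<^sup>2 * z) = h * x + t * y + t\<^sup>2 * (2 / h * z)" for x y z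
    using h by (simp add: power2_eq_square field_simps)
  ultimately show ?thesis by simp
qed

end

section \<open>Discrete paths and the adjoint identity\<close>

lemma space_path_space: "space (path_space N X) = paths N X"
  by (simp add: space_PiM space_restrict_space)

lemma path_component_measurable: "k \<le> N \<Longrightarrow> (\<lambda>x. x k) \<in> path_space N X \<rightarrow>\<^sub>M state_space X k"
  by (rule measurable_component_singleton) simp

text \<open>
  Paths are functions on all of \<open>nat\<close> that are constant beyond \<open>N\<close>, and on a countable product of
  second-countable spaces the Borel sets of the product topology are the product \<open>\<sigma>\<close>-algebra.
\<close>

lemma continuous_paths_measurable:
  fixes f :: "(nat \<Rightarrow> 'a::euclidean_space) \<Rightarrow> 'b::topological_space"
  assumes "continuous_on (paths N X) f"
  shows "f \<in> path_space N X \<rightarrow>\<^sub>M borel"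
proof -
  have "(\<lambda>x. x) \<in> path_space N X \<rightarrow>\<^sub>M (\<Pi>\<^sub>M k\<in>UNIV. borel :: 'a measure)"
  proof (rule measurable_PiM_single')
    fix k
    show "(\<lambda>x. x k) \<in> path_space N X \<rightarrow>\<^sub>M (borel :: 'a measure)"
    proof (cases "k \<le> N")
      case True
      from path_component_measurable[OF this, of X] show ?thesis
        by (simp add: measurable_restrict_space2_iff)
    next
      case False
      then have "x k = undefined" if "x \<in> space (path_space N X)" for x
        using that unfolding space_path_space by (auto simp: PiE_def extensional_def)
      then show ?thesis by (subst measurable_cong[where g = "\<lambda>_. undefined"]) auto
    qed
  qed auto
  then have "(\<lambda>x. x) \<in> path_space N X \<rightarrow>\<^sub>M (borel :: (nat \<Rightarrow> 'a) measure)"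
    by (simp add: sets_PiM_equal_borel cong: measurable_cong_sets)
  then have "(\<lambda>x. x) \<in> path_space N X \<rightarrow>\<^sub>M restrict_space borel (paths N X)"
    by (intro measurable_restrict_space2) (simp_all add: space_path_space)
  from measurable_compose[OF this borel_measurable_continuous_on_restrict[OF assms]] show ?thesis .
qed

lemma Cb_paths_bounded_measurable:
  assumes "f \<in> Cb (paths N X)" shows "f \<in> bounded_measurable (path_space N X)"
  using assms continuous_paths_measurable[of N X f]
  unfolding Cb_def bounded_measurable_def space_path_space by (auto simp: bounded_iff)

lemma Delta_lincomb:
  "Delta N NC h B G \<tau> (lincomb_potential a \<Phi> b \<Psi>) x = a * Delta N NC h B G \<tau> \<Phi> x + b * Delta N NC h B G \<tau> \<Psi> x"
proof -
  obtain \<phi> \<psi> l \<phi>' \<psi>' l' where e: "\<Phi> = (\<phi>, \<psi>, l)" "\<Psi> = (\<phi>', \<psi>', l')" by (metis prod_cases3)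
  show ?thesis
    unfolding e lincomb_potential_def Delta_def prod.case
    by (simp add: inner_add_right sum.distrib sum_distrib_left algebra_simps)
qed

lemma uminus_potential: "- \<Phi> = lincomb_potential (- 1) \<Phi> 0 \<Phi>"
  by (cases \<Phi>) (auto simp: lincomb_potential_def fun_Compl_def)

lemma uminus_uminus_potential: "- (- \<Phi>) = (\<Phi> :: ('a, 'k::finite) potential)"
  by (cases \<Phi>) (auto simp: fun_Compl_def)

context
  fixes N NC :: nat and h :: real and X :: "nat \<Rightarrow> 'a::euclidean_space set"
    and B :: "'a \<Rightarrow> 'a \<Rightarrow> real ^ 'k::finite" and G :: "nat \<Rightarrow> 'a \<Rightarrow> real" and \<tau> :: "nat \<Rightarrow> nat"
    and P :: "(nat \<Rightarrow> 'a) measure"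
  assumes h: "0 < h" and ne: "paths N X \<noteq> {}"
    and cont: "\<And>\<Psi> :: ('a, 'k) potential. \<Psi> \<in> potentials N X \<Longrightarrow> Delta N NC h B G \<tau> \<Psi> \<in> Cb (paths N X)"
    and P: "P \<in> path_measures N X"
begin

lemma sets_path_measure [measurable_cong]: "sets P = sets (path_space N X)" and finite_path_measure: "finite_measure P"
  using P by (simp_all add: path_measures_def)

text \<open>
  Regularity of \<open>B\<close> enters only through \<open>\<Delta>\<close>, evaluated at the potential that is a constant vector at
  time step \<open>k\<close> and zero elsewhere.
\<close>

lemma B_component_bounded_measurable:
  assumes k: "k < N" shows "(\<lambda>x. B (x k) (x (Suc k)) \<bullet> b) \<in> bounded_measurable (path_space N X)"
proof -
  let ?\<Psi> = "(\<lambda>j x. 0, \<lambda>j x. if j = k then b else 0, \<lambda>i. 0) :: ('a, 'k) potential"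
  have "?\<Psi> \<in> potentials N X" by (auto simp: potentials_def Cb_def image_constant_conv)
  from Cb_paths_bounded_measurable[OF cont[OF this]]
  have "Delta N NC h B G \<tau> ?\<Psi> \<in> bounded_measurable (path_space N X)" .
  moreover have "Delta N NC h B G \<tau> ?\<Psi> = (\<lambda>x. B (x k) (x (Suc k)) \<bullet> b)"
    using k by (auto simp: Delta_def fun_eq_iff if_distrib cong: if_cong)
  ultimately show ?thesis by simp
qed

text \<open>
  The same device, with the potential that singles out one price.
\<close>

lemma G_bounded_measurable:
  assumes i: "i \<in> {1..NC}" shows "(\<lambda>x. G i (x (\<tau> i))) \<in> bounded_measurable (path_space N X)"
proof -
  let ?\<Psi> = "(\<lambda>j x. 0, \<lambda>j x. 0, \<lambda>j. if j = i then 1 else 0) :: ('a, 'k) potential"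
  have "?\<Psi> \<in> potentials N X" by (auto simp: potentials_def Cb_zero)
  from Cb_paths_bounded_measurable[OF cont[OF this]]
  have "Delta N NC h B G \<tau> ?\<Psi> \<in> bounded_measurable (path_space N X)" .
  moreover have "Delta N NC h B G \<tau> ?\<Psi> = (\<lambda>x. G i (x (\<tau> i)))"
    using i by (auto simp: Delta_def fun_eq_iff if_distrib[of "\<lambda>x. x * _"] cong: if_cong)
  ultimately show ?thesis by simp
qed

lemma integrable_path_measure: "f \<in> bounded_measurable (path_space N X) \<Longrightarrow> integrable P f"
  by (rule integrable_bounded_measurable[OF _ finite_path_measure sets_path_measure])

lemma B_integrable:
  assumes k: "k < N" shows "integrable P (\<lambda>x. B (x k) (x (Suc k)))"
proof -
  have "integrable P (\<lambda>x. \<Sum>b\<in>Basis. (B (x k) (x (Suc k)) \<bullet> b) *\<^sub>R b)"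
    by (intro Bochner_Integration.integrable_sum integrable_scaleR_left integrable_path_measure B_component_bounded_measurable k)
  then show ?thesis by (simp add: euclidean_representation)
qed

text \<open>
  Only measurability along paths is known so far.  Completing a pair of consecutive states by a fixed
  path embeds the product of two state spaces into the path space.
\<close>

lemma B_measurable:
  assumes k: "k < N"
  shows "(\<lambda>z. B (fst z) (snd z)) \<in> state_space X k \<Otimes>\<^sub>M state_space X (Suc k) \<rightarrow>\<^sub>M borel"
proof -
  obtain x0 where x0: "x0 \<in> paths N X" using ne by auto
  let ?S = "state_space X k \<Otimes>\<^sub>M state_space X (Suc k)"
  let ?e = "\<lambda>z. \<lambda>j\<in>{..N}. if j = k then fst z else if j = Suc k then snd z else x0 j"
  have e: "?e \<in> ?S \<rightarrow>\<^sub>M path_space N X"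
  proof (rule measurable_restrict)
    fix j assume "j \<in> {..N}"
    then have "x0 j \<in> space (state_space X j)" using x0 by (auto simp: space_restrict_space)
    then show "(\<lambda>z. if j = k then fst z else if j = Suc k then snd z else x0 j) \<in> ?S \<rightarrow>\<^sub>M state_space X j"
      by (cases "j = k"; cases "j = Suc k") auto
  qed
  have "(\<lambda>z. B (?e z k) (?e z (Suc k)) \<bullet> b) \<in> borel_measurable ?S" for b
    using measurable_compose[OF e] B_component_bounded_measurable[OF k, of b] unfolding bounded_measurable_def by blast
  then have "(\<lambda>z. B (fst z) (snd z) \<bullet> b) \<in> borel_measurable ?S" for b using k by simp
  then show ?thesis by (subst borel_measurable_euclidean_space) auto
qed

text \<open>
  Rewrites the momentum from the joint law of two states to the law of the path, which is the form
  required by the integration formula for pushforward densities.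
\<close>

lemma Delta_adj_momentum:
  assumes k: "k < N"
  shows "fst (snd (Delta_adj X h B G \<tau> P)) k
    = (\<lambda>A. if A \<in> sets (state_space X k) then \<integral>x. indicator A (x k) *\<^sub>R ((1 / h) *\<^sub>R B (x k) (x (Suc k))) \<partial>P else 0)"
proof
  fix A
  have m: "(\<lambda>x. (x k, x (Suc k))) \<in> P \<rightarrow>\<^sub>M state_space X k \<Otimes>\<^sub>M state_space X (Suc k)"
    using k path_component_measurable[of k N X] path_component_measurable[of "Suc k" N X]
    by (intro measurable_Pair) (simp_all cong: measurable_cong_sets add: sets_path_measure)
  have "(\<integral>z. indicator A (fst z) *\<^sub>R B (fst z) (snd z) \<partial>joint_marginal X P k)
      = (\<integral>x. indicator A (x k) *\<^sub>R B (x k) (x (Suc k)) \<partial>P)" if A: "A \<in> sets (state_space X k)"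
  proof -
    have "(\<lambda>z. indicat_real A (fst z) *\<^sub>R B (fst z) (snd z)) \<in> borel_measurable (state_space X k \<Otimes>\<^sub>M state_space X (Suc k))"
      by (intro borel_measurable_scaleR measurable_compose[OF measurable_fst borel_measurable_indicator[OF A]] B_measurable k)
    from integral_distr[OF m this] show ?thesis by (simp add: joint_marginal_def)
  qed
  moreover have "(1 / h) *\<^sub>R (\<integral>x. indicator A (x k) *\<^sub>R B (x k) (x (Suc k)) \<partial>P)
      = (\<integral>x. indicator A (x k) *\<^sub>R ((1 / h) *\<^sub>R B (x k) (x (Suc k))) \<partial>P)"
    by (subst integral_scaleR_right[symmetric]) (simp add: mult.commute)
  ultimately show "fst (snd (Delta_adj X h B G \<tau> P)) k A
    = (if A \<in> sets (state_space X k) then \<integral>x. indicator A (x k) *\<^sub>R ((1 / h) *\<^sub>R B (x k) (x (Suc k))) \<partial>P else 0)"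
    by (simp add: Delta_adj_def)
qed

lemma component_measurable: "k \<le> N \<Longrightarrow> (\<lambda>x. x k) \<in> P \<rightarrow>\<^sub>M state_space X k"
  using path_component_measurable[of k N X] by (simp cong: measurable_cong_sets add: sets_path_measure)

lemma momentum_vector_measure:
  assumes k: "k < N" shows "fst (snd (Delta_adj X h B G \<tau> P)) k \<in> vector_measures (state_space X k)"
  unfolding Delta_adj_momentum[OF k] using k
  by (intro pushforward_density_vector_measure component_measurable integrable_scaleR_right B_integrable) auto

lemma marginal_vector_measure:
  assumes k: "k \<le> N" and f: "f \<in> bounded_measurable (state_space X k)"
  shows "fst (Delta_adj X h B G \<tau> P) k \<in> vector_measures (state_space X k)"
    and "signed_integral (state_space X k) (fst (Delta_adj X h B G \<tau> P) k) f = (\<integral>x. f (x k) \<partial>P)"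
proof -
  have m: "finite_measure (marginal X P k)" "sets (marginal X P k) = sets (state_space X k)"
    using finite_measure.finite_measure_distr[OF finite_path_measure component_measurable[OF k]]
    by (simp_all add: marginal_def)
  show "fst (Delta_adj X h B G \<tau> P) k \<in> vector_measures (state_space X k)"
    using signed_integral_finite_measure(1)[OF m f] by (simp add: Delta_adj_def)
  have "(\<integral>x. f x \<partial>marginal X P k) = (\<integral>x. f (x k) \<partial>P)"
    unfolding marginal_def using f by (intro integral_distr component_measurable k) (simp add: bounded_measurable_def)
  then show "signed_integral (state_space X k) (fst (Delta_adj X h B G \<tau> P) k) f = (\<integral>x. f (x k) \<partial>P)"
    using signed_integral_finite_measure(2)[OF m f] by (simp add: Delta_adj_def)
qed

lemma Delta_adj_triples: "Delta_adj X h B G \<tau> P \<in> triples N X"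
proof -
  have "(\<lambda>x. 0) \<in> bounded_measurable (state_space X k)" for k by (intro bounded_measurableI[where K = 0]) auto
  with marginal_vector_measure(1) momentum_vector_measure show ?thesis
    unfolding triples_def mem_Collect_eq case_prod_unfold by blast
qed

lemma momentum_integral:
  assumes k: "k < N" and \<psi>: "\<psi> \<in> Cb (X k)"
  shows "vector_integral (state_space X k) (fst (snd (Delta_adj X h B G \<tau> P)) k) \<psi>
    = (\<integral>x. B (x k) (x (Suc k)) \<bullet> \<psi> (x k) \<partial>P) / h"
proof -
  let ?b = "\<lambda>j x. (1 / h) * (B (x k) (x (Suc k)) $ j)"
  have b: "?b j \<in> bounded_measurable (path_space N X)" for j
    using bounded_measurable_lincomb[OF B_component_bounded_measurable[OF k, of "axis j 1"]
        B_component_bounded_measurable[OF k, of "axis j 1"], of "1 / h" 0]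
    by (simp add: inner_axis)
  have \<psi>': "(\<lambda>x. \<psi> x $ j) \<in> bounded_measurable (state_space X k)" for j
    by (intro Cb_bounded_measurable Cb_nth \<psi>)
  have comp: "(\<lambda>A. fst (snd (Delta_adj X h B G \<tau> P)) k A $ j) =
     (\<lambda>A. if A \<in> sets (state_space X k) then \<integral>x. indicator A (x k) * ?b j x \<partial>P else 0)" for j
  proof
    fix A
    have "(\<integral>x. indicator A (x k) *\<^sub>R ((1 / h) *\<^sub>R B (x k) (x (Suc k))) \<partial>P) $ j = (\<integral>x. indicator A (x k) * ?b j x \<partial>P)"
      if A: "A \<in> sets (state_space X k)"
    proof -
      have "(\<lambda>x. x k) -` A \<inter> space P \<in> sets P" using component_measurable[of k] k A by (intro measurable_sets) auto
      then have "integrable P (\<lambda>x. indicator ((\<lambda>x. x k) -` A \<inter> space P) x *\<^sub>R ((1 / h) *\<^sub>R B (x k) (x (Suc k))))"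
        by (intro integrable_mult_indicator integrable_scaleR_right B_integrable k)
      then have "integrable P (\<lambda>x. indicator A (x k) *\<^sub>R ((1 / h) *\<^sub>R B (x k) (x (Suc k))))"
        by (rule Bochner_Integration.integrable_cong[THEN iffD1, rotated 2]) (auto split: split_indicator)
      from integral_bounded_linear[OF bounded_linear_vec_nth[of j] this]
      show ?thesis by simp
    qed
    then show "fst (snd (Delta_adj X h B G \<tau> P)) k A $ j =
      (if A \<in> sets (state_space X k) then \<integral>x. indicator A (x k) * ?b j x \<partial>P else 0)"
      unfolding Delta_adj_momentum[OF k] by simp
  qed
  have int: "integrable P (\<lambda>x. \<psi> (x k) $ j * ?b j x)" for j
    using k by (intro integrable_path_measure bounded_measurable_mult b bounded_measurable_compose[OF \<psi>'] path_component_measurable) auto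
  have "vector_integral (state_space X k) (fst (snd (Delta_adj X h B G \<tau> P)) k) \<psi>
      = (\<Sum>j\<in>UNIV. \<integral>x. \<psi> (x k) $ j * ?b j x \<partial>P)"
    unfolding vector_integral_def comp using k
    by (intro sum.cong refl signed_integral_pushforward_density component_measurable integrable_path_measure b \<psi>') auto
  also have "\<dots> = (\<integral>x. (\<Sum>j\<in>UNIV. \<psi> (x k) $ j * ?b j x) \<partial>P)"
    by (rule Bochner_Integration.integral_sum[symmetric]) (rule int)
  also have "\<dots> = (\<integral>x. (B (x k) (x (Suc k)) \<bullet> \<psi> (x k)) / h \<partial>P)"
    by (rule Bochner_Integration.integral_cong[OF refl])
       (simp add: inner_vec_def sum_divide_distrib mult.commute)
  finally show ?thesis by simp
qed

text \<open>
  Summing the integration formulas for the marginals, momenta and prices.  In the momentum term the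
  factor \<open>h\<close> of the pairing cancels the \<open>1 / h\<close> in the definition of the momentum.
\<close>

theorem Delta_adjoint:
  assumes \<Psi>: "\<Psi> \<in> potentials N X"
  shows "pairing N NC X h \<Psi> (Delta_adj X h B G \<tau> P) = (\<integral>x. Delta N NC h B G \<tau> \<Psi> x \<partial>P)"
proof -
  obtain \<phi> \<psi> l where e: "\<Psi> = (\<phi>, \<psi>, l)" by (metis prod_cases3)
  have \<phi>: "\<phi> k \<in> bounded_measurable (state_space X k)" if "k \<le> N" for k
    using \<Psi> that by (intro Cb_bounded_measurable) (auto simp: e potentials_def)
  have \<psi>: "\<psi> k \<in> Cb (X k)" if "k < N" for k using \<Psi> that by (auto simp: e potentials_def)
  have int\<phi>: "integrable P (\<lambda>x. h * \<phi> k (x k))" if "k \<le> N" for k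
    using that by (intro integrable_mult_right integrable_path_measure bounded_measurable_compose[OF \<phi>] path_component_measurable) auto
  have intG: "integrable P (\<lambda>x. l i * G i (x (\<tau> i)))" if "i \<in> {1..NC}" for i
    using that by (intro integrable_mult_right integrable_path_measure G_bounded_measurable)
  have int\<psi>: "integrable P (\<lambda>x. B (x k) (x (Suc k)) \<bullet> \<psi> k (x k))" if k: "k < N" for k
  proof -
    have \<psi>k: "(\<lambda>x. \<psi> k (x k) $ j) \<in> bounded_measurable (path_space N X)" for j
      using k by (intro bounded_measurable_compose[OF Cb_bounded_measurable[OF Cb_nth[OF \<psi>[OF k]]]] path_component_measurable) auto
    have "integrable P (\<lambda>x. \<Sum>j\<in>UNIV. (B (x k) (x (Suc k)) \<bullet> axis j 1) * \<psi> k (x k) $ j)"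
      by (intro Bochner_Integration.integrable_sum integrable_path_measure bounded_measurable_mult \<psi>k B_component_bounded_measurable k)
    moreover have "(\<lambda>x. B (x k) (x (Suc k)) \<bullet> \<psi> k (x k)) = (\<lambda>x. \<Sum>j\<in>UNIV. B (x k) (x (Suc k)) $ j * \<psi> k (x k) $ j)"
      by (simp add: inner_vec_def)
    ultimately show ?thesis by (simp add: inner_axis)
  qed
  have "(\<integral>x. Delta N NC h B G \<tau> \<Psi> x \<partial>P) = (\<Sum>k\<le>N. h * (\<integral>x. \<phi> k (x k) \<partial>P))
      + (\<Sum>k<N. \<integral>x. B (x k) (x (Suc k)) \<bullet> \<psi> k (x k) \<partial>P) + (\<Sum>i=1..NC. l i * (\<integral>x. G i (x (\<tau> i)) \<partial>P))"
  proof -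
    have "(\<integral>x. Delta N NC h B G \<tau> \<Psi> x \<partial>P) = (\<integral>x. (\<Sum>k\<le>N. h * \<phi> k (x k)) \<partial>P)
        + (\<integral>x. (\<Sum>k<N. B (x k) (x (Suc k)) \<bullet> \<psi> k (x k)) \<partial>P) + (\<integral>x. (\<Sum>i=1..NC. l i * G i (x (\<tau> i))) \<partial>P)"
    proof -
      have 1: "integrable P (\<lambda>x. \<Sum>k\<le>N. h * \<phi> k (x k))"
        by (rule Bochner_Integration.integrable_sum) (rule int\<phi>, simp)
      have 2: "integrable P (\<lambda>x. \<Sum>k<N. B (x k) (x (Suc k)) \<bullet> \<psi> k (x k))"
        by (rule Bochner_Integration.integrable_sum) (rule int\<psi>, simp)
      have 3: "integrable P (\<lambda>x. \<Sum>i=1..NC. l i * G i (x (\<tau> i)))"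
        by (rule Bochner_Integration.integrable_sum) (rule intG)
      show ?thesis
        unfolding e Delta_def prod.case
        by (simp only: Bochner_Integration.integral_add[OF Bochner_Integration.integrable_add[OF 1 2] 3]
            Bochner_Integration.integral_add[OF 1 2])
    qed
    also have "(\<integral>x. (\<Sum>k\<le>N. h * \<phi> k (x k)) \<partial>P) = (\<Sum>k\<le>N. h * (\<integral>x. \<phi> k (x k) \<partial>P))"
      by (subst Bochner_Integration.integral_sum) (rule int\<phi>, simp, simp)
    also have "(\<integral>x. (\<Sum>k<N. B (x k) (x (Suc k)) \<bullet> \<psi> k (x k)) \<partial>P) = (\<Sum>k<N. \<integral>x. B (x k) (x (Suc k)) \<bullet> \<psi> k (x k) \<partial>P)"
      by (subst Bochner_Integration.integral_sum) (rule int\<psi>, simp, simp)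
    also have "(\<integral>x. (\<Sum>i=1..NC. l i * G i (x (\<tau> i))) \<partial>P) = (\<Sum>i=1..NC. l i * (\<integral>x. G i (x (\<tau> i)) \<partial>P))"
      by (subst Bochner_Integration.integral_sum) (rule intG, assumption, simp)
    finally show ?thesis .
  qed
  moreover have "pairing N NC X h \<Psi> (Delta_adj X h B G \<tau> P) =
      h * (\<Sum>k\<le>N. \<integral>x. \<phi> k (x k) \<partial>P) + h * (\<Sum>k<N. (\<integral>x. B (x k) (x (Suc k)) \<bullet> \<psi> k (x k) \<partial>P) / h)
      + (\<Sum>i=1..NC. l i * (\<integral>x. G i (x (\<tau> i)) \<partial>P))"
  proof -
    have "pairing N NC X h \<Psi> u = h * (\<Sum>k\<le>N. signed_integral (state_space X k) (fst u k) (\<phi> k))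
        + h * (\<Sum>k<N. vector_integral (state_space X k) (fst (snd u) k) (\<psi> k)) + (\<Sum>i=1..NC. l i * snd (snd u) i)" for u
      unfolding e pairing_def by (simp add: case_prod_unfold)
    moreover have "(\<Sum>k\<le>N. signed_integral (state_space X k) (fst (Delta_adj X h B G \<tau> P) k) (\<phi> k)) = (\<Sum>k\<le>N. \<integral>x. \<phi> k (x k) \<partial>P)"
      by (intro sum.cong refl marginal_vector_measure(2) \<phi>) auto
    moreover have "(\<Sum>k<N. vector_integral (state_space X k) (fst (snd (Delta_adj X h B G \<tau> P)) k) (\<psi> k))
        = (\<Sum>k<N. (\<integral>x. B (x k) (x (Suc k)) \<bullet> \<psi> k (x k) \<partial>P) / h)"
      by (intro sum.cong refl momentum_integral \<psi>) auto
    moreover have "snd (snd (Delta_adj X h B G \<tau> P)) = (\<lambda>i. \<integral>x. G i (x (\<tau> i)) \<partial>P)" by (simp add: Delta_adj_def)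
    ultimately show ?thesis by simp
  qed
  ultimately show ?thesis using h by (simp add: sum_distrib_left)
qed

end

section \<open>Optimality of the Gibbs measure\<close>

lemma legendre_upper: "u \<in> V \<Longrightarrow> ereal (pair y u) - F u \<le> legendre pair V F y"
  unfolding legendre_def by (rule SUP_upper)

lemma fenchel_young_legendre:
  assumes "u \<in> V" "legendre pair V F y = ereal A"
  shows "ereal (pair y u - A) \<le> F u"
  using legendre_upper[OF assms(1), of pair y F] assms(2) by (cases "F u") auto

lemma legendre_convex:
  assumes lin: "\<And>u. u \<in> V \<Longrightarrow> pair z u = (1 - t) * pair y u + t * pair y' u" and t: "0 \<le> t" "t \<le> 1"
    and y: "legendre pair V F y = ereal A" "legendre pair V F y' = ereal c"
  shows "legendre pair V F z \<le> ereal ((1 - t) * A + t * c)"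
  unfolding legendre_def
proof (rule SUP_least)
  fix u assume u: "u \<in> V"
  show "ereal (pair z u) - F u \<le> ereal ((1 - t) * A + t * c)"
  proof (cases "F u")
    case (real r)
    have "pair y u - A \<le> r" "pair y' u - c \<le> r"
      using fenchel_young_legendre[OF u y(1)] fenchel_young_legendre[OF u y(2)] by (simp_all add: real)
    then have "(1 - t) * (pair y u - A) + t * (pair y' u - c) \<le> (1 - t) * r + t * r"
      using t by (intro add_mono mult_left_mono) auto
    then show ?thesis by (simp add: real lin[OF u] algebra_simps)
  next
    case MInf
    with fenchel_young_legendre[OF u y(1)] show ?thesis by simp
  qed simp
qed

lemma legendre_gt_MInf:
  assumes "v \<in> V" "F v \<noteq> \<infinity>" shows "legendre pair V F y \<noteq> -\<infinity>"
proof
  assume "legendre pair V F y = -\<infinity>"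
  with legendre_upper[OF assms(1), of pair y F] assms(2) show False by (cases "F v") auto
qed

lemma legendre_minorant:
  assumes "\<And>u. u \<in> V \<Longrightarrow> ereal (pair y u - c) \<le> F u"
  shows "legendre pair V F y \<le> ereal c"
  unfolding legendre_def
proof (rule SUP_least)
  fix u assume "u \<in> V"
  from assms[OF this] show "ereal (pair y u) - F u \<le> ereal c" by (cases "F u") auto
qed

text \<open>
  The supremum is attained at the Gibbs measure.
\<close>

lemma Gfun_star_eq:
  assumes h: "0 < h" and R: "prob_space R" "sets R = sets (path_space N X)" and f: "f \<in> bounded_measurable R"
  shows "Gfun_star N X h R f = ereal (h * (\<integral>x. exp (f x / h) \<partial>R))"
  unfolding Gfun_star_def
proof (rule antisym)
  show "legendre (\<lambda>f P. \<integral>x. f x \<partial>P) (path_measures N X) (Gfun h R) f \<le> ereal (h * (\<integral>x. exp (f x / h) \<partial>R))"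
    unfolding legendre_def Gfun_def
    by (intro SUP_least entropy_duality(1)[OF h R(1) f]) (auto simp: path_measures_def R(2))
  have "gibbs h R f \<in> path_measures N X"
    using finite_measure_gibbs[OF h R(1) f] R(2) by (simp add: path_measures_def sets_gibbs[OF h R(1) f])
  from legendre_upper[OF this, of "\<lambda>f P. \<integral>x. f x \<partial>P" f "Gfun h R"]
  show "ereal (h * (\<integral>x. exp (f x / h) \<partial>R)) \<le> legendre (\<lambda>f P. \<integral>x. f x \<partial>P) (path_measures N X) (Gfun h R) f"
    unfolding Gfun_def entropy_duality_gibbs[OF h R(1) f] .
qed

lemma euler_maruyama_path_law:
  assumes "euler_maruyama_chain W N X h \<mu> \<sigma> \<rho> Z Y"
  shows "prob_space (path_law W N X Y)" "sets (path_law W N X Y) = sets (path_space N X)"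
proof -
  have W: "prob_space W" and Y: "\<And>k. k \<le> N \<Longrightarrow> Y k \<in> W \<rightarrow>\<^sub>M state_space X k"
    using assms by (auto simp: euler_maruyama_chain_def)
  have "(\<lambda>\<omega>. \<lambda>k\<in>{..N}. Y k \<omega>) \<in> W \<rightarrow>\<^sub>M path_space N X"
    by (rule measurable_restrict) (simp add: Y)
  with W show "prob_space (path_law W N X Y)"
    unfolding path_law_def by (rule prob_space.prob_space_distr)
  show "sets (path_law W N X Y) = sets (path_space N X)" by (simp add: path_law_def)
qed

locale dual_maximizer =
  fixes N NC :: nat and h :: real and X :: "nat \<Rightarrow> 'a::euclidean_space set"
    and R :: "(nat \<Rightarrow> 'a) measure"
    and B :: "'a \<Rightarrow> 'a \<Rightarrow> real ^ 'k::finite" and G :: "nat \<Rightarrow> 'a \<Rightarrow> real" and \<tau> :: "nat \<Rightarrow> nat"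
    and Fmom :: "nat \<Rightarrow> ('a set \<Rightarrow> real) \<times> ('a set \<Rightarrow> real ^ 'k) \<Rightarrow> ereal"
    and M :: "nat \<Rightarrow> ('a set \<Rightarrow> real) \<Rightarrow> ereal" and C :: "nat \<Rightarrow> real \<Rightarrow> ereal"
    and \<Phi> :: "('a, 'k) potential"
  assumes h: "0 < h" and R: "prob_space R" "sets R = sets (path_space N X)"
    and cont: "\<And>\<Psi> :: ('a, 'k) potential. \<Psi> \<in> potentials N X \<Longrightarrow> Delta N NC h B G \<tau> \<Psi> \<in> Cb (paths N X)"
    and mom: "\<And>k. k < N \<Longrightarrow> admissible_mom (X k) (Fmom k)"
    and marg: "\<And>k. k \<le> N \<Longrightarrow> admissible_marginal (X k) (M k)"
    and price: "\<And>i. i \<in> {1..NC} \<Longrightarrow> admissible_price (C i)"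
    and proper: "\<exists>u\<in>triples N X. Ffun N NC Fmom M C u \<noteq> \<infinity>"
    and max: "is_arg_max (dual_objective N NC X h B G \<tau> Fmom M C R) (\<lambda>\<Psi>. \<Psi> \<in> potentials N X) \<Phi>"
begin

abbreviation "F \<equiv> Ffun N NC Fmom M C"
abbreviation "Fstar \<equiv> Ffun_star N NC X h Fmom M C"
abbreviation "\<Delta> \<equiv> Delta N NC h B G \<tau>"
abbreviation "\<Delta>adj \<equiv> Delta_adj X h B G \<tau>"
abbreviation "pair \<equiv> pairing N NC X h"
abbreviation "Pstar \<equiv> gibbs h R (\<Delta> \<Phi>)"
abbreviation "exp_functional f \<equiv> h * (\<integral>x. exp (f x / h) \<partial>R)"

lemma \<Phi>_pot: "\<Phi> \<in> potentials N X" using max by (simp add: is_arg_max_def)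

lemma paths_nonempty: "paths N X \<noteq> {}"
  using prob_space.not_empty[OF R(1)] sets_eq_imp_space_eq[OF R(2)] by (simp add: space_path_space)

lemma Delta_bounded_measurable:
  assumes "\<Psi> \<in> potentials N X" shows "\<Delta> \<Psi> \<in> bounded_measurable R"
  using Cb_paths_bounded_measurable[OF cont[OF assms]] sets_eq_imp_space_eq[OF R(2)]
  by (simp add: bounded_measurable_def R(2) cong: measurable_cong_sets)

lemma uminus_pot: "\<Psi> \<in> potentials N X \<Longrightarrow> - \<Psi> \<in> potentials N X"
  by (simp add: uminus_potential potentials_lincomb)

lemma Delta_uminus: "\<Delta> (- \<Psi>) x = - \<Delta> \<Psi> x"
  by (simp add: uminus_potential Delta_lincomb)

lemma dual_value:
  assumes "\<Psi> \<in> potentials N X"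
  shows "dual_objective N NC X h B G \<tau> Fmom M C R \<Psi> = - Fstar (- \<Psi>) - ereal (exp_functional (\<Delta> \<Psi>))"
  unfolding dual_objective_def Gfun_star_eq[OF h R Delta_bounded_measurable[OF assms]] ..

lemma closed: "closed_convex comb_triple (triples N X) (pairing_functionals N NC X h) F"
  by (rule closed_convex_Ffun[OF h mom marg price])

interpretation dual_functionals "triples N X" comb_triple "pairing_functionals N NC X h :: (('a, 'k) triple \<Rightarrow> real) set"
  by (rule dual_functionals_pairing)

text \<open>
  Fenchel--Moreau in terms of the Legendre transform: an affine minorant bounds it at its slope.
\<close>

lemma F_minorant:
  assumes "u \<in> triples N X" "ereal a < F u"
  obtains y c where "y \<in> potentials N X" "Fstar y \<le> ereal c" "a < pair y u - c"
proof -
  obtain v where v: "v \<in> triples N X" "F v \<noteq> \<infinity>" using proper by blast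
  obtain l c where l: "l \<in> pairing_functionals N NC X h" "\<And>u. u \<in> triples N X \<Longrightarrow> ereal (l u - c) \<le> F u" "a < l u - c"
    using affine_minorant[OF _ _ _ v assms] closed unfolding closed_convex_def by blast
  then obtain y where y: "y \<in> potentials N X" "l = pair y" by (auto simp: pairing_functionals_def)
  have "Fstar y \<le> ereal c" unfolding Ffun_star_def by (rule legendre_minorant) (use l(2) y in simp)
  with y l(3) that show ?thesis by blast
qed

lemma Fstar_gt_MInf: "Fstar y \<noteq> -\<infinity>"
  using proper legendre_gt_MInf unfolding Ffun_star_def by metis

text \<open>
  A minorant of \<open>F\<close> exhibits a potential at which the dual objective is finite, so its value at a
  maximizer is finite as well.
\<close>

lemma Fstar_finite: obtains A where "Fstar (- \<Phi>) = ereal A"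
proof -
  obtain v where v: "v \<in> triples N X" "F v \<noteq> \<infinity>" using proper by blast
  have "F v \<noteq> -\<infinity>" using closed v(1) by (simp add: closed_convex_def)
  with v(2) have "\<exists>r. ereal r < F v" by (cases "F v") (auto intro: exI[of _ "_ - 1"] lt_ex)
  then obtain r where "ereal r < F v" by blast
  then obtain y c where y: "y \<in> potentials N X" "Fstar y \<le> ereal c"
    using F_minorant[OF v(1)] by blast
  have "\<not> dual_objective N NC X h B G \<tau> Fmom M C R \<Phi> < dual_objective N NC X h B G \<tau> Fmom M C R (- y)"
    using max uminus_pot[OF y(1)] unfolding is_arg_max_def by blast
  then have "- Fstar y - ereal (exp_functional (\<Delta> (- y))) \<le> - Fstar (- \<Phi>) - ereal (exp_functional (\<Delta> \<Phi>))"
    unfolding dual_value[OF uminus_pot[OF y(1)]] dual_value[OF \<Phi>_pot] uminus_uminus_potential by simp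
  with y(2) have "Fstar (- \<Phi>) \<noteq> \<infinity>"
    using Fstar_gt_MInf[of y] by (cases "Fstar y") auto
  with Fstar_gt_MInf[of "- \<Phi>"] that show ?thesis by (cases "Fstar (- \<Phi>)") auto
qed

lemma Pstar_measure: "Pstar \<in> path_measures N X"
  using finite_measure_gibbs[OF h R(1) Delta_bounded_measurable[OF \<Phi>_pot]] R(2)
  by (simp add: path_measures_def sets_gibbs[OF h R(1) Delta_bounded_measurable[OF \<Phi>_pot]])

lemma adjoint:
  assumes "P \<in> path_measures N X" "\<Psi> \<in> potentials N X"
  shows "pair \<Psi> (\<Delta>adj P) = (\<integral>x. \<Delta> \<Psi> x \<partial>P)"
  by (rule Delta_adjoint[OF h paths_nonempty cont assms])

lemma integrable_Delta:
  assumes "P \<in> path_measures N X" "\<Psi> \<in> potentials N X"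
  shows "integrable P (\<Delta> \<Psi>)"
  using assms R(2) by (intro integrable_bounded_measurable[OF Delta_bounded_measurable]) (auto simp: path_measures_def)

text \<open>
  The dual objective is compared at \<open>\<Phi>\<close> and at the point whose negative lies a fraction \<open>t\<close> of the
  way from \<open>-\<Phi>\<close> to \<open>y\<close>.  Convexity of the Legendre transform and the second-order bound on the
  exponential functional give a quadratic in \<open>t\<close> that is nonnegative for small \<open>t\<close>.
\<close>

lemma first_order_condition:
  assumes A: "Fstar (- \<Phi>) = ereal A" and y: "y \<in> potentials N X" and c: "Fstar y = ereal c"
  shows "pair y (\<Delta>adj Pstar) - c \<le> pair (- \<Phi>) (\<Delta>adj Pstar) - A"
proof -
  define f where "f = \<Delta> \<Phi>"
  define g where "g x = - \<Delta> y x - f x" for x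
  have f: "f \<in> bounded_measurable R" unfolding f_def by (rule Delta_bounded_measurable[OF \<Phi>_pot])
  have g: "g \<in> bounded_measurable R"
    using bounded_measurable_lincomb[OF Delta_bounded_measurable[OF y] f, of "- 1" "- 1"]
    by (simp add: g_def[abs_def])
  obtain K where K: "\<And>x. x \<in> space R \<Longrightarrow> \<bar>g x\<bar> \<le> K" using g by (auto simp: bounded_measurable_def)
  \<comment> \<open>A strictly positive bound, since the range of \<open>t\<close> is obtained by dividing by it.\<close>
  define K' where "K' = max K 1"
  have K': "\<And>x. x \<in> space R \<Longrightarrow> \<bar>g x\<bar> \<le> K'" "0 < K'" using K by (force simp: K'_def)+
  define J where "J = (\<integral>x. g x \<partial>gibbs h R f)"
  define Q where "Q = 2 / h * (\<integral>x. g x * g x \<partial>gibbs h R f)"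
  have quadratic: "0 \<le> t * (c - A + J) + t\<^sup>2 * Q" if t: "0 < t" "t \<le> min 1 (h / (2 * K'))" for t
  proof -
    let ?y = "lincomb_potential (1 - t) (- \<Phi>) t y"
    have y': "?y \<in> potentials N X" by (intro potentials_lincomb uminus_pot \<Phi>_pot y)
    have "\<Delta> (- ?y) x = f x + t * g x" for x
      by (simp add: Delta_uminus Delta_lincomb f_def g_def algebra_simps)
    then have D: "\<Delta> (- ?y) = (\<lambda>x. f x + t * g x)" by auto
    have "\<not> dual_objective N NC X h B G \<tau> Fmom M C R \<Phi> < dual_objective N NC X h B G \<tau> Fmom M C R (- ?y)"
      using max uminus_pot[OF y'] unfolding is_arg_max_def by blast
    then have opt: "- Fstar ?y - ereal (exp_functional (\<lambda>x. f x + t * g x)) \<le> - ereal A - ereal (exp_functional f)"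
      unfolding dual_value[OF uminus_pot[OF y']] dual_value[OF \<Phi>_pot] uminus_uminus_potential A D f_def by simp
    have "Fstar ?y \<le> ereal ((1 - t) * A + t * c)"
      unfolding Ffun_star_def
    proof (rule legendre_convex)
      show "pair ?y u = (1 - t) * pair (- \<Phi>) u + t * pair y u" if "u \<in> triples N X" for u
        by (rule pairing_lincomb[OF uminus_pot[OF \<Phi>_pot] y that])
    qed (use A c t in \<open>auto simp: Ffun_star_def\<close>)
    with opt have "A + exp_functional f \<le> (1 - t) * A + t * c + exp_functional (\<lambda>x. f x + t * g x)"
      using Fstar_gt_MInf[of ?y] by (cases "Fstar ?y") auto
    also have "exp_functional (\<lambda>x. f x + t * g x) \<le> exp_functional f + t * J + t\<^sup>2 * Q"
      unfolding J_def Q_def using t K'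
      by (intro exponential_functional_increment[OF h R(1) f g K'(1)]) (auto simp: field_simps)
    finally show ?thesis by (simp add: algebra_simps)
  qed
  have "0 < min 1 (h / (2 * K'))" using h K' by simp
  from nonneg_of_quadratic[OF this quadratic] have "0 \<le> c - A + J" .
  moreover have "J = - pair y (\<Delta>adj Pstar) - pair \<Phi> (\<Delta>adj Pstar)"
  proof -
    note int = integrable_Delta[OF Pstar_measure y] integrable_Delta[OF Pstar_measure \<Phi>_pot]
    have "J = (\<integral>x. - \<Delta> y x - \<Delta> \<Phi> x \<partial>Pstar)" unfolding J_def g_def f_def ..
    also have "\<dots> = (\<integral>x. - \<Delta> y x \<partial>Pstar) - (\<integral>x. \<Delta> \<Phi> x \<partial>Pstar)"
      by (intro Bochner_Integration.integral_diff Bochner_Integration.integrable_minus int)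
    also have "(\<integral>x. - \<Delta> y x \<partial>Pstar) = - (\<integral>x. \<Delta> y x \<partial>Pstar)" by (rule integral_minus)
    finally show ?thesis unfolding adjoint[OF Pstar_measure y] adjoint[OF Pstar_measure \<Phi>_pot] .
  qed
  moreover have "pair (- \<Phi>) (\<Delta>adj Pstar) = - pair \<Phi> (\<Delta>adj Pstar)"
    unfolding adjoint[OF Pstar_measure uminus_pot[OF \<Phi>_pot]] adjoint[OF Pstar_measure \<Phi>_pot] Delta_uminus
    by (rule integral_minus)
  ultimately show ?thesis by simp
qed

text \<open>
  If \<open>F\<close> were larger, an affine minorant would exceed the bound at \<open>\<Delta>\<^sup>\<dagger>P\<^sup>*\<close>, and its slope would
  violate the first-order condition.
\<close>

lemma subgradient:
  assumes A: "Fstar (- \<Phi>) = ereal A"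
  shows "F (\<Delta>adj Pstar) \<le> ereal (pair (- \<Phi>) (\<Delta>adj Pstar) - A)"
proof (rule ccontr)
  assume "\<not> ?thesis"
  then have "ereal (pair (- \<Phi>) (\<Delta>adj Pstar) - A) < F (\<Delta>adj Pstar)" by simp
  moreover have "\<Delta>adj Pstar \<in> triples N X" by (rule Delta_adj_triples[OF h paths_nonempty cont Pstar_measure])
  ultimately obtain y c where y: "y \<in> potentials N X" "Fstar y \<le> ereal c"
      "pair (- \<Phi>) (\<Delta>adj Pstar) - A < pair y (\<Delta>adj Pstar) - c"
    using F_minorant by blast
  obtain c' where c': "Fstar y = ereal c'" using y(2) Fstar_gt_MInf[of y] by (cases "Fstar y") auto
  from first_order_condition[OF A y(1) c'] y(2,3) c' show False by simp
qed

theorem primal_optimality: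
  "is_arg_min (primal_objective N NC X h B G \<tau> Fmom M C R) (\<lambda>P. P \<in> path_measures N X) Pstar
    \<and> (\<forall>Q. is_arg_min (primal_objective N NC X h B G \<tau> Fmom M C R) (\<lambda>P. P \<in> path_measures N X) Q
           \<longrightarrow> Q = Pstar)"
proof -
  let ?obj = "primal_objective N NC X h B G \<tau> Fmom M C R"
  have f: "\<Delta> \<Phi> \<in> bounded_measurable R" by (rule Delta_bounded_measurable[OF \<Phi>_pot])
  obtain A where A: "Fstar (- \<Phi>) = ereal A" by (rule Fstar_finite)
  define v where "v = - A - exp_functional (\<Delta> \<Phi>)"
  have pairP: "pair (- \<Phi>) (\<Delta>adj P) = - (\<integral>x. \<Delta> \<Phi> x \<partial>P)" if "P \<in> path_measures N X" for P
    by (simp add: adjoint[OF that] \<Phi>_pot uminus_pot Delta_uminus)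
  have lower_F: "ereal (- (\<integral>x. \<Delta> \<Phi> x \<partial>P) - A) \<le> F (\<Delta>adj P)" if P: "P \<in> path_measures N X" for P
    using fenchel_young_legendre[OF Delta_adj_triples[OF h paths_nonempty cont P] A[unfolded Ffun_star_def]]
    unfolding pairP[OF P] .
  have lower_G: "ereal ((\<integral>x. \<Delta> \<Phi> x \<partial>P) - exp_functional (\<Delta> \<Phi>)) \<le> Gfun h R P"
    and eq_G: "Gfun h R P = ereal ((\<integral>x. \<Delta> \<Phi> x \<partial>P) - exp_functional (\<Delta> \<Phi>)) \<Longrightarrow> P = Pstar"
    if P: "P \<in> path_measures N X" for P
  proof -
    have P': "finite_measure P" "sets P = sets R" using P R(2) by (auto simp: path_measures_def)
    note ent = entropy_duality[OF h R(1) f P', folded Gfun_def]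
    show "ereal ((\<integral>x. \<Delta> \<Phi> x \<partial>P) - exp_functional (\<Delta> \<Phi>)) \<le> Gfun h R P"
      using ent(1) by (cases "Gfun h R P") auto
    show "Gfun h R P = ereal ((\<integral>x. \<Delta> \<Phi> x \<partial>P) - exp_functional (\<Delta> \<Phi>)) \<Longrightarrow> P = Pstar"
      by (rule ent(2)) simp
  qed
  have lower: "ereal v \<le> ?obj P" if P: "P \<in> path_measures N X" for P
    using add_mono[OF lower_F[OF P] lower_G[OF P]] by (simp add: primal_objective_def v_def)
  have G_Pstar: "Gfun h R Pstar = ereal ((\<integral>x. \<Delta> \<Phi> x \<partial>Pstar) - exp_functional (\<Delta> \<Phi>))"
    using entropy_duality_gibbs[OF h R(1) f, folded Gfun_def] by (cases "Gfun h R Pstar") auto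
  have "?obj Pstar \<le> ereal (- (\<integral>x. \<Delta> \<Phi> x \<partial>Pstar) - A) + ereal ((\<integral>x. \<Delta> \<Phi> x \<partial>Pstar) - exp_functional (\<Delta> \<Phi>))"
    unfolding primal_objective_def G_Pstar
    using subgradient[OF A] unfolding pairP[OF Pstar_measure] by (rule add_right_mono)
  then have upper: "?obj Pstar \<le> ereal v" by (simp add: v_def)
  have arg_min: "is_arg_min ?obj (\<lambda>P. P \<in> path_measures N X) Pstar"
    using Pstar_measure upper lower by (auto simp: is_arg_min_def not_less intro: order_trans)
  moreover have "Q = Pstar" if Q: "is_arg_min ?obj (\<lambda>P. P \<in> path_measures N X) Q" for Q
  proof -
    have Qm: "Q \<in> path_measures N X" and "?obj Q \<le> ?obj Pstar"
      using Q Pstar_measure by (auto simp: is_arg_min_def not_less)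
    then have "F (\<Delta>adj Q) + Gfun h R Q \<le> ereal v" using upper by (simp add: primal_objective_def)
    with lower_F[OF Qm] lower_G[OF Qm]
    have "Gfun h R Q = ereal ((\<integral>x. \<Delta> \<Phi> x \<partial>Q) - exp_functional (\<Delta> \<Phi>))"
      by (cases "F (\<Delta>adj Q)"; cases "Gfun h R Q") (auto simp: v_def)
    then show ?thesis by (rule eq_G[OF Qm])
  qed
  ultimately show ?thesis by blast
qed

end

theorem proposition4p2:
  fixes N NC :: nat and h :: real
    and X :: "nat \<Rightarrow> 'a::euclidean_space set"
    and W :: "'w measure" and \<mu> :: "'a \<Rightarrow> real \<Rightarrow> 'a" and \<sigma> :: "'a \<Rightarrow> real \<Rightarrow> 'a \<Rightarrow>\<^sub>L 'a"
    and \<rho> :: "'a measure" and Z Y :: "nat \<Rightarrow> 'w \<Rightarrow> 'a"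
    and R :: "(nat \<Rightarrow> 'a) measure"
    and B :: "'a \<Rightarrow> 'a \<Rightarrow> real ^ 'k::finite"
    and G :: "nat \<Rightarrow> 'a \<Rightarrow> real" and \<tau> :: "nat \<Rightarrow> nat"
    and Fmom :: "nat \<Rightarrow> ('a set \<Rightarrow> real) \<times> ('a set \<Rightarrow> real ^ 'k) \<Rightarrow> ereal"
    and M :: "nat \<Rightarrow> ('a set \<Rightarrow> real) \<Rightarrow> ereal"
    and C :: "nat \<Rightarrow> real \<Rightarrow> ereal"
    and \<Phi> :: "('a, 'k) potential"
    and Pstar :: "(nat \<Rightarrow> 'a) measure"
  assumes "1 \<le> N" and "1 \<le> NC" and "0 < h"
    and "euler_maruyama_chain W N X h \<mu> \<sigma> \<rho> Z Y"
    and "R = path_law W N X Y"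
    and "\<And>i. i \<in> {1..NC} \<Longrightarrow> \<tau> i \<le> N"
    and "\<And>\<Psi> :: ('a, 'k) potential.
           \<Psi> \<in> potentials N X \<Longrightarrow> Delta N NC h B G \<tau> \<Psi> \<in> Cb (paths N X)"
    and "\<And>k. k < N \<Longrightarrow> admissible_mom (X k) (Fmom k)"
    and "\<And>k. k \<le> N \<Longrightarrow> admissible_marginal (X k) (M k)"
    and "\<And>i. i \<in> {1..NC} \<Longrightarrow> admissible_price (C i)"
    and "\<exists>u\<in>triples N X. Ffun N NC Fmom M C u \<noteq> \<infinity>"
    and "is_arg_max (dual_objective N NC X h B G \<tau> Fmom M C R) (\<lambda>\<Psi>. \<Psi> \<in> potentials N X) \<Phi>"
    and "Pstar = induced_measure N NC h B G \<tau> R \<Phi>"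
    and "\<And>k. k \<le> N \<Longrightarrow> \<bar>M k (fst (Delta_adj X h B G \<tau> Pstar) k)\<bar> \<noteq> \<infinity>"
    and "\<And>i. i \<in> {1..NC} \<Longrightarrow> \<bar>C i (snd (snd (Delta_adj X h B G \<tau> Pstar)) i)\<bar> \<noteq> \<infinity>"
  shows "is_arg_min (primal_objective N NC X h B G \<tau> Fmom M C R) (\<lambda>P. P \<in> path_measures N X) Pstar
    \<and> (\<forall>Q. is_arg_min (primal_objective N NC X h B G \<tau> Fmom M C R) (\<lambda>P. P \<in> path_measures N X) Q
           \<longrightarrow> Q = Pstar)"
proof -
  have "dual_maximizer N NC h X R B G \<tau> Fmom M C \<Phi>"
    by (rule dual_maximizer.intro[OF assms(3) euler_maruyama_path_law[OF assms(4), folded assms(5)] assms(7-12)])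
  from dual_maximizer.primal_optimality[OF this] show ?thesis
    by (simp add: assms(13) induced_measure_def gibbs_def)
qed

end
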